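(* Let $(W_1,S_1)$ and $(W_2,S_2)$ be Coxeter systems of finite rank, and let $(s_1,\dots,s_n)$ be an $n$-tuple with $S_1=\{s_1,\dots,s_k\}$ and $S_2=\{s_{k+1},\dots,s_n\}$. Let $(W,S)$ be the Coxeter system with $W=W_1*W_2$ and $S=S_1\sqcup S_2$. Identify $B_k\times B_{n-k}$ with the subgroup of $B_n$ generated by $\sigma_1,\dots,\sigma_{k-1},\sigma_{k+1},\dots,\sigma_{n-1}$ via $(\sigma_i,1)\mapsto\sigma_i$, $(1,\sigma_j)\mapsto\sigma_{k+j}$. Let $H_1=H(W_1,(s_1,\dots,s_k))$, $H_2=H(W_2,(s_{k+1},\dots,s_n))$, $H=H(W,(s_1,\dots,s_n))$, and similarly $\bar H_1,\bar H_2,\bar H$. Then $H=H_1\times H_2$ and $\bar H=\bar H_1\times\bar H_2$. In particular, if $(W_1,(s_1,\dots,s_k))$ and $(W_2,(s_{k+1},\dots,s_n))$ are well-stabilized, then so is $(W,(s_1,\dots,s_n))$.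
   Context: A Coxeter system $(W,S)$: $W=\langle S\mid (ss')^{m(s,s')}=1\text{ whenever } m(s,s')\neq\infty\rangle$ with $m$ symmetric, $m(s,s)=1$, $m(s,s')\in\{2,3,\dots,\infty\}$ for $s\neq s'$. The free product $W_1*W_2$ with $S_1\sqcup S_2$ is the Coxeter system whose Coxeter matrix restricts to those of $W_1,W_2$ and has $m(s,s')=\infty$ for $s\in S_1$, $s'\in S_2$. The braid group $B_m=\langle\sigma_1,\dots,\sigma_{m-1}\mid \sigma_i\sigma_{i+1}\sigma_i=\sigma_{i+1}\sigma_i\sigma_{i+1},\ \sigma_i\sigma_j=\sigma_j\sigma_i\ (|i-j|\ge2)\rangle$ acts on $G^m$ for any group $G$ (Hurwitz action) by $\sigma_i\cdot(g_1,\dots,g_m)=(g_1,\dots,g_{i-1},g_ig_{i+1}g_i^{-1},g_i,g_{i+2},\dots,g_m)$. The Artin group $\mathrm{Art}(W,S)$ of a Coxeter system with ordered generators $(s_1,\dots,s_n)$ is generated by $\bar s_1,\dots,\bar s_n$ subject to $\bar s_i\bar s_j\bar s_i\cdots=\bar s_j\bar s_i\bar s_j\cdots$ (both sides with $m(s_i,s_j)$ factors) whenever $m(s_i,s_j)\ne\infty$. For a Coxeter system $(V,\{r_1,\dots,r_m\})$ with the ordering $(r_1,\dots,r_m)$, $H(V,(r_1,\dots,r_m))\le B_m$ is the stabilizer of $(r_1,\dots,r_m)\in V^m$ and $\bar H(V,(r_1,\dots,r_m))\le B_m$ is the stabilizer of $(\bar r_1,\dots,\bar r_m)\in\mathrm{Art}(V,\{r_i\})^m$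 under the Hurwitz action; $(V,(r_1,\dots,r_m))$ is well-stabilized if these two subgroups are equal. *)

theory Defs
  imports Main "HOL-Library.Extended_Nat"
begin

text \<open>A letter (a, True) is the generator a, (a, False) is its inverse.\<close>
type_synonym 'a word = "('a \<times> bool) list"

definition winv :: "'a word \<Rightarrow> 'a word" where
  "winv w = rev (map (\<lambda>(a, b). (a, \<not> b)) w)"

inductive pres_eq :: "'a word set \<Rightarrow> 'a word \<Rightarrow> 'a word \<Rightarrow> bool" for R where
  refl: "pres_eq R w w"
| sym: "pres_eq R u w \<Longrightarrow> pres_eq R w u"
| trans: "pres_eq R u v \<Longrightarrow> pres_eq R v w \<Longrightarrow> pres_eq R u w"
| cancel: "pres_eq R (u @ [(a, b), (a, \<not> b)] @ v) (u @ v)"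
| rel: "r \<in> R \<Longrightarrow> pres_eq R (u @ r @ v) (u @ v)"

definition coxeter_matrix :: "nat \<Rightarrow> (nat \<Rightarrow> nat \<Rightarrow> enat) \<Rightarrow> bool" where
  "coxeter_matrix n M \<longleftrightarrow>
     (\<forall>i<n. M i i = 1) \<and> (\<forall>i<n. \<forall>j<n. M i j = M j i) \<and>
     (\<forall>i<n. \<forall>j<n. i \<noteq> j \<longrightarrow> M i j \<ge> 2)"

definition coxeter_rels :: "nat \<Rightarrow> (nat \<Rightarrow> nat \<Rightarrow> enat) \<Rightarrow> nat word set" where
  "coxeter_rels n M = {concat (replicate m [(i, True), (j, True)]) | i j m.
       i < n \<and> j < n \<and> M i j = enat m}"

definition alt_word :: "nat \<Rightarrow> nat \<Rightarrow> nat \<Rightarrow> nat word" where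
  "alt_word i j m = map (\<lambda>t. (if even t then i else j, True)) [0..<m]"

definition artin_rels :: "nat \<Rightarrow> (nat \<Rightarrow> nat \<Rightarrow> enat) \<Rightarrow> nat word set" where
  "artin_rels n M = {alt_word i j m @ winv (alt_word j i m) | i j m.
       i < n \<and> j < n \<and> i \<noteq> j \<and> M i j = enat m}"

definition gen_tuple :: "nat \<Rightarrow> nat word list" where
  "gen_tuple n = map (\<lambda>i. [(i, True)]) [0..<n]"

definition free_prod_matrix ::
  "nat \<Rightarrow> (nat \<Rightarrow> nat \<Rightarrow> enat) \<Rightarrow> (nat \<Rightarrow> nat \<Rightarrow> enat) \<Rightarrow> nat \<Rightarrow> nat \<Rightarrow> enat" where
  "free_prod_matrix k M1 M2 i j =
     (if i < k \<and> j < k then M1 i j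
      else if k \<le> i \<and> k \<le> j then M2 (i - k) (j - k) else \<infinity>)"

text \<open>Braid words for B_m: letter (i, b) is sigma_(i+1)^(+-1), valid iff i+1 < m.\<close>
definition braid_word :: "nat \<Rightarrow> nat word \<Rightarrow> bool" where
  "braid_word m w \<longleftrightarrow> (\<forall>(i, b) \<in> set w. Suc i < m)"

definition braid_rels :: "nat \<Rightarrow> nat word set" where
  "braid_rels m =
     {[(i, True), (Suc i, True), (i, True), (Suc i, False), (i, False), (Suc i, False)] | i.
        Suc (Suc i) < m} \<union>
     {[(i, True), (j, True), (i, False), (j, False)] | i j.
        Suc i < m \<and> Suc j < m \<and> (i + 2 \<le> j \<or> j + 2 \<le> i)}"

abbreviation braid_eq :: "nat \<Rightarrow> nat word \<Rightarrow> nat word \<Rightarrow> bool" where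
  "braid_eq m \<equiv> pres_eq (braid_rels m)"

fun hurwitz_letter :: "nat \<times> bool \<Rightarrow> 'a word list \<Rightarrow> 'a word list" where
  "hurwitz_letter (i, True) t =
     t[i := t ! i @ t ! Suc i @ winv (t ! i), Suc i := t ! i]"
| "hurwitz_letter (i, False) t =
     t[i := t ! Suc i, Suc i := winv (t ! Suc i) @ t ! i @ t ! Suc i]"

fun hurwitz :: "nat word \<Rightarrow> 'a word list \<Rightarrow> 'a word list" where
  "hurwitz [] t = t"
| "hurwitz (x # xs) t = hurwitz_letter x (hurwitz xs t)"

definition stab :: "'a word set \<Rightarrow> nat \<Rightarrow> 'a word list \<Rightarrow> nat word set" where
  "stab R m t = {b. braid_word m b \<and> list_all2 (pres_eq R) (hurwitz b t) t}"

definition Hcox :: "nat \<Rightarrow> (nat \<Rightarrow> nat \<Rightarrow> enat) \<Rightarrow> nat word set" where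
  "Hcox n M = stab (coxeter_rels n M) n (gen_tuple n)"

definition Hart :: "nat \<Rightarrow> (nat \<Rightarrow> nat \<Rightarrow> enat) \<Rightarrow> nat word set" where
  "Hart n M = stab (artin_rels n M) n (gen_tuple n)"

definition well_stabilized :: "nat \<Rightarrow> (nat \<Rightarrow> nat \<Rightarrow> enat) \<Rightarrow> bool" where
  "well_stabilized n M \<longleftrightarrow> Hcox n M = Hart n M"

definition shift_word :: "nat \<Rightarrow> nat word \<Rightarrow> nat word" where
  "shift_word k w = map (\<lambda>(i, b). (i + k, b)) w"

text \<open>The subgroup A \<times> B of B_n, for A \<le> B_k, B \<le> B_(n-k), under the
  identification of B_k \<times> B_(n-k) with a subgroup of B_n.\<close>
definition braid_prod :: "nat \<Rightarrow> nat \<Rightarrow> nat word set \<Rightarrow> nat word set \<Rightarrow> nat word set" where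
  "braid_prod n k A B = {w. braid_word n w \<and>
      (\<exists>u\<in>A. \<exists>v\<in>B. braid_eq n w (u @ shift_word k v))}"

end

theory Submission
  imports Defs "HOL-Library.Function_Algebras" Complex_Main
begin

text \<open>Let F be the free group on x(1), ..., x(n), with Hurwitz action of B(n) on tuples, and let
  c = x(1) \<dots> x(n) = c(1) c(2) be split at position k. Call an element of F simple if it is a product of
  an initial segment of some tuple in the orbit of (x(1), \<dots>, x(n)).

  With respect to F = F(k) * F(n-k), every simple element lies in a factor or is, without
  cancellation and at a syllable boundary, a product of two shorter elements that are simple up to
  inversion. Hence all its syllables are simple up to inversion. A simple element acts nontrivially in
  the geometric representation of W, since otherwise n - 1 reflections would generate W; so its
  syllable length does not drop in W = W(1) * W(2). If b stabilizes (s(1), \<dots>, s(n)), the simple element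
  b(c(1)) has image of syllable length one, and therefore b(c(1)) = c(1). By Artin's
  reduction an element of B(k) \<times> B(n-k) then takes b(x(1), \<dots>, x(n)) back to (x(1), \<dots>, x(n)), and by
  faithfulness of the action on F it is the inverse of b. The stabilizer for the Artin group is
  contained in the one for the Coxeter group.\<close>

section \<open>Presented groups and free groups\<close>

text \<open>The obstacle is the way back from W to F: the hypothesis determines only the image of
  b(c(1)) in W, and a syllable of an arbitrary element of F may die there. Simple elements are a
  class closed (up to inversion) under the cutting that produces syllables, so each syllable can be
  handled by the same dimension count; this is why the syllable statement is proved for all of them
  and not for b(c(1)) alone. Cuts come from first letters. If g and h begin in different factors,
  then the inverse of g times h is reduced as written and meets at a syllable boundary. Hence every
  partial product whose first letter changes sides yields a cut, and passing to tuples of minimal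
  total length makes that side readable from a single strand. The last step needs faithfulness
  because membership in \<open>braid_prod\<close> is an equality in the braid group, whereas the
  argument only produces an equality of actions on F.\<close>

lemma winv_Nil [simp]: "winv [] = []"
  by (simp add: winv_def)

lemma winv_append [simp]: "winv (u @ v) = winv v @ winv u"
  by (simp add: winv_def)

lemma winv_Cons: "winv ((a, b) # v) = winv v @ [(a, \<not> b)]"
  by (simp add: winv_def)

lemma winv_winv [simp]: "winv (winv w) = w"
  by (induction w) (auto simp: winv_Cons)

lemma length_winv [simp]: "length (winv w) = length w"
  by (simp add: winv_def)

lemma set_winv: "set (winv w) = (\<lambda>(a, b). (a, \<not> b)) ` set w"
  by (simp add: winv_def)

lemma winv_eq_Nil_iff [simp]: "winv w = [] \<longleftrightarrow> w = []"
  by (simp add: winv_def)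

lemma pres_eq_ctx: "pres_eq R u v \<Longrightarrow> pres_eq R (p @ u @ q) (p @ v @ q)"
proof (induction rule: pres_eq.induct)
  case (cancel u a b v)
  show ?case using pres_eq.cancel[of R "p @ u" a b "v @ q"] by simp
next
  case (rel r u v)
  show ?case using pres_eq.rel[OF rel, of "p @ u" "v @ q"] by simp
qed (auto intro: pres_eq.intros)

lemma pres_eq_append:
  assumes "pres_eq R u u'" "pres_eq R v v'" shows "pres_eq R (u @ v) (u' @ v')"
proof -
  have "pres_eq R (u @ v) (u' @ v)" using pres_eq_ctx[OF assms(1), of "[]" v] by simp
  moreover have "pres_eq R (u' @ v) (u' @ v')" using pres_eq_ctx[OF assms(2), of u' "[]"] by simp
  ultimately show ?thesis by (rule pres_eq.trans)
qed

lemma pres_eq_right_inv: "pres_eq R (w @ winv w) []"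
proof (induction w)
  case (Cons x w)
  obtain a b where x: "x = (a, b)" by fastforce
  have "pres_eq R ([x] @ (w @ winv w) @ [(a, \<not> b)]) ([x] @ [] @ [(a, \<not> b)])"
    by (rule pres_eq_ctx) fact
  moreover have "pres_eq R [(a, b), (a, \<not> b)] []"
    using pres_eq.cancel[of R "[]" a b "[]"] by simp
  ultimately show ?case by (auto simp: winv_Cons x intro: pres_eq.trans)
qed (simp add: pres_eq.refl)

lemma pres_eq_left_inv: "pres_eq R (winv w @ w) []"
  using pres_eq_right_inv[of R "winv w"] by simp

lemma pres_eq_winv:
  assumes "pres_eq R u v" shows "pres_eq R (winv u) (winv v)"
proof -
  have "pres_eq R (winv u @ v @ winv v) (winv u)"
    using pres_eq_append[OF pres_eq.refl[of R "winv u"] pres_eq_right_inv[of R v]] by simp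
  moreover have "pres_eq R (winv u @ v @ winv v) (winv u @ u @ winv v)"
    using pres_eq_ctx[OF pres_eq.sym[OF assms]] by auto
  moreover have "pres_eq R (winv u @ u @ winv v) (winv v)"
    using pres_eq_append[OF pres_eq_left_inv[of R u] pres_eq.refl[of R "winv v"]] by simp
  ultimately show ?thesis by (meson pres_eq.sym pres_eq.trans)
qed

lemma pres_eq_relator: "r \<in> R \<Longrightarrow> pres_eq R r []"
  using pres_eq.rel[of r R "[]" "[]"] by simp

lemma pres_eq_hom:
  assumes "pres_eq R u v"
    and app: "\<And>x y. f (x @ y) = f x @ f y"
    and canc: "\<And>a b. pres_eq R' (f [(a, b), (a, \<not> b)]) []"
    and rel: "\<And>r. r \<in> R \<Longrightarrow> pres_eq R' (f r) []"
  shows "pres_eq R' (f u) (f v)"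
  using assms(1)
proof (induction rule: pres_eq.induct)
  case (cancel u a b v)
  show ?case using pres_eq_ctx[OF canc, of "f u" a b "f v"] by (simp only: app) (simp flip: app)
next
  case (rel r u v)
  show ?case using pres_eq_ctx[OF assms(4)[OF rel], of "f u" "f v"] by (simp add: app)
qed (auto intro: pres_eq.intros)

text \<open>One quotient type serves all presentations at once: its elements are families
  of words indexed by the relator set.\<close>

definition fam_eq :: "('a word set \<Rightarrow> 'a word) \<Rightarrow> ('a word set \<Rightarrow> 'a word) \<Rightarrow> bool" where
  "fam_eq x y \<longleftrightarrow> (\<forall>R. pres_eq R (x R) (y R))"

quotient_type 'a pgrp = "'a word set \<Rightarrow> 'a word" / fam_eq
  by (rule equivpI) (auto simp: reflp_def symp_def transp_def fam_eq_def intro: pres_eq.intros)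

text \<open>\<open>group_add\<close> does not assume commutativity, so groups are written additively
  from here on: \<open>a + b - a\<close> is a conjugate and \<open>0\<close> the neutral
  element.\<close>

instantiation pgrp :: (type) group_add
begin
lift_definition zero_pgrp :: "'a pgrp" is "\<lambda>R. []" .
lift_definition plus_pgrp :: "'a pgrp \<Rightarrow> 'a pgrp \<Rightarrow> 'a pgrp" is "\<lambda>x y R. x R @ y R"
  by (simp add: fam_eq_def pres_eq_append)
lift_definition uminus_pgrp :: "'a pgrp \<Rightarrow> 'a pgrp" is "\<lambda>x R. winv (x R)"
  by (simp add: fam_eq_def pres_eq_winv)
definition minus_pgrp :: "'a pgrp \<Rightarrow> 'a pgrp \<Rightarrow> 'a pgrp" where "minus_pgrp a b = a + - b"
instance
proof
  fix a b c :: "'a pgrp"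
  show "a + b + c = a + (b + c)" by transfer (simp add: fam_eq_def pres_eq.refl)
  show "0 + a = a" by transfer (simp add: fam_eq_def pres_eq.refl)
  show "a + 0 = a" by transfer (simp add: fam_eq_def pres_eq.refl)
  show "- a + a = 0" by transfer (simp add: fam_eq_def pres_eq_left_inv)
  show "a + - b = a - b" by (simp add: minus_pgrp_def)
qed
end

text \<open>Identifies the group presented by \<open>R\<close> with one factor of the direct product
  over all relator sets, so that groups with different relators share a type.\<close>

lift_definition pr :: "'a word set \<Rightarrow> 'a word \<Rightarrow> 'a pgrp" is
  "\<lambda>R w R'. if R' = R then w else []" .

lemma pr_eq_iff: "pr R u = pr R v \<longleftrightarrow> pres_eq R u v"
  by transfer (auto simp: fam_eq_def pres_eq.refl)

lemma pr_Nil [simp]: "pr R [] = 0"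
  by transfer (auto simp: fam_eq_def pres_eq.refl)

lemma pr_append: "pr R (u @ v) = pr R u + pr R v"
  by transfer (auto simp: fam_eq_def pres_eq.refl)

lemma pr_winv: "pr R (winv u) = - pr R u"
  by transfer (auto simp: fam_eq_def pres_eq.refl)

lemma pr_eq_0_iff: "pr R u = 0 \<longleftrightarrow> pres_eq R u []"
  using pr_eq_iff[of R u "[]"] by simp

lemma pr_letter: "pr R [(a, False)] = - pr R [(a, True)]"
  using pr_winv[of R "[(a, True)]"] by (simp add: winv_def)

lemma pr_Cons: "pr R (x # w) = pr R [x] + pr R w"
  using pr_append[of R "[x]" w] by simp

definition wev :: "('a \<Rightarrow> 'g::group_add) \<Rightarrow> 'a word \<Rightarrow> 'g" where
  "wev f w = sum_list (map (\<lambda>(a, b). if b then f a else - f a) w)"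

lemma wev_Nil [simp]: "wev f [] = 0"
  and wev_Cons: "wev f ((a, b) # w) = (if b then f a else - f a) + wev f w"
  and wev_append [simp]: "wev f (u @ v) = wev f u + wev f v"
  by (simp_all add: wev_def)

lemma wev_winv [simp]: "wev f (winv w) = - wev f w"
  by (induction w) (auto simp: winv_Cons wev_Cons minus_add)

text \<open>Von Dyck's theorem: an assignment that kills the relators factors through the presented
  group.\<close>

lemma wev_pres_eq:
  assumes "pres_eq R u v" "\<And>r. r \<in> R \<Longrightarrow> wev f r = 0" shows "wev f u = wev f v"
  using assms(1)
proof (induction rule: pres_eq.induct)
  case (cancel u a b v) show ?case by (simp add: wev_Cons)
next
  case (rel r u v) then show ?case by (simp add: assms(2))
qed auto

section \<open>Reduced words and the free group\<close>

abbreviation linv :: "'a \<times> bool \<Rightarrow> 'a \<times> bool" where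
  "linv x \<equiv> (fst x, \<not> snd x)"

definition reduced :: "'a word \<Rightarrow> bool" where
  "reduced w \<longleftrightarrow> successively (\<lambda>x y. y \<noteq> linv x) w"

fun rcons :: "'a \<times> bool \<Rightarrow> 'a word \<Rightarrow> 'a word" where
  "rcons x [] = [x]"
| "rcons x (y # w) = (if y = linv x then w else x # y # w)"

definition red :: "'a word \<Rightarrow> 'a word" where
  "red w = foldr rcons w []"

lemma reduced_Nil [simp]: "reduced []" and reduced_single [simp]: "reduced [x]"
  by (simp_all add: reduced_def)

lemma reduced_Cons: "reduced (x # w) \<longleftrightarrow> reduced w \<and> (w \<noteq> [] \<longrightarrow> hd w \<noteq> linv x)"
  by (cases w) (auto simp: reduced_def)

lemma reduced_append: "reduced (u @ v) \<longleftrightarrow>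
    reduced u \<and> reduced v \<and> (u \<noteq> [] \<and> v \<noteq> [] \<longrightarrow> hd v \<noteq> linv (last u))"
  by (auto simp: reduced_def successively_append_iff)

lemma reduced_winv: "reduced (winv w) \<longleftrightarrow> reduced w"
proof -
  have *: "reduced w \<Longrightarrow> reduced (winv w)" for w :: "'a word"
    unfolding reduced_def winv_def successively_rev successively_map
    by (erule successively_mono) (auto simp: case_prod_beta prod_eq_iff)
  from *[of w] *[of "winv w"] show ?thesis by auto
qed

lemma reduced_rcons: "reduced w \<Longrightarrow> reduced (rcons x w)"
  by (cases w) (auto simp: reduced_Cons)

lemma reduced_red: "reduced (red w)"
  by (induction w) (auto simp: red_def reduced_rcons)

text \<open>Van der Waerden's trick: letters act on reduced words, and inverse letters act by
  inverse maps. Thus \<open>red\<close> is invariant under cancellation, which gives the uniqueness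
  of reduced forms in \<open>free_eq_iff\<close>.\<close>

lemma rcons_rcons: "reduced w \<Longrightarrow> rcons x (rcons (linv x) w) = w"
  by (cases w; cases "tl w") (auto simp: reduced_Cons prod_eq_iff)

lemma red_Cons: "red (x # w) = rcons x (red w)"
  by (simp add: red_def)

lemma red_reduced: "reduced w \<Longrightarrow> red w = w"
proof (induction w)
  case (Cons x w)
  then show ?case by (cases w) (auto simp: red_Cons reduced_Cons)
qed (simp add: red_def)

lemma red_append_cong: "red v = red v' \<Longrightarrow> red (u @ v) = red (u @ v')"
  by (simp add: red_def)

lemma pres_eq_rcons: "pres_eq R (x # w) (rcons x w)"
proof (cases w)
  case (Cons y v)
  show ?thesis
  proof (cases "y = linv x")
    case True
    then show ?thesis using pres_eq.cancel[of R "[]" "fst x" "snd x" v] Cons by simp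
  qed (simp add: Cons pres_eq.refl)
qed (simp add: pres_eq.refl)

lemma pres_eq_red: "pres_eq R w (red w)"
proof (induction w)
  case (Cons x w)
  have "pres_eq R (x # w) (x # red w)" using pres_eq_append[OF pres_eq.refl[of R "[x]"] Cons] by simp
  then show ?case unfolding red_Cons by (rule pres_eq.trans) (rule pres_eq_rcons)
qed (simp add: red_def pres_eq.refl)

lemma free_eq_iff: "pres_eq {} u v \<longleftrightarrow> red u = red v"
proof
  show "red u = red v" if "pres_eq {} u v" using that
  proof (induction rule: pres_eq.induct)
    case (cancel u a b v)
    have "red ([(a, b), (a, \<not> b)] @ v) = red v"
      using rcons_rcons[OF reduced_red, of "(a, b)" v] by (simp add: red_Cons)
    then show ?case by (rule red_append_cong)
  qed auto
  show "pres_eq {} u v" if "red u = red v"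
    using pres_eq_red[of "{}" u] pres_eq_red[of "{}" v] that by (metis pres_eq.sym pres_eq.trans)
qed

\<comment> \<open>A type of its own and not \<open>pgrp\<close> at the empty relator set: here every
  element is the class of a single word, so that \<open>rd\<close> is an injective normal
  form.\<close>
quotient_type fgrp = "nat word" / "pres_eq {}"
  by (rule equivpI) (auto simp: reflp_def symp_def transp_def intro: pres_eq.intros)

instantiation fgrp :: group_add
begin
lift_definition zero_fgrp :: fgrp is "[]" .
lift_definition plus_fgrp :: "fgrp \<Rightarrow> fgrp \<Rightarrow> fgrp" is "(@)" by (rule pres_eq_append)
lift_definition uminus_fgrp :: "fgrp \<Rightarrow> fgrp" is winv by (rule pres_eq_winv)
definition minus_fgrp :: "fgrp \<Rightarrow> fgrp \<Rightarrow> fgrp" where "minus_fgrp a b = a + - b"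
instance
proof
  fix a b c :: fgrp
  show "a + b + c = a + (b + c)" by transfer (simp add: pres_eq.refl)
  show "0 + a = a" by transfer (simp add: pres_eq.refl)
  show "a + 0 = a" by transfer (simp add: pres_eq.refl)
  show "- a + a = 0" by transfer (simp add: pres_eq_left_inv)
  show "a + - b = a - b" by (simp add: minus_fgrp_def)
qed
end

lift_definition fg :: "nat word \<Rightarrow> fgrp" is "\<lambda>w. w" .
lift_definition rd :: "fgrp \<Rightarrow> nat word" is red by (simp add: free_eq_iff)
lift_definition fev :: "(nat \<Rightarrow> 'g::group_add) \<Rightarrow> fgrp \<Rightarrow> 'g" is wev
  by (rule wev_pres_eq) auto

definition gx :: "nat \<Rightarrow> fgrp" where "gx i = fg [(i, True)]"

lemma fg_append: "fg (u @ v) = fg u + fg v" by transfer (simp add: pres_eq.refl)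
lemma fg_Nil [simp]: "fg [] = 0" by transfer (simp add: pres_eq.refl)
lemma fg_winv: "fg (winv u) = - fg u" by transfer (simp add: pres_eq.refl)
lemma fg_eq_iff: "fg u = fg v \<longleftrightarrow> pres_eq {} u v" by transfer simp
lemma fg_rd [simp]: "fg (rd g) = g" by transfer (meson pres_eq.sym pres_eq_red)
lemma rd_fg: "rd (fg w) = red w" by transfer simp
lemma reduced_rd [simp]: "reduced (rd g)" by transfer (rule reduced_red)
lemma rd_fg_reduced: "reduced w \<Longrightarrow> rd (fg w) = w" by (simp add: rd_fg red_reduced)
lemma rd_inject: "rd a = rd b \<longleftrightarrow> a = b" by (metis fg_rd)
lemma rd_0 [simp]: "rd 0 = []" using rd_fg_reduced[of "[]"] by simp
lemma rd_eq_Nil_iff [simp]: "rd a = [] \<longleftrightarrow> a = 0" by (metis rd_0 rd_inject)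
lemma rd_uminus: "rd (- a) = winv (rd a)"
  by (metis fg_rd fg_winv rd_fg_reduced reduced_rd reduced_winv)
lemma rd_add: "reduced (rd a @ rd b) \<Longrightarrow> rd (a + b) = rd a @ rd b"
  by (metis fg_append fg_rd rd_fg_reduced)
lemma rd_gx [simp]: "rd (gx i) = [(i, True)]"
  by (simp add: gx_def rd_fg_reduced)

lemma fev_add [simp]: "fev f (a + b) = fev f a + fev f b" by transfer simp
lemma fev_0 [simp]: "fev f 0 = 0" by transfer simp
lemma fev_uminus [simp]: "fev f (- a) = - fev f a" by transfer simp
lemma fev_diff [simp]: "fev f (a - b) = fev f a - fev f b"
  using fev_add[of f a "- b"] fev_uminus[of f b] by (metis add_uminus_conv_diff)
lemma fev_fg: "fev f (fg w) = wev f w" by transfer simp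
lemma fev_gx [simp]: "fev f (gx i) = f i" by (simp add: gx_def fev_fg wev_Cons)
lemma fev_sum_list: "fev f (sum_list L) = sum_list (map (fev f) L)"
  by (induction L) auto

lemma wev_gx: "wev gx w = fg w"
proof (induction w)
  case (Cons x w)
  obtain a b where x: "x = (a, b)" by fastforce
  have "fg [(a, False)] = - gx a" unfolding gx_def fg_winv[symmetric] by (simp add: winv_def)
  then have "fg [x] = (if b then gx a else - gx a)" by (cases b) (auto simp: x gx_def)
  then show ?case using Cons fg_append[of "[x]" w] by (simp add: x wev_Cons)
qed simp

lemma cancel_decomp:
  assumes "reduced u" "reduced v"
  obtains u' c v' where "u = u' @ c" "v = winv c @ v'" "reduced (u' @ v')"
proof -
  have "\<exists>u' c v'. u = u' @ c \<and> v = winv c @ v' \<and> reduced (u' @ v')"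
    using assms
  proof (induction u arbitrary: v rule: rev_induct)
    case Nil then show ?case by (intro exI[of _ "[]"] exI[of _ v]) auto
  next
    case (snoc x u)
    show ?case
    proof (cases "v \<noteq> [] \<and> hd v = linv x")
      case True
      then obtain v1 where v: "v = linv x # v1" by (cases v) auto
      have "reduced u" "reduced v1" using snoc.prems v by (auto simp: reduced_append reduced_Cons)
      then obtain u' c v' where "u = u' @ c" "v1 = winv c @ v'" "reduced (u' @ v')"
        using snoc.IH by blast
      then show ?thesis
        by (intro exI[of _ u'] exI[of _ "c @ [x]"] exI[of _ v']) (cases x, auto simp: v winv_Cons)
    next
      case False
      then have "u @ [x] = (u @ [x]) @ [] \<and> v = winv [] @ v \<and> reduced ((u @ [x]) @ v)"
        using snoc.prems by (auto simp: reduced_append reduced_Cons)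
      then show ?thesis by blast
    qed
  qed
  then show ?thesis using that by blast
qed

text \<open>\<open>c\<close> is exactly what cancels in the product; later comparisons of lengths
  and first letters use this form.\<close>

lemma rd_add_decomp:
  obtains u c v where "rd a = u @ c" "rd b = winv c @ v" "rd (a + b) = u @ v"
proof -
  obtain u c v where *: "rd a = u @ c" "rd b = winv c @ v" "reduced (u @ v)"
    using cancel_decomp[OF reduced_rd[of a] reduced_rd[of b]] by blast
  have "a = fg u + fg c" "b = - fg c + fg v"
    using * by (metis fg_rd fg_append, metis fg_rd fg_append fg_winv)
  then have "a + b = fg u + fg v" by (simp add: add.assoc)
  then have "rd (a + b) = u @ v" using rd_fg_reduced[OF *(3)] by (simp add: fg_append)
  then show ?thesis using that * by blast
qed

section \<open>The Hurwitz action\<close>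

lemmas grp_simps = diff_conv_add_uminus add.assoc minus_add

text \<open>\<open>hurwitz_letter\<close> acts on words, where a letter and its inverse cancel only
  up to \<open>pres_eq\<close>. On group elements the braid relations become equations between
  tuples, and \<open>map_hurwitz\<close> passes from one to the other.\<close>

fun hzl :: "nat \<times> bool \<Rightarrow> 'g::group_add list \<Rightarrow> 'g list" where
  "hzl (i, True) t = t[i := t ! i + t ! Suc i - t ! i, Suc i := t ! i]"
| "hzl (i, False) t = t[i := t ! Suc i, Suc i := - t ! Suc i + t ! i + t ! Suc i]"

definition hz :: "nat word \<Rightarrow> 'g::group_add list \<Rightarrow> 'g list" where
  "hz w t = foldr hzl w t"

lemma hz_Nil [simp]: "hz [] t = t"
  and hz_Cons: "hz (x # w) t = hzl x (hz w t)"
  and hz_append: "hz (u @ v) t = hz u (hz v t)"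
  by (simp_all add: hz_def)

lemma length_hzl [simp]: "length (hzl x t) = length t"
  by (cases "(x, t)" rule: hzl.cases) auto

lemma length_hz [simp]: "length (hz w t) = length t"
  by (induction w) (auto simp: hz_Cons)

lemma braid_word_Nil [simp]: "braid_word n []"
  and braid_word_Cons: "braid_word n (x # w) \<longleftrightarrow> Suc (fst x) < n \<and> braid_word n w"
  and braid_word_append [simp]: "braid_word n (u @ v) \<longleftrightarrow> braid_word n u \<and> braid_word n v"
  by (auto simp: braid_word_def)

lemma braid_word_winv [simp]: "braid_word n (winv w) \<longleftrightarrow> braid_word n w"
  by (auto simp: braid_word_def set_winv)

lemma braid_word_mono: "braid_word m w \<Longrightarrow> m \<le> n \<Longrightarrow> braid_word n w"
  by (auto simp: braid_word_def)

lemma hzl_inv: "Suc i < length t \<Longrightarrow> hzl (i, b) (hzl (i, \<not> b) t) = t"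
  by (cases b) (auto intro!: nth_equalityI simp: nth_list_update grp_simps simp del: add_uminus_conv_diff)

lemma hz_winv: "braid_word (length t) w \<Longrightarrow> hz (winv w) (hz w t) = t"
proof (induction w)
  case (Cons x w)
  obtain a b where x: "x = (a, b)" by fastforce
  then show ?case using Cons hzl_inv[of a "hz w t" "\<not> b"]
    by (simp add: winv_Cons hz_append hz_Cons braid_word_Cons)
qed simp

lemma hz_winv': "braid_word (length t) w \<Longrightarrow> hz w (hz (winv w) t) = t"
  using hz_winv[of t "winv w"] by simp

lemma list_split2:
  assumes "Suc i < length t"
  obtains A a b B where "t = A @ a # b # B" "length A = i"
proof -
  have "t = take i t @ drop i t" by simp
  moreover have "drop i t = t ! i # t ! Suc i # drop (Suc (Suc i)) t"
    using assms by (simp add: Cons_nth_drop_Suc)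
  ultimately show ?thesis using that[of "take i t"] assms by force
qed

lemma hzl_True: "hzl (length A, True) (A @ a # b # B) = A @ (a + b - a) # a # B"
  and hzl_False: "hzl (length A, False) (A @ a # b # B) = A @ b # (- b + a + b) # B"
  by (simp_all add: list_update_append nth_append)

lemma sum_list_hzl: "Suc i < length t \<Longrightarrow> sum_list (hzl (i, b) t) = sum_list t"
  by (erule list_split2; cases b; hypsubst)
    (simp_all only: hzl_True hzl_False, simp_all add: grp_simps del: add_uminus_conv_diff)

lemma sum_list_hz: "braid_word (length t) w \<Longrightarrow> sum_list (hz w t) = sum_list t"
  by (induction w) (auto simp: hz_Cons braid_word_Cons sum_list_hzl)

lemma hzl_append1: "Suc i < length L \<Longrightarrow> hzl (i, b) (L @ R) = hzl (i, b) L @ R"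
  by (cases b) (auto simp: list_update_append nth_append)

lemma hzl_append2: "Suc i < length R \<Longrightarrow> hzl (i + length L, b) (L @ R) = L @ hzl (i, b) R"
  by (cases b) (auto simp: list_update_append nth_append)

lemma hz_append1: "braid_word (length L) w \<Longrightarrow> hz w (L @ R) = hz w L @ R"
  by (induction w) (auto simp: hz_Cons braid_word_Cons hzl_append1)

lemma shift_word_Cons: "shift_word k (x # w) = (fst x + k, snd x) # shift_word k w"
  and shift_word_Nil [simp]: "shift_word k [] = []"
  and shift_word_append [simp]: "shift_word k (u @ v) = shift_word k u @ shift_word k v"
  by (auto simp: shift_word_def case_prod_beta)

lemma shift_word_winv: "shift_word k (winv w) = winv (shift_word k w)"
  by (induction w) (auto simp: shift_word_Cons winv_Cons)

lemma hz_append2: "braid_word (length R) w \<Longrightarrow> hz (shift_word (length L) w) (L @ R) = L @ hz w R"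
  by (induction w) (auto simp: hz_Cons braid_word_Cons shift_word_Cons hzl_append2)

lemma braid_word_shift: "braid_word m w \<Longrightarrow> k + m \<le> n \<Longrightarrow> braid_word n (shift_word k w)"
  by (induction w) (auto simp: braid_word_Cons shift_word_Cons)

lemma map_hzl:
  assumes "\<And>a b. f (a + b) = f a + f b" "\<And>a. f (- a) = - f a" "Suc i < length t"
  shows "map f (hzl (i, b) t) = hzl (i, b) (map f t)"
proof -
  have "f (a - b) = f a - f b" for a b using assms(1)[of a "- b"] assms(2)[of b] by simp
  then show ?thesis using assms by (cases b) (auto simp: map_update nth_append)
qed

lemma map_hz:
  assumes "\<And>a b. f (a + b) = f a + f b" "\<And>a. f (- a) = - f a" "braid_word (length t) w"
  shows "map f (hz w t) = hz w (map f t)"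
  using assms(3)
proof (induction w)
  case (Cons x w)
  then show ?case using map_hzl[of f "fst x" "hz w t" "snd x", OF assms(1,2)]
    by (simp add: hz_Cons braid_word_Cons)
qed simp

lemma length_hurwitz_letter [simp]: "length (hurwitz_letter x t) = length t"
  by (cases "(x, t)" rule: hurwitz_letter.cases) auto

lemma length_hurwitz [simp]: "length (hurwitz w t) = length t"
  by (induction w) auto

lemma map_hurwitz:
  fixes f :: "'a word \<Rightarrow> 'g::group_add"
  assumes app: "\<And>a b. f (a @ b) = f a + f b" and winv: "\<And>a. f (winv a) = - f a"
    and "braid_word (length t) w"
  shows "map f (hurwitz w t) = hz w (map f t)"
  using assms(3)
proof (induction w)
  case (Cons x w)
  have *: "Suc i < length s \<Longrightarrow> map f (hurwitz_letter (i, b) s) = hzl (i, b) (map f s)" for i b s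
    by (cases b) (auto simp: map_update app winv grp_simps simp del: add_uminus_conv_diff)
  then show ?case using Cons *[of "fst x" "hurwitz w t" "snd x"] by (simp add: hz_Cons braid_word_Cons)
qed simp

lemmas map_pr_hurwitz = map_hurwitz[OF pr_append pr_winv]
lemmas map_fg_hurwitz = map_hurwitz[OF fg_append fg_winv]

lemma hzl_braid:
  assumes "Suc (Suc i) < length t"
  shows "hz [(i, True), (Suc i, True), (i, True)] t = hz [(Suc i, True), (i, True), (Suc i, True)] t"
  using assms by (auto intro!: nth_equalityI simp: hz_Cons nth_list_update grp_simps simp del: add_uminus_conv_diff)

lemma hzl_commute:
  assumes "Suc i < length t" "Suc j < length t" "i + 2 \<le> j \<or> j + 2 \<le> i"
  shows "hz [(i, True), (j, True)] t = hz [(j, True), (i, True)] t"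
  using assms by (auto intro!: nth_equalityI simp: hz_Cons nth_list_update)

lemma braid_word_braid_rels: "r \<in> braid_rels n \<Longrightarrow> braid_word n r"
  by (auto simp: braid_rels_def braid_word_Cons)

lemma hz_braid_rels:
  fixes t :: "'a::group_add list"
  assumes "r \<in> braid_rels n" "length t = n" shows "hz r t = t"
proof -
  \<comment> \<open>Both kinds of relator have the form \<open>u @ winv v\<close>, so it suffices
    that \<open>u\<close> and \<open>v\<close> agree on tuples.\<close>
  have *: "hz (u @ winv v) t = t"
    if "braid_word n u" "braid_word n v" "\<And>s :: 'a list. length s = n \<Longrightarrow> hz u s = hz v s" for u v
    using that(3)[of "hz (winv v) t"] hz_winv'[of t v] that(2) assms(2) by (simp add: hz_append)
  from assms(1) consider
      i where "r = [(i, True), (Suc i, True), (i, True)] @ winv [(Suc i, True), (i, True), (Suc i, True)]"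
        "Suc (Suc i) < n"
    | i j where "r = [(i, True), (j, True)] @ winv [(j, True), (i, True)]"
        "Suc i < n" "Suc j < n" "i + 2 \<le> j \<or> j + 2 \<le> i"
    by (auto simp: braid_rels_def winv_def)
  then show ?thesis
  proof cases
    case 1 then show ?thesis by (simp only:) (rule *, auto simp: braid_word_Cons intro!: hzl_braid)
  next
    case 2 then show ?thesis by (simp only:) (rule *, auto simp: braid_word_Cons intro!: hzl_commute)
  qed
qed

text \<open>A derivation of \<^term>\<open>braid_eq n u v\<close> may pass through words with letters outside
  the valid range, on which the action is junk; such letters are filtered out first.\<close>

lemma hz_braid_eq:
  fixes t :: "'a::group_add list"
  assumes "braid_eq n u v" "braid_word n u" "braid_word n v" "length t = n"
  shows "hz u t = hz v t"
proof -
  define f where "f = filter (\<lambda>x :: nat \<times> bool. Suc (fst x) < n)"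
  have f: "braid_word n w \<Longrightarrow> f w = w" for w
    unfolding f_def braid_word_def by (rule filter_True) auto
  have app: "f (x @ y) = f x @ f y" for x y by (simp add: f_def)
  have "length t = n \<Longrightarrow> hz (f u) t = hz (f v) t" for t :: "'a list"
    using assms(1)
  proof (induction arbitrary: t rule: pres_eq.induct)
    case (cancel u a b v)
    have "hz (f [(a, b), (a, \<not> b)]) s = s" if "length s = n" for s :: "'a list"
      using that hzl_inv[of a s b] by (simp add: f_def hz_Cons)
    then have *: "hz (f [(a, b), (a, \<not> b)]) (hz (f v) t) = hz (f v) t" using cancel by simp
    show ?case unfolding app hz_append * ..
  next
    case (rel r u v)
    then show ?case using f[OF braid_word_braid_rels, of r] hz_braid_rels[of r n "hz (f v) t"]
      by (simp add: app hz_append)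
  qed auto
  then show ?thesis using assms f by simp
qed

section \<open>Hurwitz equivalence of tuples\<close>

definition heq :: "'g::group_add list \<Rightarrow> 'g list \<Rightarrow> bool" where
  "heq t t' \<longleftrightarrow> (\<exists>w. braid_word (length t) w \<and> hz w t = t')"

lemma heq_refl [simp]: "heq t t"
  unfolding heq_def by (rule exI[of _ "[]"]) simp

lemma heq_length: "heq t t' \<Longrightarrow> length t' = length t"
  by (auto simp: heq_def)

lemma heq_sum_list: "heq t t' \<Longrightarrow> sum_list t' = sum_list t"
  by (auto simp: heq_def sum_list_hz)

lemma heq_trans [trans]: "heq s t \<Longrightarrow> heq t u \<Longrightarrow> heq s u"
  unfolding heq_def by (metis braid_word_append hz_append length_hz)

lemma heq_sym: "heq s t \<Longrightarrow> heq t s"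
  unfolding heq_def using braid_word_winv hz_winv length_hz by metis

lemma heq_append1: "heq L L' \<Longrightarrow> heq (L @ R) (L' @ R)"
  unfolding heq_def by (metis hz_append1 braid_word_mono le_add1 length_append)

lemma heq_append2: "heq R R' \<Longrightarrow> heq (L @ R) (L @ R')"
  unfolding heq_def using hz_append2 braid_word_shift[of "length R" _ "length L" "length (L @ R)"]
  by (metis length_append order_refl)

lemma heq_ctx: "heq t t' \<Longrightarrow> heq (L @ t @ R) (L @ t' @ R)"
  by (intro heq_append1 heq_append2)

lemma heq_step: "heq [a, b] [a + b - a, a]"
  unfolding heq_def by (rule exI[of _ "[(0, True)]"]) (simp add: hz_Cons braid_word_Cons)

lemma heq_move_left: "heq (B @ [x]) ((sum_list B + x - sum_list B) # B)"
proof (induction B arbitrary: x rule: rev_induct)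
  case (snoc b B)
  have "heq ((B @ [b]) @ [x]) (B @ [b + x - b] @ [b])"
    using heq_append2[OF heq_step[of b x], of B] by simp
  also have "heq (B @ [b + x - b] @ [b]) ((sum_list B + (b + x - b) - sum_list B) # B @ [b])"
    using heq_append1[OF snoc, of "b + x - b" "[b]"] by simp
  finally show ?case by (simp add: grp_simps del: add_uminus_conv_diff)
qed simp

text \<open>The strands of \<open>R\<close> cross \<open>L\<close> one by one with
  \<open>heq_move_left\<close>, each being conjugated by the product of \<open>L\<close>.\<close>

lemma heq_block_left:
  "heq (L @ R) (map (\<lambda>y. sum_list L + y - sum_list L) R @ L)"
proof (induction R)
  case (Cons x R)
  have "heq ((L @ [x]) @ R) (((sum_list L + x - sum_list L) # L) @ R)"
    by (rule heq_append1) (rule heq_move_left)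
  also have "heq \<dots> ([sum_list L + x - sum_list L] @ (map (\<lambda>y. sum_list L + y - sum_list L) R @ L))"
    using heq_append2[OF Cons, of "[sum_list L + x - sum_list L]"] by simp
  finally show ?case by simp
qed simp

lemma heq_block_right:
  "heq (L @ R) (R @ map (\<lambda>y. - sum_list R + y + sum_list R) L)"
proof (rule heq_sym)
  show "heq (R @ map (\<lambda>y. - sum_list R + y + sum_list R) L) (L @ R)"
    using heq_block_left[of R "map (\<lambda>y. - sum_list R + y + sum_list R) L"]
    by (simp add: comp_def grp_simps del: add_uminus_conv_diff)
qed

lemma heq_move_right: "heq (x # B) (B @ [- sum_list B + x + sum_list B])"
  using heq_block_right[of "[x]" B] by simp

section \<open>Faithfulness of the Artin representation\<close>

lemma grp_swap:
  fixes x :: "'a::group_add"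
  assumes "x + y = z + w" shows "- z + x = w - y"
proof -
  have "- z + (x + y) - y = - z + (z + w) - y" using assms by simp
  then show ?thesis by (simp add: grp_simps del: add_uminus_conv_diff)
qed

section \<open>Combing: a normal form for braids\<close>

locale braid_gens =
  fixes m :: nat and b :: "nat \<Rightarrow> 'g::group_add"
  assumes braid: "Suc i < m \<Longrightarrow> b i + b (Suc i) + b i = b (Suc i) + b i + b (Suc i)"
    and commute: "i < m \<Longrightarrow> j < m \<Longrightarrow> i + 2 \<le> j \<Longrightarrow> b i + b j = b j + b i"
begin

text \<open>The product b(m-1) ... b(j). For braid generators it carries the strand at position j to
  the last position m; the inverses of \<open>C 0\<close>, ..., \<open>C m\<close> represent the
  cosets of the braids that keep the last strand in its place.\<close>

definition C :: "nat \<Rightarrow> 'g" where "C j = sum_list (map b (rev [j..<m]))"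

text \<open>For i < m one has \<open>C i = C (Suc i) + b i\<close>, so this is a conjugate of twice
  \<open>b i\<close>: the pure braid in which the last strand encircles strand i. These elements
  account for what is lost when the last strand is forgotten.\<close>

definition a :: "nat \<Rightarrow> 'g" where "a i = C i + b i - C (Suc i)"

lemma C_step: "j < m \<Longrightarrow> C j = C (Suc j) + b j"
  by (simp add: C_def upt_conv_Cons)

lemma C_m [simp]: "C m = 0"
  by (simp add: C_def)

lemma b_C_far: "Suc i < j \<Longrightarrow> j \<le> m \<Longrightarrow> b i + C j = C j + b i"
proof (induction "m - j" arbitrary: j)
  case (Suc d)
  then have "j < m" by simp
  have IH: "b i + C (Suc j) = C (Suc j) + b i" using Suc by simp
  have "b i + C j = C (Suc j) + (b i + b j)"
    using IH by (simp add: C_step[OF \<open>j < m\<close>] add.assoc[symmetric])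
  also have "\<dots> = C (Suc j) + (b j + b i)" using commute[of i j] Suc \<open>j < m\<close> by simp
  finally show ?case by (simp add: C_step[OF \<open>j < m\<close>] add.assoc)
qed simp

text \<open>Conjugation by \<open>C j\<close> shifts the index by one. The case i = j comes from the
  braid relation; for smaller j the additional factor \<open>b j\<close> commutes with
  \<open>b (Suc i)\<close>.\<close>

lemma b_C_near: "j \<le> i \<Longrightarrow> Suc i < m \<Longrightarrow> b i + C j = C j + b (Suc i)"
proof (induction "i - j" arbitrary: j)
  case 0
  then have [simp]: "j = i" by simp
  have C: "C i = C (Suc (Suc i)) + b (Suc i) + b i" using 0 by (simp add: C_step)
  have "b i + C i = C (Suc (Suc i)) + (b i + b (Suc i) + b i)"
    using b_C_far[of i "Suc (Suc i)"] 0 by (simp add: C add.assoc[symmetric])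
  also have "\<dots> = C (Suc (Suc i)) + (b (Suc i) + b i + b (Suc i))" using braid 0 by simp
  finally show ?case by (simp add: C add.assoc)
next
  case (Suc d)
  then have "j < m" by simp
  have IH: "b i + C (Suc j) = C (Suc j) + b (Suc i)" using Suc by simp
  have "b i + C j = C (Suc j) + (b (Suc i) + b j)"
    using IH by (simp add: C_step[OF \<open>j < m\<close>] add.assoc[symmetric])
  also have "\<dots> = C (Suc j) + (b j + b (Suc i))" using commute[of j "Suc i"] Suc by simp
  finally show ?case by (simp add: C_step[OF \<open>j < m\<close>] add.assoc)
qed

lemma b_a_far:
  assumes "Suc i < m" "l < m" "l < i \<or> Suc i < l" shows "b i + a l = a l + b i"
  using assms(3)
proof
  assume l: "l < i"
  have "b i + a l = C l + (b (Suc i) + b l) - C (Suc l)"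
    using b_C_near[of l i] assms l 
    by (simp add: a_def grp_simps(1) add.assoc[symmetric] del: add_uminus_conv_diff)
  also have "b (Suc i) + b l = b l + b (Suc i)" using commute[of l "Suc i"] assms l by simp
  also have "C l + (b l + b (Suc i)) - C (Suc l) = C l + b l + (b (Suc i) - C (Suc l))"
    by (simp add: grp_simps del: add_uminus_conv_diff)
  also have "b (Suc i) - C (Suc l) = - C (Suc l) + b i"
    using grp_swap[OF b_C_near[of "Suc l" i]] assms l by simp
  finally show ?thesis by (simp add: a_def grp_simps del: add_uminus_conv_diff)
next
  assume l: "Suc i < l"
  have "b i + a l = C l + (b i + b l) - C (Suc l)"
    using b_C_far[of i l] assms l 
    by (simp add: a_def grp_simps(1) add.assoc[symmetric] del: add_uminus_conv_diff)
  also have "b i + b l = b l + b i" using commute[of i l] assms l by simp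
  also have "C l + (b l + b i) - C (Suc l) = C l + b l + (b i - C (Suc l))"
    by (simp add: grp_simps del: add_uminus_conv_diff)
  also have "b i - C (Suc l) = - C (Suc l) + b i"
    using grp_swap[OF b_C_far[of i "Suc l"]] assms l by simp
  finally show ?thesis by (simp add: a_def grp_simps del: add_uminus_conv_diff)
qed

lemma b_a_up:
  assumes "Suc i < m" shows "b i + a i = a (Suc i) + b i"
proof -
  let ?D = "C (Suc (Suc i))"
  have C1: "C (Suc i) = ?D + b (Suc i)" using assms by (simp add: C_step)
  have C0: "C i = C (Suc i) + b i" using assms by (simp add: C_step)
  have "b i + a i = (b i + C i) + b i - C (Suc i)"
    by (simp add: a_def grp_simps del: add_uminus_conv_diff)
  also have "\<dots> = C i + b (Suc i) + b i - C (Suc i)"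
    using b_C_near[of i i] assms by simp
  also have "\<dots> = C (Suc i) + (b i + b (Suc i) + b i) - b (Suc i) - ?D"
    by (simp add: C0 C1 grp_simps del: add_uminus_conv_diff)
  also have "\<dots> = C (Suc i) + b (Suc i) + (b i - ?D)"
    unfolding braid[OF assms] by (simp add: grp_simps del: add_uminus_conv_diff)
  also have "b i - ?D = - ?D + b i"
    using grp_swap[OF b_C_far[of i "Suc (Suc i)"]] assms by simp
  finally show ?thesis by (simp add: a_def grp_simps del: add_uminus_conv_diff)
qed

text \<open>Together with \<open>b_a_up\<close> this shows that conjugation by \<open>b i\<close>
  takes the pair \<open>a i\<close>, \<open>a (Suc i)\<close> to \<open>a (Suc i)\<close>,
  \<open>- a (Suc i) + a i + a (Suc i)\<close>, which is again a Hurwitz move. So the subgroup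
  generated by the \<open>a\<close>'s is normalized by all generators except the last.\<close>

lemma b_a_a:
  assumes "Suc i < m" shows "b i + (a i + a (Suc i)) = a i + a (Suc i) + b i"
proof -
  let ?D = "C (Suc (Suc i))"
  have aa: "a i + a (Suc i) = C i + b i + b (Suc i) - ?D"
    by (simp add: a_def grp_simps del: add_uminus_conv_diff)
  have C0: "C i = ?D + b (Suc i) + b i" using assms by (simp add: C_step)
  have "b i + (a i + a (Suc i)) = (b i + C i) + b i + b (Suc i) - ?D"
    unfolding aa by (simp add: grp_simps del: add_uminus_conv_diff)
  also have "\<dots> = C i + (b (Suc i) + b i + b (Suc i)) - ?D"
    using b_C_near[of i i] assms by (simp add: grp_simps del: add_uminus_conv_diff)
  also have "\<dots> = C i + b i + b (Suc i) + (b i - ?D)"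
    unfolding braid[OF assms, symmetric] by (simp add: grp_simps del: add_uminus_conv_diff)
  also have "b i - ?D = - ?D + b i"
    using grp_swap[OF b_C_far[of i "Suc (Suc i)"]] assms by simp
  finally show ?thesis unfolding aa by (simp add: grp_simps del: add_uminus_conv_diff)
qed

abbreviation sgnd :: "bool \<Rightarrow> 'g \<Rightarrow> 'g" where
  "sgnd e x \<equiv> (if e then x else - x)"

abbreviation letters :: "nat \<Rightarrow> nat word \<Rightarrow> bool" where
  "letters k u \<equiv> fst ` set u \<subseteq> {..<k}"

lemma letters_winv: "letters k (winv u) = letters k u"
  by (force simp: set_winv)

lemma b_a_normal:
  assumes "Suc i < m" "l < m"
  shows "\<exists>u. letters m u \<and> sgnd e (b i) + a l = wev a u + sgnd e (b i)"
proof -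
  consider "l < i \<or> Suc i < l" | "l = i" | "l = Suc i" by linarith
  then show ?thesis
  proof cases
    case 1
    have "b i + a l = a l + b i" by (rule b_a_far) (use assms 1 in auto)
    then have "sgnd e (b i) + a l = a l + sgnd e (b i)"
      using grp_swap[of "a l" "b i" "b i" "a l"] by auto
    then show ?thesis by (intro exI[of _ "[(l, True)]"]) (use assms in \<open>simp add: wev_Cons\<close>)
  next
    case 2
    show ?thesis
    proof (cases e)
      case True
      then show ?thesis using b_a_up[OF assms(1)] assms 2
        by (intro exI[of _ "[(Suc i, True)]"]) (simp add: wev_Cons)
    next
      case False
      \<comment> \<open>The inverse conjugation takes \<open>a i\<close> to
        \<open>a i + a (Suc i) - a i\<close>; this follows from the invariance of the sum.\<close>
      have *: "- b i + (a i + a (Suc i)) = a i + a (Suc i) - b i"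
        using grp_swap[OF b_a_a[OF assms(1), symmetric]] .
      have "- b i + a i = - b i + (a i + a (Suc i)) - a (Suc i)"
        by (simp add: grp_simps del: add_uminus_conv_diff)
      also have "\<dots> = a i + a (Suc i) - (a (Suc i) + b i)"
        unfolding * by (simp add: grp_simps del: add_uminus_conv_diff)
      also have "\<dots> = a i + a (Suc i) - (b i + a i)"
        by (simp only: b_a_up[OF assms(1)])
      finally show ?thesis using False assms 2
        by (intro exI[of _ "[(i, True), (Suc i, True), (i, False)]"])
          (simp add: wev_Cons grp_simps del: add_uminus_conv_diff)
    qed
  next
    case 3
    show ?thesis
    proof (cases e)
      case False
      have "- b i + a (Suc i) = a i - b i"
        using grp_swap[OF b_a_up[OF assms(1), symmetric]] .
      then show ?thesis using assms 3 False
        by (intro exI[of _ "[(i, True)]"]) (simp add: wev_Cons)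
    next
      case True
      have "a (Suc i) + (b i + a (Suc i)) = a i + a (Suc i) + b i"
        using b_a_a[OF assms(1)] b_a_up[OF assms(1)] by (simp only: add.assoc[symmetric])
      then have "b i + a (Suc i) = - a (Suc i) + (a i + a (Suc i) + b i)"
        by (metis minus_add_cancel)
      then show ?thesis using assms 3 True
        by (intro exI[of _ "[(Suc i, False), (i, True), (Suc i, True)]"])
          (simp add: wev_Cons grp_simps del: add_uminus_conv_diff)
    qed
  qed
qed

lemma b_word_normal:
  assumes "Suc i < m" "letters m u"
  shows "\<exists>u'. letters m u' \<and> sgnd e (b i) + wev a u = wev a u' + sgnd e (b i)"
  using assms(2)
proof (induction u)
  case Nil then show ?case by (intro exI[of _ "[]"]) simp
next
  case (Cons x u)
  obtain l s where x: "x = (l, s)" by fastforce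
  let ?b = "sgnd e (b i)"
  obtain v where v: "letters m v" "?b + a l = wev a v + ?b"
    using b_a_normal[OF assms(1), of l e] Cons.prems by (auto simp: x split del: if_split)
  obtain u' where u': "letters m u'" "?b + wev a u = wev a u' + ?b"
    using Cons.IH Cons.prems by (auto simp: x split del: if_split)
  define v' where "v' = (if s then v else winv v)"
  have *: "?b + sgnd s (a l) = wev a v' + ?b"
  proof (cases s)
    case False
    have "?b - a l = - wev a v + ?b" using grp_swap[OF v(2)] by simp
    then show ?thesis using False by (simp add: v'_def)
  qed (use v in \<open>simp add: v'_def\<close>)
  have "?b + wev a (x # u) = (?b + sgnd s (a l)) + wev a u"
    by (simp only: x wev_Cons add.assoc)
  also have "\<dots> = wev a v' + (?b + wev a u)"
    unfolding * by (simp only: add.assoc)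
  also have "\<dots> = wev a (v' @ u') + ?b" by (simp only: u' wev_append add.assoc)
  finally have "?b + wev a (x # u) = wev a (v' @ u') + ?b" .
  moreover have "letters m (v' @ u')" using v(1) u'(1) letters_winv[of v m] by (auto simp: v'_def)
  ultimately show ?case by blast
qed

text \<open>A letter multiplied on the left either passes through the coset representative or
  changes it. If it passes through, it goes on through the word in the \<open>a\<close>'s by
  \<open>b_word_normal\<close> and joins the part with one strand less.\<close>

lemma normal_form:
  assumes "letters m w"
  shows "\<exists>j u v. j \<le> m \<and> letters m u \<and> letters (m - 1) v \<and> wev b w = - C j + wev a u + wev b v"
  using assms
proof (induction w)
  case Nil
  then show ?case by (intro exI[of _ m] exI[of _ "[]"]) simp
next
  case (Cons x w)
  obtain i e where x: "x = (i, e)" by fastforce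
  let ?b = "sgnd e (b i)"
  obtain j u v where *: "j \<le> m" "letters m u" "letters (m - 1) v"
    "wev b w = - C j + wev a u + wev b v"
    using Cons.IH Cons.prems by (auto simp: x)
  have i: "i < m" using Cons.prems x by simp
  have w: "wev b (x # w) = (?b - C j) + (wev a u + wev b v)"
    by (simp add: x wev_Cons *(4) grp_simps del: add_uminus_conv_diff split del: if_split)
  have commuting: ?case if asm: "?b - C j = - C j + sgnd e (b i')" "Suc i' < m" for i'
  proof -
    obtain u' where u': "letters m u'" "sgnd e (b i') + wev a u = wev a u' + sgnd e (b i')"
      using b_word_normal[OF asm(2) *(2)] by blast
    have "wev b (x # w) = - C j + (sgnd e (b i') + wev a u) + wev b v"
      unfolding w asm(1) by (simp only: add.assoc)
    also have "\<dots> = - C j + wev a u' + wev b ((i', e) # v)"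
      unfolding u' by (simp only: wev_Cons add.assoc)
    finally show ?thesis using *(1,3) u'(1) asm(2)
      by (intro exI[of _ j] exI[of _ u'] exI[of _ "(i', e) # v"]) auto
  qed
  have moving: ?case if "?b - C j = - C j' + wev a u'" "letters m u'" "j' \<le> m" for j' u'
    using that * w by (intro exI[of _ j'] exI[of _ "u' @ u"] exI[of _ v]) (auto simp: add.assoc)
  have sgnd: "sgnd e y' - z = - z + sgnd e y" if "y + z = z + y'" for y y' z
  proof (cases e)
    case True then show ?thesis using grp_swap[OF that] by simp
  next
    case False
    have "- (z + y') = - (y + z)" using that by simp
    then show ?thesis using False by (simp add: grp_simps del: add_uminus_conv_diff)
  qed
  \<comment> \<open>The letter passes through \<open>- C j\<close> unchanged below \<open>j\<close>
    and with its index lowered by one above; the two middle cases move the representative to a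
    neighbouring one and leave at most one \<open>a\<close> behind.\<close>
  have "Suc i < j \<or> Suc i = j \<or> i = j \<or> (\<exists>i'. i = Suc i' \<and> j \<le> i')" by presburger
  then consider "Suc i < j" | "Suc i = j" | "i = j" | i' where "i = Suc i'" "j \<le> i'" by blast
  then show ?case
  proof cases
    case 1
    show ?thesis by (rule commuting[of i]) (rule sgnd, rule b_C_far, use 1 * in auto)
  next
    case 4
    show ?thesis by (rule commuting[of i']) (simp only: 4(1), rule sgnd, rule b_C_near, use 4 i in auto)
  next
    case 2
    have C: "C i = C j + b i" using C_step[OF i] 2 by simp
    show ?thesis
    proof (cases e)
      case True
      show ?thesis by (rule moving[of i "[(i, True)]"])
        (use i 2 True in \<open>auto simp: wev_Cons a_def C grp_simps simp del: add_uminus_conv_diff\<close>)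
    next
      case False
      show ?thesis by (rule moving[of i "[]"])
        (use i False in \<open>auto simp: C grp_simps simp del: add_uminus_conv_diff\<close>)
    qed
  next
    case 3
    have C: "C j = C (Suc i) + b i" using C_step[OF i] 3 by simp
    show ?thesis
    proof (cases e)
      case True
      show ?thesis by (rule moving[of "Suc i" "[]"])
        (use i True in \<open>auto simp: C grp_simps simp del: add_uminus_conv_diff\<close>)
    next
      case False
      show ?thesis by (rule moving[of "Suc i" "[(i, False)]"])
        (use i 3 False in \<open>auto simp: wev_Cons a_def C grp_simps simp del: add_uminus_conv_diff\<close>)
    qed
  qed
qed

end

lemma wev_pr: "wev (\<lambda>i. pr R [(i, True)]) w = pr R w"
proof (induction w)
  case (Cons x w)
  moreover obtain a b where "x = (a, b)" by fastforce
  ultimately show ?case using pr_Cons[of R x w] by (cases b) (simp_all add: wev_Cons pr_letter)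
qed simp

lemma braid_gens_pr: "braid_gens m (\<lambda>i. pr (braid_rels (Suc m)) [(i, True)])"
proof
  let ?b = "\<lambda>i. pr (braid_rels (Suc m)) [(i, True)]"
  fix i
  assume "Suc i < m"
  then have "pr (braid_rels (Suc m))
      [(i, True), (Suc i, True), (i, True), (Suc i, False), (i, False), (Suc i, False)] = 0"
    unfolding pr_eq_0_iff by (intro pres_eq_relator) (auto simp: braid_rels_def)
  then have "wev ?b
      [(i, True), (Suc i, True), (i, True), (Suc i, False), (i, False), (Suc i, False)] = 0"
    by (simp only: wev_pr)
  then have "(?b i + ?b (Suc i) + ?b i) - (?b (Suc i) + ?b i + ?b (Suc i)) = 0"
    by (simp add: wev_Cons grp_simps del: add_uminus_conv_diff)
  then show "?b i + ?b (Suc i) + ?b i = ?b (Suc i) + ?b i + ?b (Suc i)" by simp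
next
  let ?b = "\<lambda>i. pr (braid_rels (Suc m)) [(i, True)]"
  fix i j :: nat
  assume "i < m" "j < m" "i + 2 \<le> j"
  then have "pr (braid_rels (Suc m)) [(i, True), (j, True), (i, False), (j, False)] = 0"
    unfolding pr_eq_0_iff by (intro pres_eq_relator) (auto simp: braid_rels_def)
  then have "wev ?b [(i, True), (j, True), (i, False), (j, False)] = 0"
    by (simp only: wev_pr)
  then have "(?b i + ?b j) - (?b j + ?b i) = 0"
    by (simp add: wev_Cons grp_simps del: add_uminus_conv_diff)
  then show "?b i + ?b j = ?b j + ?b i" by simp
qed


text \<open>\<open>cw\<close>, \<open>aw\<close> and \<open>subst_aw\<close> realize
  \<open>C\<close>, \<open>a\<close> and evaluation at the \<open>a\<close>'s by braid words, so
  that the normal form can act on tuples.\<close>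

definition cw :: "nat \<Rightarrow> nat \<Rightarrow> nat word" where
  "cw m j = map (\<lambda>i. (i, True)) (rev [j..<m])"

definition aw :: "nat \<Rightarrow> nat \<Rightarrow> nat word" where
  "aw m i = cw m i @ [(i, True)] @ winv (cw m (Suc i))"

definition subst_aw :: "nat \<Rightarrow> nat word \<Rightarrow> nat word" where
  "subst_aw m u = concat (map (\<lambda>(i, e). if e then aw m i else winv (aw m i)) u)"

lemma subst_aw_Cons: "subst_aw m (x # u) = (if snd x then aw m (fst x) else winv (aw m (fst x))) @ subst_aw m u"
  and subst_aw_Nil [simp]: "subst_aw m [] = []"
  by (auto simp: subst_aw_def case_prod_beta)

lemma cw_step: "j < m \<Longrightarrow> cw m j = cw m (Suc j) @ [(j, True)]"
  by (simp add: cw_def upt_conv_Cons)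

lemma cw_m [simp]: "cw m m = []"
  by (simp add: cw_def)

lemma aw_alt: "i < m \<Longrightarrow> aw m i = cw m (Suc i) @ [(i, True), (i, True)] @ winv (cw m (Suc i))"
  by (simp add: aw_def cw_step)

lemma braid_word_letters: "braid_word (Suc m) w \<longleftrightarrow> fst ` set w \<subseteq> {..<m}"
  by (auto simp: braid_word_def)

lemma braid_word_cw [simp]: "braid_word (Suc m) (cw m j)"
  by (auto simp: braid_word_def cw_def)

lemma braid_word_aw: "i < m \<Longrightarrow> braid_word (Suc m) (aw m i)"
  by (simp add: aw_def braid_word_Cons)

lemma braid_word_subst_aw: "fst ` set u \<subseteq> {..<m} \<Longrightarrow> braid_word (Suc m) (subst_aw m u)"
  by (induction u) (auto simp: subst_aw_Cons braid_word_aw)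

lemma braid_normal_form:
  assumes "braid_word (Suc m) w"
  obtains j u v where "j \<le> m" "fst ` set u \<subseteq> {..<m}" "braid_word m v"
    "braid_eq (Suc m) w (winv (cw m j) @ subst_aw m u @ v)"
proof -
  let ?pr = "pr (braid_rels (Suc m))"
  interpret braid_gens m "\<lambda>i. ?pr [(i, True)]" by (rule braid_gens_pr)
  obtain j u v where *: "j \<le> m" "fst ` set u \<subseteq> {..<m}" "fst ` set v \<subseteq> {..<m - 1}"
    "wev (\<lambda>i. ?pr [(i, True)]) w = - C j + wev a u + wev (\<lambda>i. ?pr [(i, True)]) v"
    using normal_form[OF assms[unfolded braid_word_letters]] by blast
  have C: "C i = ?pr (cw m i)" for i
    unfolding wev_pr[of _ "cw m i", symmetric] by (simp add: C_def cw_def wev_def comp_def)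
  have a: "a i = ?pr (aw m i)" for i
    by (simp only: a_def aw_def C pr_append pr_winv add_uminus_conv_diff add_diff_eq)
  have "wev a u = ?pr (subst_aw m u)" for u
    by (induction u) (auto simp: subst_aw_Cons wev_Cons a pr_append pr_winv)
  then have "?pr w = ?pr (winv (cw m j) @ subst_aw m u @ v)"
    using *(4) by (simp only: wev_pr C pr_append pr_winv add.assoc)
  then have "braid_eq (Suc m) w (winv (cw m j) @ subst_aw m u @ v)" by (simp add: pr_eq_iff)
  moreover have "braid_word m v" using *(3) by (fastforce simp: braid_word_def)
  ultimately show ?thesis using that * by blast
qed

text \<open>One strand z of the tuple is tracked, at position l and conjugated by h; the
  homomorphism kills z, and the other strands are only known up to it.\<close>

locale kill_strand =
  fixes m :: nat and \<kappa> :: "'g::group_add \<Rightarrow> 'g" and z :: 'g and Y :: "'g list"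
  assumes hom: "\<kappa> (x + y) = \<kappa> x + \<kappa> y" and hom_minus: "\<kappa> (- x) = - \<kappa> x" and kill: "\<kappa> z = 0"
begin

definition St :: "nat \<Rightarrow> 'g list \<Rightarrow> 'g \<Rightarrow> bool" where
  "St l t h \<longleftrightarrow> l \<le> m \<and> length t = Suc m \<and> t ! l = h + z - h \<and>
     (\<forall>i<l. \<kappa> (t ! i) = Y ! i) \<and> (\<forall>i. l \<le> i \<and> i < m \<longrightarrow> \<kappa> (t ! Suc i) = Y ! i)"

lemma kill_conj: "\<kappa> (h + z - h) = 0"
  using hom[of "h + z" "- h"] by (simp add: hom hom_minus kill)

lemma kill_pos: "St l t h \<Longrightarrow> \<kappa> (t ! l) = 0"
  by (simp add: St_def kill_conj)

lemma hom_diff: "\<kappa> (x - y) = \<kappa> x - \<kappa> y"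
  using hom[of x "- y"] by (simp add: hom_minus)

lemma StI:
  assumes "l \<le> m" "length t = Suc m" "t ! l = h + z - h"
    "\<And>i. i < l \<Longrightarrow> \<kappa> (t ! i) = Y ! i" "\<And>i. l \<le> i \<Longrightarrow> i < m \<Longrightarrow> \<kappa> (t ! Suc i) = Y ! i"
  shows "St l t h"
  using assms by (simp add: St_def)

lemma StD:
  assumes "St l t h"
  shows "l \<le> m" "length t = Suc m" "t ! l = h + z - h"
    "i < l \<Longrightarrow> \<kappa> (t ! i) = Y ! i" "l \<le> i \<Longrightarrow> i < m \<Longrightarrow> \<kappa> (t ! Suc i) = Y ! i"
  using assms by (simp_all add: St_def)

lemma St_down:
  assumes "St (Suc l) t h" shows "St l (hzl (l, False) t) h"
proof (rule StI)
  note st = StD[OF assms]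
  show "\<kappa> (hzl (l, False) t ! Suc i) = Y ! i" if "l \<le> i" "i < m" for i
    using that st(1,2,4,5) kill_pos[OF assms] by (cases "i = l") (simp_all add: hom hom_minus)
qed (use StD[OF assms] in simp_all)

lemma St_up:
  assumes "St l t h" "l < m" shows "St (Suc l) (hzl (l, True) t) h"
proof (rule StI)
  note st = StD[OF assms(1)]
  show "\<kappa> (hzl (l, True) t ! i) = Y ! i" if "i < Suc l" for i
    using that st(1,2,4,5) kill_pos[OF assms(1)] assms(2) by (cases "i = l") (simp_all add: hom hom_diff)
qed (use StD[OF assms(1)] assms(2) in simp_all)

text \<open>Encircling strand \<open>l\<close> conjugates the tracked strand by
  \<open>t ! l\<close>, which is recorded in \<open>h\<close>. Strand \<open>l\<close> is itself
  conjugated, but by an element that \<open>\<kappa>\<close> kills.\<close>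

lemma St_twist:
  assumes "St (Suc l) t h" shows "St (Suc l) (hz [(l, True), (l, True)] t) (t ! l + h)"
proof (rule StI)
  note st = StD[OF assms]
  show "\<kappa> (hz [(l, True), (l, True)] t ! i) = Y ! i" if "i < Suc l" for i
    using that st(1,2,4,5) kill_pos[OF assms] by (cases "i = l") (simp_all add: hom hom_diff hz_Cons)
  show "hz [(l, True), (l, True)] t ! Suc l = t ! l + h + z - (t ! l + h)"
    using st by (simp add: hz_Cons grp_simps del: add_uminus_conv_diff)
qed (use StD[OF assms] in \<open>simp_all add: hz_Cons\<close>)

lemma St_untwist:
  assumes "St (Suc l) t h"
  shows "St (Suc l) (hz [(l, False), (l, False)] t) (- (- t ! Suc l + t ! l + t ! Suc l) + h)"
proof (rule StI)
  note st = StD[OF assms]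
  show "\<kappa> (hz [(l, False), (l, False)] t ! i) = Y ! i" if "i < Suc l" for i
    using that st(1,2,4,5) kill_pos[OF assms]
    by (cases "i = l") (simp_all add: hom hom_minus hz_Cons)
  show "hz [(l, False), (l, False)] t ! Suc l = - (- t ! Suc l + t ! l + t ! Suc l) + h + z
      - (- (- t ! Suc l + t ! l + t ! Suc l) + h)"
    using st by (simp add: hz_Cons grp_simps del: add_uminus_conv_diff)
qed (use StD[OF assms] in \<open>simp_all add: hz_Cons\<close>)

lemma St_winv_cw: "St m t h \<Longrightarrow> j \<le> m \<Longrightarrow> St j (hz (winv (cw m j)) t) h"
proof (induction "m - j" arbitrary: j)
  case (Suc d)
  then have "St (Suc j) (hz (winv (cw m (Suc j))) t) h" "j < m" by simp_all
  then show ?case using St_down by (simp add: cw_step winv_Cons hz_append hz_Cons)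
qed simp

lemma St_cw: "St j t h \<Longrightarrow> j \<le> m \<Longrightarrow> St m (hz (cw m j) t) h"
proof (induction "m - j" arbitrary: j t)
  case (Suc d)
  then have "St (Suc j) (hzl (j, True) t) h" "j < m" using St_up by simp_all
  then show ?case using Suc by (simp add: cw_step hz_append hz_Cons)
qed simp

lemma St_aw:
  assumes "St m t h" "i < m"
  shows "\<exists>h'. St m (hz (if e then aw m i else winv (aw m i)) t) h' \<and>
    \<kappa> h' = (if e then Y ! i else - Y ! i) + \<kappa> h"
proof -
  define s where "s = hz (winv (cw m (Suc i))) t"
  have s: "St (Suc i) s h" unfolding s_def by (rule St_winv_cw) (use assms in auto)
  have k: "\<kappa> (s ! i) = Y ! i" "\<kappa> (s ! Suc i) = 0" using StD(4)[OF s] kill_pos[OF s] by simp_all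
  show ?thesis
  proof (cases e)
    case True
    have "hz (aw m i) t = hz (cw m (Suc i)) (hz [(i, True), (i, True)] s)"
      by (simp only: aw_alt[OF assms(2)] hz_append s_def)
    then have "St m (hz (aw m i) t) (s ! i + h)" using St_cw[OF St_twist[OF s]] assms by simp
    moreover have "\<kappa> (s ! i + h) = Y ! i + \<kappa> h" by (simp add: hom k)
    ultimately show ?thesis using True by auto
  next
    case False
    define h' where "h' = - (- s ! Suc i + s ! i + s ! Suc i) + h"
    have "hz (winv (aw m i)) t = hz (cw m (Suc i)) (hz [(i, False), (i, False)] s)"
      by (simp only: aw_alt[OF assms(2)] hz_append s_def winv_append winv_winv winv_Cons winv_Nil
          append.simps not_True_eq_False hz_Cons hz_Nil)
    then have "St m (hz (winv (aw m i)) t) h'"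
      using St_cw[OF St_untwist[OF s]] assms by (simp add: h'_def)
    moreover have "\<kappa> h' = - Y ! i + \<kappa> h" by (simp only: h'_def hom hom_minus k) simp
    ultimately show ?thesis using False by auto
  qed
qed

text \<open>Makes the free part of the normal form visible: the value of \<open>u\<close> at the
  other strands appears as the image of the conjugator.\<close>

lemma St_subst_aw:
  assumes "St m t h" "fst ` set u \<subseteq> {..<m}"
  shows "\<exists>h'. St m (hz (subst_aw m u) t) h' \<and> \<kappa> h' = wev (\<lambda>i. Y ! i) u + \<kappa> h"
  using assms(2)
proof (induction u)
  case Nil then show ?case using assms by auto
next
  case (Cons x u)
  obtain i e where x: "x = (i, e)" by fastforce
  obtain h1 where h1: "St m (hz (subst_aw m u) t) h1" "\<kappa> h1 = wev (\<lambda>i. Y ! i) u + \<kappa> h"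
    using Cons by auto
  obtain h2 where "St m (hz (if e then aw m i else winv (aw m i)) (hz (subst_aw m u) t)) h2"
    "\<kappa> h2 = (if e then Y ! i else - Y ! i) + \<kappa> h1"
    using St_aw[OF h1(1), of i e] Cons.prems by (auto simp: x split del: if_split)
  then show ?case using h1(2)
    by (intro exI[of _ h2]) (cases e; simp add: x subst_aw_Cons hz_append wev_Cons add.assoc)
qed

end

lemma wev_cong: "(\<And>i. i \<in> fst ` set w \<Longrightarrow> f i = g i) \<Longrightarrow> wev f w = wev g w"
  by (induction w) (auto simp: wev_Cons split: prod.splits)

definition kl :: "nat \<Rightarrow> fgrp \<Rightarrow> fgrp" where
  "kl m = fev (\<lambda>i. if i = m then 0 else gx i)"

text \<open>Compare the reduced words of both sides, after stripping leading occurrences of the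
  generator from h.\<close>

lemma commute_gx_kl:
  assumes "h + gx m = gx m + h" shows "kl m h = 0"
  using assms
proof (induction "length (rd h)" arbitrary: h rule: less_induct)
  case less
  show ?case
  proof (cases "rd h")
    case Nil
    then show ?thesis by (simp add: kl_def)
  next
    case (Cons x w)
    show ?thesis
    proof (cases "fst x = m")
      case True
      define y where "y = fg [x]"
      have h: "h = y + fg w" unfolding y_def fg_append[symmetric] using Cons fg_rd[of h] by simp
      have w: "rd (fg w) = w" using reduced_rd[of h] Cons by (intro rd_fg_reduced) (simp add: reduced_Cons)
      have y: "y = gx m \<or> y = - gx m"
        using True unfolding y_def gx_def fg_winv[symmetric] by (cases x; cases "snd x") (auto simp: winv_def)
      then have yk: "kl m y = 0" by (auto simp: kl_def)
      have yc: "y + gx m = gx m + y" using y by auto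
      have "y + (fg w + gx m) = y + (gx m + fg w)"
        using less.prems unfolding h by (simp only: add.assoc[symmetric] yc)
      then have "fg w + gx m = gx m + fg w" by simp
      then have "kl m (fg w) = 0" using less.hyps[of "fg w"] w Cons by simp
      then show ?thesis using yk h by (simp add: kl_def)
    next
      case False
      have "reduced (rd (gx m) @ rd h)" using Cons False reduced_rd[of h]
        by (auto simp: reduced_Cons)
      then have l: "rd (gx m + h) = (m, True) # rd h" by (simp add: rd_add)
      obtain u c v where d: "rd h = u @ c" "[(m, True)] = winv c @ v" "rd (h + gx m) = u @ v"
        using rd_add_decomp[of h "gx m"] by auto
      have "u @ v = (m, True) # rd h" using d less.prems l by simp
      moreover have "length (u @ v) \<le> length (rd h) \<longleftrightarrow> c \<noteq> []"
        using d by (cases c) (auto dest!: arg_cong[where f = length])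
      ultimately have "c = []" by auto
      then have "u = x # w" using d Cons by simp
      then show ?thesis using \<open>u @ v = (m, True) # rd h\<close> False by auto
    qed
  qed
qed

lemma braid_rels_mono: "m \<le> n \<Longrightarrow> braid_rels m \<subseteq> braid_rels n"
  by (fastforce simp: braid_rels_def)

lemma pres_eq_mono:
  assumes "pres_eq R u v" "R \<subseteq> S" shows "pres_eq S u v"
  using assms(1)
proof (induction rule: pres_eq.induct)
  case (cancel u a b v)
  show ?case by (rule pres_eq.cancel)
next
  case (rel r u v)
  then show ?case using assms(2) by (intro pres_eq.rel) auto
qed (auto intro: pres_eq.intros)

lemma subst_aw_append: "subst_aw m (u @ v) = subst_aw m u @ subst_aw m v"
  by (simp add: subst_aw_def)

lemma pres_eq_subst_aw: "pres_eq {} u v \<Longrightarrow> pres_eq R (subst_aw m u) (subst_aw m v)"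
  by (rule pres_eq_hom)
    (auto simp: subst_aw_append subst_aw_Cons pres_eq_right_inv pres_eq_left_inv)

text \<open>Induction on the number of strands through the normal form. Killing the last generator
  leaves the action of \<open>v\<close> on the other strands, so \<open>v\<close> is trivial by
  induction. The conjugator \<open>h\<close> of the last strand commutes with the last generator, so
  its image, which is the value of \<open>u\<close>, vanishes in the free group.\<close>

theorem Artin_faithful:
  assumes "braid_word n w" "hz w (map gx [0..<n]) = map gx [0..<n]"
  shows "braid_eq n w []"
  using assms
proof (induction n arbitrary: w)
  case 0
  then have "w = []" by (cases w) (auto simp: braid_word_Cons)
  then show ?case by (simp add: pres_eq.refl)
next
  case (Suc m)
  let ?X = "map gx [0..<m]"
  obtain j u v where *: "j \<le> m" "fst ` set u \<subseteq> {..<m}" "braid_word m v"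
    "braid_eq (Suc m) w (winv (cw m j) @ subst_aw m u @ v)"
    using braid_normal_form[OF Suc.prems(1)] by blast
  have v: "braid_word (Suc m) v" using *(3) by (rule braid_word_mono) simp
  define Y where "Y = hz v ?X"
  interpret kill_strand m "kl m" "gx m" Y
    by standard (auto simp: kl_def)
  have k0: "kl m 0 = 0" by (simp add: kl_def)
  have kX: "map (kl m) ?X = ?X" by (auto simp: kl_def)
  have kY: "map (kl m) Y = Y"
  proof -
    have "map (kl m) Y = hz v (map (kl m) ?X)"
      unfolding Y_def by (rule map_hz) (use hom hom_minus *(3) in auto)
    then show ?thesis by (simp only: kX Y_def)
  qed
  have "hz v (?X @ [gx m]) = Y @ [gx m]" unfolding Y_def using *(3) by (intro hz_append1) simp
  moreover have "length Y = m" by (simp add: Y_def)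
  moreover have "i < m \<Longrightarrow> kl m (Y ! i) = Y ! i" for i
    using arg_cong[OF kY, of "\<lambda>l. l ! i"] \<open>length Y = m\<close> by simp
  ultimately have "St m (hz v (?X @ [gx m])) 0" by (auto simp: St_def nth_append)
  then obtain h where h: "St m (hz (subst_aw m u) (hz v (?X @ [gx m]))) h"
    "kl m h = wev (\<lambda>i. Y ! i) u"
    using St_subst_aw[OF _ *(2)] k0 by fastforce
  have "St j (hz (winv (cw m j)) (hz (subst_aw m u) (hz v (?X @ [gx m])))) h"
    by (rule St_winv_cw) (use h * in auto)
  moreover have "hz (winv (cw m j) @ subst_aw m u @ v) (?X @ [gx m]) = ?X @ [gx m]"
    using hz_braid_eq[OF *(4) Suc.prems(1), of "?X @ [gx m]"] Suc.prems(2) v braid_word_subst_aw[OF *(2)] by simp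
  ultimately have St: "St j (?X @ [gx m]) h" by (simp add: hz_append)
  \<comment> \<open>Entry \<open>j\<close> of the fixed tuple is killed, and the last generator is
    the only entry with this property.\<close>
  have j: "j = m"
  proof (rule ccontr)
    assume "j \<noteq> m"
    then have "kl m (gx j) = 0" using kill_pos[OF St] *(1) by (simp add: nth_append)
    then have "gx j = 0" using \<open>j \<noteq> m\<close> by (simp add: kl_def)
    then show False using rd_gx[of j] by simp
  qed
  have "Y = ?X"
  proof (rule nth_equalityI)
    fix i assume "i < length Y"
    then have "i < m" using \<open>length Y = m\<close> by simp
    then show "Y ! i = ?X ! i" using StD(4)[OF St, of i] j by (simp add: nth_append) (simp add: kl_def)
  qed (simp add: \<open>length Y = m\<close>)
  then have "braid_eq m v []" using Suc.IH[OF *(3)] by (simp add: Y_def)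
  then have v0: "braid_eq (Suc m) v []" by (rule pres_eq_mono) (rule braid_rels_mono, simp)
  have "h + gx m - h = gx m" using StD(3)[OF St] j by (simp add: nth_append)
  then have "h + gx m = gx m + h" by (metis diff_add_cancel)
  then have "wev (\<lambda>i. Y ! i) u = 0" using h(2) commute_gx_kl by simp
  moreover have "wev (\<lambda>i. Y ! i) u = wev gx u"
    by (rule wev_cong) (use *(2) \<open>Y = ?X\<close> in auto)
  ultimately have "fg u = fg []" by (simp add: wev_gx)
  then have "braid_eq (Suc m) (subst_aw m u) (subst_aw m [])"
    by (intro pres_eq_subst_aw) (simp only: fg_eq_iff)
  then have "braid_eq (Suc m) (subst_aw m u @ v) ([] @ [])"
    using v0 by (intro pres_eq_append) simp_all
  then show ?case using *(4) j by (auto intro: pres_eq.trans)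
qed

section \<open>Artin's reduction of conjugated generators\<close>

abbreviation len :: "fgrp \<Rightarrow> nat" where "len g \<equiv> length (rd g)"

definition is_conj :: "fgrp \<Rightarrow> bool" where
  "is_conj X \<longleftrightarrow> (\<exists>w i. X = w + gx i - w)"

lemma is_conj_gx [simp]: "is_conj (gx i)"
  unfolding is_conj_def by (rule exI[of _ 0]) auto

lemma is_conj_conj: "is_conj X \<Longrightarrow> is_conj (g + X - g)"
proof -
  assume "is_conj X"
  then obtain w i where "X = w + gx i - w" by (auto simp: is_conj_def)
  then have "g + X - g = (g + w) + gx i - (g + w)"
    by (simp add: grp_simps del: add_uminus_conv_diff)
  then show ?thesis unfolding is_conj_def by blast
qed

lemma is_conj_conj': "is_conj X \<Longrightarrow> is_conj (- g + X + g)"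
  using is_conj_conj[of X "- g"] by simp

lemma len_uminus [simp]: "len (- a) = len a"
  by (simp add: rd_uminus)

text \<open>Conjugation by one more letter keeps the symmetric shape: the letter is absorbed by the
  core, cancels at both ends, or is added at both ends.\<close>

lemma is_conj_rd:
  assumes "is_conj X"
  obtains w i where "rd X = w @ [(i, True)] @ winv w"
proof -
  obtain u i where X: "X = u + gx i - u" using assms by (auto simp: is_conj_def)
  have "\<exists>w. reduced (w @ [(i, True)] @ winv w) \<and> fg u + gx i - fg u = fg (w @ [(i, True)] @ winv w)"
    for u
  proof (induction u)
    case Nil
    show ?case by (rule exI[of _ "[]"]) (simp add: gx_def)
  next
    case (Cons x u)
    then obtain w where w: "reduced (w @ [(i, True)] @ winv w)"
      "fg u + gx i - fg u = fg (w @ [(i, True)] @ winv w)" by blast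
    have "fg (x # u) + gx i - fg (x # u) = fg [x] + (fg u + gx i - fg u) - fg [x]"
      using fg_append[of "[x]" u] by (simp add: grp_simps del: add_uminus_conv_diff)
    also have "\<dots> = fg [x] + fg (w @ [(i, True)] @ winv w) - fg [x]" by (simp only: w(2))
    also have "\<dots> = fg ([x] @ (w @ [(i, True)] @ winv w) @ winv [x])"
      by (simp only: fg_append fg_winv add.assoc diff_conv_add_uminus)
    finally have eq: "fg (x # u) + gx i - fg (x # u) = fg ([x] @ (w @ [(i, True)] @ winv w) @ winv [x])" .
    show ?case
    proof (cases w)
      case Nil
      show ?thesis
      proof (cases "fst x = i")
        case True
        have "red ([x] @ [(i, True)] @ winv [x]) = red [(i, True)]"
          using True by (cases x) (auto simp: red_def winv_def)
        then have "fg (x # u) + gx i - fg (x # u) = fg [(i, True)]"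
          unfolding eq Nil by (simp add: fg_eq_iff free_eq_iff)
        then show ?thesis by (intro exI[of _ "[]"]) simp
      next
        case False
        then have "reduced ([x] @ [(i, True)] @ winv [x])"
          by (cases x) (auto simp: winv_def reduced_Cons)
        then show ?thesis using eq Nil by (intro exI[of _ "[x]"]) simp
      qed
    next
      case (Cons y w')
      show ?thesis
      proof (cases "y = linv x")
        case True
        have "pres_eq {} ([x] @ (w @ [(i, True)] @ winv w) @ winv [x]) (w' @ [(i, True)] @ winv w')"
        proof -
          have "[x] @ (w @ [(i, True)] @ winv w) @ winv [x] =
              ([x] @ winv [x]) @ (w' @ [(i, True)] @ winv w') @ ([x] @ winv [x])"
            using True by (cases x) (simp add: Cons winv_def)
          moreover have "pres_eq {} (([x] @ winv [x]) @ (w' @ [(i, True)] @ winv w') @ ([x] @ winv [x]))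
              ([] @ (w' @ [(i, True)] @ winv w') @ [])"
            by (intro pres_eq_append pres_eq_right_inv pres_eq.refl)
          ultimately show ?thesis by simp
        qed
        then have "fg (x # u) + gx i - fg (x # u) = fg (w' @ [(i, True)] @ winv w')"
          unfolding eq by (simp only: fg_eq_iff)
        moreover have "reduced (w' @ [(i, True)] @ winv w')"
          using w(1) by (cases y) (auto simp: Cons winv_Cons reduced_append reduced_Cons split: if_splits)
        ultimately show ?thesis by blast
      next
        case False
        let ?B = "w @ [(i, True)] @ winv w"
        have "reduced ([x] @ ?B)" using w(1) False by (simp add: Cons reduced_Cons)
        moreover have "last ([x] @ ?B) = linv y" by (cases y) (simp add: Cons winv_Cons)
        moreover have "winv [x] = [linv x]" by (cases x) (simp add: winv_def)
        ultimately have "reduced (([x] @ ?B) @ winv [x])"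
          using False unfolding reduced_append[of "[x] @ ?B"] by (auto simp: prod_eq_iff)
        then show ?thesis using eq winv_append[of "[x]" w] by (intro exI[of _ "[x] @ w"]) simp
      qed
    qed
  qed
  from this[of "rd u"] obtain w where "reduced (w @ [(i, True)] @ winv w)"
    "X = fg (w @ [(i, True)] @ winv w)" using X by auto
  then show ?thesis using that rd_fg_reduced by metis
qed

lemma len_fg_le: "len (fg w) \<le> length w"
proof -
  have "length (rcons x v) \<le> Suc (length v)" for x and v :: "nat word" by (cases v) auto
  then have "length (red w) \<le> length w" by (induction w) (auto simp: red_Cons red_def intro: order_trans)
  then show ?thesis by (simp add: rd_fg)
qed

lemma len_fg_conj: "len (fg w + gx i - fg w) \<le> length w + 1 + length w"
proof -
  have "fg w + gx i - fg w = fg (w @ [(i, True)] @ winv w)"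
    by (simp only: fg_append fg_winv gx_def add.assoc diff_conv_add_uminus)
  then show ?thesis using len_fg_le[of "w @ [(i, True)] @ winv w"] by simp
qed

definition tlen :: "fgrp list \<Rightarrow> nat" where "tlen L = sum_list (map len L)"

lemma tlen_append [simp]: "tlen (A @ B) = tlen A + tlen B"
  and tlen_Cons [simp]: "tlen (x # L) = len x + tlen L"
  and tlen_Nil [simp]: "tlen [] = 0"
  by (simp_all add: tlen_def)

lemma list_all_hz:
  assumes "list_all is_conj L" "braid_word (length L) w" shows "list_all is_conj (hz w L)"
  using assms(2)
proof (induction w)
  case (Cons x w)
  obtain i b where x: "x = (i, b)" by fastforce
  obtain A a c B where AB: "hz w L = A @ a # c # B" "length A = i"
    by (rule list_split2[of i "hz w L"]) (use Cons.prems x in \<open>auto simp: braid_word_Cons\<close>)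
  show ?case using Cons AB
    by (cases b) (auto simp: x hz_Cons hzl_True hzl_False braid_word_Cons is_conj_conj is_conj_conj'
        simp del: hzl.simps)
qed (simp add: assms)

lemma heq_is_conj: "heq L L' \<Longrightarrow> list_all is_conj L \<Longrightarrow> list_all is_conj L'"
  unfolding heq_def using list_all_hz by blast

text \<open>Since no Hurwitz move shortens the tuple, the conjugators may cancel in part, but the middle
  letters of the entries survive in the product.\<close>

lemma unreduced_product:
  assumes "list_all is_conj (X # L)"
    and "\<And>A a b B. X # L = A @ a # b # B \<Longrightarrow> len (a + b - a) \<ge> len b \<and> len (- b + a + b) \<ge> len a"
    and "rd X = w @ [(i, True)] @ winv w"
  shows "\<exists>s. rd (sum_list (X # L)) = w @ (i, True) # s \<and> length s \<ge> length L \<and>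
      (length s = length L \<longrightarrow> (\<forall>Y \<in> set (X # L). len Y = 1))"
  using assms
proof (induction L arbitrary: X w i)
  case Nil
  then show ?case by auto
next
  case (Cons X' L)
  obtain w' i' where X': "rd X' = w' @ [(i', True)] @ winv w'"
    using Cons.prems(1) is_conj_rd[of X'] by auto
  have "\<exists>s. rd (sum_list (X' # L)) = w' @ (i', True) # s \<and> length s \<ge> length L \<and>
      (length s = length L \<longrightarrow> (\<forall>Y \<in> set (X' # L). len Y = 1))"
  proof (rule Cons.IH[OF _ _ X'])
    show "list_all is_conj (X' # L)" using Cons.prems(1) by simp
    show "len (a + b - a) \<ge> len b \<and> len (- b + a + b) \<ge> len a" if "X' # L = A @ a # b # B" for A a b B
      using Cons.prems(2)[of "X # A" a b B] that by simp
  qed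
  then obtain s where s: "rd (sum_list (X' # L)) = w' @ (i', True) # s" "length s \<ge> length L"
    "length s = length L \<longrightarrow> (\<forall>Y \<in> set (X' # L). len Y = 1)" by blast
  have le: "len (X + X' - X) \<ge> len X'" "len (- X' + X + X') \<ge> len X"
    using Cons.prems(2)[of "[]" X X' L] by simp_all
  have Xfg: "X = fg w + gx i - fg w" "X' = fg w' + gx i' - fg w'"
    using fg_rd[of X] fg_rd[of X'] by (simp_all only: Cons.prems(3) X' fg_append fg_winv gx_def
        add.assoc diff_conv_add_uminus)
  have rw: "reduced w" "reduced w'" "reduced (w @ [(i, True)])" "reduced ([(i, True)] @ winv w)"
    "reduced (w' @ [(i', True)])" "reduced (w' @ (i', True) # s)"
    using reduced_rd[of X] reduced_rd[of X'] reduced_rd[of "sum_list (X' # L)"]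
    unfolding Cons.prems(3) X' s(1) by (auto simp: reduced_append reduced_Cons)
  \<comment> \<open>What cancels between the conjugators is their common prefix \<open>c\<close>,
    with \<open>w = c @ a\<close> and \<open>w' = c @ b\<close>. The facts \<open>na\<close> and
    \<open>nb\<close> exclude that the cancellation reaches a middle letter.\<close>
  obtain c' a b where ab: "winv w = winv a @ c'" "w' = winv c' @ b" "reduced (winv a @ b)"
  proof -
    have "reduced (winv w)" using rw(1) by (simp add: reduced_winv)
    then obtain u c v where "winv w = u @ c" "w' = winv c @ v" "reduced (u @ v)"
      using cancel_decomp[OF _ rw(2)] by blast
    then show ?thesis using that[of "winv u" c v] by simp
  qed
  define c where "c = winv c'"
  have w: "w = c @ a" using arg_cong[OF ab(1), of winv] by (simp add: c_def)
  have w': "w' = c @ b" using ab(2) by (simp add: c_def)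
  \<comment> \<open>Otherwise conjugation by \<open>X\<close> would remove that letter from both
    ends of \<open>X'\<close> and shorten it; \<open>nb\<close> is the mirror image.\<close>
  have na: "a \<noteq> [] \<or> b = [] \<or> hd b \<noteq> (i, False)"
  proof (rule ccontr)
    assume "\<not> ?thesis"
    then obtain b' where a: "a = []" and b: "b = (i, False) # b'" by (cases b) auto
    have "fg b = - gx i + fg b'"
      unfolding b using fg_append[of "[(i, False)]" b'] fg_winv[of "[(i, True)]"]
      by (simp add: winv_def gx_def)
    then have "X + X' - X = fg (c @ b') + gx i' - fg (c @ b')"
      unfolding Xfg w w' a fg_append by (simp add: grp_simps del: add_uminus_conv_diff)
    then have "len (X + X' - X) \<le> length (c @ b') + 1 + length (c @ b')"
      using len_fg_conj[of "c @ b'" i'] by simp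
    then show False using le(1) X' w' b by simp
  qed
  have nb: "b \<noteq> [] \<or> a = [] \<or> hd a \<noteq> (i', True)"
  proof (rule ccontr)
    assume "\<not> ?thesis"
    then obtain a' where b: "b = []" and a: "a = (i', True) # a'" by (cases a) auto
    have "fg a = gx i' + fg a'"
      unfolding a using fg_append[of "[(i', True)]" a'] by (simp add: gx_def)
    then have "- X' + X + X' = fg (c @ a') + gx i - fg (c @ a')"
      unfolding Xfg w w' b fg_append by (simp add: grp_simps del: add_uminus_conv_diff)
    then have "len (- X' + X + X') \<le> length (c @ a') + 1 + length (c @ a')"
      using len_fg_conj[of "c @ a'" i] by simp
    then show False using le(2) Cons.prems(3) w a by simp
  qed
  let ?t = "winv a @ b @ (i', True) # s"
  have "reduced ((i, True) # ?t)"
  proof -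
    have "reduced (b @ (i', True) # s)" using rw(6) by (simp add: w' reduced_append)
    moreover have "reduced (winv a @ b)" by fact
    moreover have "b = [] \<Longrightarrow> winv a \<noteq> [] \<Longrightarrow> last (winv a) \<noteq> (i', False)"
      using nb by (cases a) (auto simp: winv_Cons split: prod.splits)
    ultimately have "winv a \<noteq> [] \<Longrightarrow> hd (b @ (i', True) # s) \<noteq> linv (last (winv a))"
      by (cases "b = []") (auto simp: reduced_append prod_eq_iff)
    then have 1: "reduced ?t"
      using \<open>reduced (winv a @ b)\<close> \<open>reduced (b @ (i', True) # s)\<close>
      unfolding reduced_append[of "winv a"] by simp
    have "hd ?t \<noteq> (i, False)"
    proof (cases "a = []")
      case True
      then show ?thesis using na by (cases b) auto
    next
      case False
      then have "hd (winv a) \<noteq> (i, False)"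
        using rw(4) by (simp add: w reduced_Cons)
      then show ?thesis using False by simp
    qed
    with 1 show ?thesis by (simp add: reduced_Cons)
  qed
  then have red: "reduced (w @ (i, True) # ?t)"
    using rw(3) by (auto simp: reduced_append reduced_Cons)
  have "sum_list (X # X' # L) = fg w + gx i - fg w + fg (w' @ (i', True) # s)"
    using fg_rd[of "sum_list (X' # L)", unfolded s(1)] Xfg(1) by simp
  also have "\<dots> = fg (w @ (i, True) # ?t)"
  proof -
    have "fg ((i, True) # ?t) = gx i + fg ?t" using fg_append[of "[(i, True)]" ?t] by (simp add: gx_def)
    then show ?thesis by (simp add: w w' fg_append fg_winv grp_simps del: add_uminus_conv_diff)
  qed
  finally have rdX: "rd (sum_list (X # X' # L)) = w @ (i, True) # ?t"
    using rd_fg_reduced[OF red] by simp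
  show ?case
  proof (rule exI[of _ ?t], intro conjI impI)
    show "rd (sum_list (X # X' # L)) = w @ (i, True) # ?t" by (rule rdX)
    show "length (X' # L) \<le> length ?t" using s(2) by simp
    assume "length ?t = length (X' # L)"
    then have "length a + length b + length s = length L" by simp
    then have "length a = 0" "length b = 0" "length s = length L" using s(2) by linarith+
    then have "a = []" "b = []" "length s = length L" by auto
    then have "len X = len X'" "\<forall>Y \<in> set (X' # L). len Y = 1"
      using s(3) X' Cons.prems(3) w w' by simp_all
    then show "\<forall>Y \<in> set (X # X' # L). len Y = 1" by simp
  qed
qed

lemma is_conj_len_1: "is_conj X \<Longrightarrow> len X = 1 \<Longrightarrow> \<exists>i. X = gx i"
proof -
  assume "is_conj X" "len X = 1"
  then obtain w i where X: "rd X = w @ [(i, True)] @ winv w" using is_conj_rd by blast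
  with \<open>len X = 1\<close> have "rd X = [(i, True)]" by simp
  then show "\<exists>i. X = gx i" by (metis rd_gx rd_inject)
qed

lemma rd_sum_list_gx: "rd (sum_list (map gx is)) = map (\<lambda>i. (i, True)) is"
proof (induction "is")
  case (Cons i "is")
  have "reduced (rd (sum_list (map gx is)))" by simp
  then have "reduced (rd (gx i) @ rd (sum_list (map gx is)))"
    unfolding Cons by (cases "is") (auto simp: reduced_Cons)
  then show ?case using Cons by (simp add: rd_add)
qed simp

text \<open>As long as a move shortens an entry, it lowers the total length. Afterwards
  \<open>unreduced_product\<close> bounds the length of the product below by the number of entries.
  The product is a positive word of just this length, so equality holds and all entries are
  generators, whose order can be read off the product.\<close>

theorem Artin_reduction:
  assumes "list_all is_conj L" "sum_list L = sum_list (map gx is)" "length L = length is"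
  shows "heq L (map gx is)"
  using assms
proof (induction "tlen L" arbitrary: L rule: less_induct)
  case less
  show ?case
  proof (cases "\<exists>A a b B. L = A @ a # b # B \<and> (len (a + b - a) < len b \<or> len (- b + a + b) < len a)")
    case True
    then obtain A a b B where L: "L = A @ [a, b] @ B"
      and "len (a + b - a) < len b \<or> len (- b + a + b) < len a" by auto
    moreover have "heq [a, b] [a + b - a, a]" by (rule heq_step)
    moreover have "heq [a, b] [b, - b + a + b]" using heq_move_right[of a "[b]"] by simp
    ultimately obtain P where P: "heq [a, b] P" "tlen P < tlen [a, b]" by fastforce
    then have LP: "heq L (A @ P @ B)" unfolding L by (intro heq_ctx)
    have "heq (A @ P @ B) (map gx is)"
    proof (rule less.hyps)
      show "tlen (A @ P @ B) < tlen L" using P by (simp add: L)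
    qed (use heq_is_conj[OF LP] heq_sum_list[OF LP] heq_length[OF LP] less.prems in auto)
    with LP show ?thesis by (rule heq_trans)
  next
    case False
    have "\<forall>Y \<in> set L. len Y = 1"
    proof (cases L)
      case (Cons X L')
      obtain w i where X: "rd X = w @ [(i, True)] @ winv w"
        using less.prems(1) is_conj_rd[of X] Cons by auto
      have *: "list_all is_conj (X # L')" using less.prems(1) Cons by simp
      have "\<exists>s. rd (sum_list (X # L')) = w @ (i, True) # s \<and> length s \<ge> length L' \<and>
        (length s = length L' \<longrightarrow> (\<forall>Y \<in> set (X # L'). len Y = 1))"
        by (rule unreduced_product[OF * _ X]) (use False Cons in force)
      then obtain s where s: "rd (sum_list L) = w @ (i, True) # s" "length s \<ge> length L'"
        "length s = length L' \<longrightarrow> (\<forall>Y \<in> set L. len Y = 1)" using Cons by auto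
      have "len (sum_list L) = length L" using less.prems by (simp add: rd_sum_list_gx)
      then show ?thesis using s Cons by simp
    qed simp
    then have "\<forall>Y \<in> set L. \<exists>i. Y = gx i" using less.prems(1) is_conj_len_1 by (auto simp: list_all_iff)
    then obtain f where f: "\<forall>Y \<in> set L. Y = gx (f Y)" by metis
    define js where "js = map f L"
    have L: "L = map gx js" using f by (simp add: js_def map_idI)
    then have "map (\<lambda>i. (i, True)) js = map (\<lambda>i. (i, True)) is"
      using less.prems(2) rd_sum_list_gx by metis
    then have "js = is" by (rule map_injective) (simp add: inj_def)
    then show ?thesis using L by simp
  qed
qed

section \<open>Splitting simple elements of a free product\<close>

text \<open>Whatever survived of \<open>a\<close> in the sum would be a common prefix of
  \<open>a\<close> and \<open>a + b\<close>.\<close>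

lemma full_cancel:
  assumes "a \<noteq> 0" "a + b \<noteq> 0" "hd (rd a) \<noteq> hd (rd (a + b))"
  shows "rd b = rd (- a) @ rd (a + b)"
proof -
  obtain u c v where *: "rd a = u @ c" "rd b = winv c @ v" "rd (a + b) = u @ v"
    by (rule rd_add_decomp)
  have "u = []" using * assms by (cases u) auto
  then show ?thesis using * by (simp add: rd_uminus)
qed

lemma last_winv: "w \<noteq> [] \<Longrightarrow> last (winv w) = linv (hd w)"
  by (cases w) (auto simp: winv_def case_prod_beta)

lemma hd_winv: "w \<noteq> [] \<Longrightarrow> hd (winv w) = linv (last w)"
  by (cases w rule: rev_cases) (auto simp: winv_def case_prod_beta)

text \<open>\<open>v + e\<close> is the conjugate \<open>- e + X + e\<close>. The word of
  \<open>X\<close> begins and ends with mutually inverse letters, and these meet in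
  \<open>v + e\<close>.\<close>

lemma conj_shorter:
  assumes "is_conj X" "rd X = rd e @ rd v" "e \<noteq> 0" "v \<noteq> 0"
  shows "len (v + e) < len X"
proof -
  obtain w i where X: "rd X = w @ [(i, True)] @ winv w" using is_conj_rd[OF assms(1)] .
  have "w \<noteq> []"
  proof
    assume "w = []"
    then have "length (rd e @ rd v) = 1" using X assms(2) by simp
    then show False using assms(3,4) by (cases "rd e"; cases "rd v") auto
  qed
  then have l: "last (rd X) = linv (hd (rd X))" unfolding X by (simp add: last_winv)
  have ne: "rd e \<noteq> []" "rd v \<noteq> []" using assms by simp_all
  then have lv: "last (rd v) = linv (hd (rd e))" using l unfolding assms(2) by simp
  obtain u c v' where *: "rd v = u @ c" "rd e = winv c @ v'" "rd (v + e) = u @ v'"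
    by (rule rd_add_decomp)
  have "c \<noteq> []"
  proof
    assume "c = []"
    then have "reduced (rd v @ rd e)" using * reduced_rd[of "v + e"] by simp
    then show False using ne lv by (auto simp: reduced_append prod_eq_iff)
  qed
  then show ?thesis using * assms(2) by simp
qed

lemma hd_is_conj_uminus: "is_conj X \<Longrightarrow> fst (hd (rd (- X))) = fst (hd (rd X))"
proof -
  assume "is_conj X"
  then obtain w i where X: "rd X = w @ [(i, True)] @ winv w" using is_conj_rd by blast
  show ?thesis unfolding rd_uminus X by (cases w) (auto simp: winv_Cons winv_def)
qed

section \<open>Exponent sums and tuples of minimal length\<close>

definition expsum :: "fgrp \<Rightarrow> int" where "expsum = fev (\<lambda>_. 1)"

lemma expsum_is_conj: "is_conj X \<Longrightarrow> expsum X = 1"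
  by (auto simp: is_conj_def expsum_def)

lemma expsum_sum_list: "list_all is_conj L \<Longrightarrow> expsum (sum_list L) = int (length L)"
  unfolding expsum_def fev_sum_list
  by (induction L) (auto simp: expsum_is_conj[unfolded expsum_def])

lemma sum_list_conj_nonzero: "list_all is_conj L \<Longrightarrow> L \<noteq> [] \<Longrightarrow> sum_list L \<noteq> 0"
  using expsum_sum_list[of L] by (auto simp: expsum_def)

definition minimal :: "fgrp list \<Rightarrow> bool" where
  "minimal L \<longleftrightarrow> (\<forall>L'. heq L L' \<longrightarrow> tlen L \<le> tlen L')"

lemma minimal_exists: "\<exists>L'. heq L L' \<and> minimal L'"
proof -
  obtain L' where "heq L L'" "\<And>L''. heq L L'' \<Longrightarrow> tlen L' \<le> tlen L''"
    using ex_has_least_nat[of "heq L" L tlen] by auto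
  then show ?thesis unfolding minimal_def using heq_trans by blast
qed

text \<open>Writing p for the partial products of a minimal tuple, a difference of the first letters
  of -p(j) + p(i-1) and -p(j) + p(i) would allow strand i to be shortened by moving it to position j.\<close>

lemma minimal_left:
  assumes "minimal (P @ (B @ [X]) @ S)" "list_all is_conj (B @ [X])" "B \<noteq> []"
  shows "hd (rd (sum_list B + X)) = hd (rd (sum_list B))"
proof (rule ccontr)
  assume neq: "\<not> ?thesis"
  have n: "sum_list B \<noteq> 0" "sum_list B + X \<noteq> 0"
    using sum_list_conj_nonzero[of B] sum_list_conj_nonzero[of "B @ [X]"] assms by auto
  have "rd X = rd (- sum_list B) @ rd (sum_list B + X)"
    by (rule full_cancel) (use n neq in auto)
  then have "len (sum_list B + X + - sum_list B) < len X"
    by (rule conj_shorter[rotated]) (use assms n in auto)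
  then have "tlen (P @ ((sum_list B + X - sum_list B) # B) @ S) < tlen (P @ (B @ [X]) @ S)" by simp
  moreover have "heq (P @ (B @ [X]) @ S) (P @ ((sum_list B + X - sum_list B) # B) @ S)"
    by (rule heq_ctx) (rule heq_move_left)
  ultimately show False using assms(1) unfolding minimal_def by (meson not_le)
qed

lemma minimal_right:
  assumes "minimal (P @ (X # B) @ S)" "list_all is_conj (X # B)" "B \<noteq> []"
  shows "hd (rd (- (X + sum_list B))) = hd (rd (- sum_list B))"
proof (rule ccontr)
  assume neq: "\<not> ?thesis"
  have n: "sum_list B \<noteq> 0" "X + sum_list B \<noteq> 0"
    using sum_list_conj_nonzero[of B] sum_list_conj_nonzero[of "X # B"] assms by auto
  have eq: "- (X + sum_list B) + X = - sum_list B"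
    by (simp add: grp_simps del: add_uminus_conv_diff)
  have "rd X = rd (- (- (X + sum_list B))) @ rd (- (X + sum_list B) + X)"
    by (rule full_cancel) (use n neq eq in auto)
  then have "rd X = rd (X + sum_list B) @ rd (- sum_list B)" by (simp add: eq)
  then have "len (- sum_list B + (X + sum_list B)) < len X"
    by (rule conj_shorter[rotated]) (use assms n in auto)
  then have "tlen (P @ (B @ [- sum_list B + X + sum_list B]) @ S) < tlen (P @ (X # B) @ S)"
    by (simp add: add.assoc)
  moreover have "heq (P @ (X # B) @ S) (P @ (B @ [- sum_list B + X + sum_list B]) @ S)"
    by (rule heq_ctx) (rule heq_move_right)
  ultimately show False using assms(1) unfolding minimal_def by (meson not_le)
qed

text \<open>Iterates \<open>minimal_left\<close>: for every interval of a minimal tuple, the first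
  letter of the product is that of a single strand. \<open>minimal_suffix\<close> is the mirror
  image.\<close>

lemma minimal_prefix:
  assumes "minimal (P @ Q @ S)" "list_all is_conj Q" "Q \<noteq> []"
  shows "hd (rd (sum_list Q)) = hd (rd (hd Q))"
  using assms
proof (induction Q arbitrary: S rule: rev_induct)
  case (snoc X B)
  show ?case
  proof (cases "B = []")
    case False
    have "hd (rd (sum_list B + X)) = hd (rd (sum_list B))"
      by (rule minimal_left[OF snoc.prems(1,2) False])
    also have "\<dots> = hd (rd (hd B))"
      by (rule snoc.IH[of "X # S"]) (use snoc.prems False in auto)
    finally show ?thesis using False by simp
  qed simp
qed simp

lemma minimal_suffix:
  assumes "minimal (P @ Q @ S)" "list_all is_conj Q" "Q \<noteq> []"
  shows "hd (rd (- sum_list Q)) = hd (rd (- last Q))"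
  using assms
proof (induction Q arbitrary: P)
  case (Cons X B)
  show ?case
  proof (cases "B = []")
    case False
    have "hd (rd (- (X + sum_list B))) = hd (rd (- sum_list B))"
      by (rule minimal_right[OF Cons.prems(1,2) False])
    also have "\<dots> = hd (rd (- last B))"
      by (rule Cons.IH[of "P @ [X]"]) (use Cons.prems False in auto)
    finally show ?thesis using False by simp
  qed simp
qed simp

lemma hd_last_rd_upt:
  assumes "a < b"
  shows "hd (rd (sum_list (map gx [a..<b]))) = (a, True)"
    "last (rd (sum_list (map gx [a..<b]))) = (b - 1, True)"
  using assms by (simp_all only: rd_sum_list_gx) (simp_all add: last_map hd_map)

lemma switch_or_const:
  obtains P Q where "xs = P @ Q" "P \<noteq> []" "Q \<noteq> []" "f (last P) \<noteq> f (hd Q)"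
  | "\<forall>x \<in> set xs. f x = f (hd xs)"
proof -
  have "(\<exists>P Q. xs = P @ Q \<and> P \<noteq> [] \<and> Q \<noteq> [] \<and> f (last P) \<noteq> f (hd Q)) \<or>
      (\<forall>x \<in> set xs. f x = f (hd xs))"
  proof (induction xs)
    case (Cons x xs)
    show ?case
    proof (cases "xs = [] \<or> f x = f (hd xs)")
      case True
      then show ?thesis
      proof
        assume "f x = f (hd xs)"
        from Cons show ?thesis
        proof (elim disjE exE conjE)
          fix P Q assume "xs = P @ Q" "P \<noteq> []" "Q \<noteq> []" "f (last P) \<noteq> f (hd Q)"
          then show ?thesis by (intro disjI1 exI[of _ "x # P"] exI[of _ Q]) auto
        qed (use \<open>f x = f (hd xs)\<close> in auto)
      qed auto
    next
      case False
      then show ?thesis by (intro disjI1 exI[of _ "[x]"] exI[of _ xs]) auto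
    qed
  qed simp
  then show ?thesis using that by blast
qed

section \<open>Cutting simple elements between the two factors\<close>

locale splitting =
  fixes n k :: nat
  assumes k0: "0 < k" and kn: "k < n"
begin

definition gens :: "fgrp list" where "gens = map gx [0..<n]"

definition ty :: "nat \<times> bool \<Rightarrow> bool" where "ty x \<longleftrightarrow> fst x < k"

abbreviation hty :: "fgrp \<Rightarrow> bool" where "hty g \<equiv> ty (hd (rd g))"
abbreviation lty :: "fgrp \<Rightarrow> bool" where "lty g \<equiv> ty (last (rd g))"

definition pure :: "bool \<Rightarrow> fgrp \<Rightarrow> bool" where
  "pure T g \<longleftrightarrow> (\<forall>x \<in> set (rd g). ty x = T)"

definition Simp :: "fgrp \<Rightarrow> bool" where
  "Simp g \<longleftrightarrow> (\<exists>L R. heq gens (L @ R) \<and> L \<noteq> [] \<and> g = sum_list L)"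

definition splits :: "fgrp \<Rightarrow> fgrp \<Rightarrow> fgrp \<Rightarrow> bool" where
  "splits g e v \<longleftrightarrow> g = e + v \<and> rd g = rd e @ rd v \<and> e \<noteq> 0 \<and> v \<noteq> 0 \<and> lty e \<noteq> hty v \<and>
     (Simp e \<or> Simp (- e)) \<and> (Simp v \<or> Simp (- v))"

definition Good :: "fgrp \<Rightarrow> bool" where
  "Good g \<longleftrightarrow> (\<exists>T. pure T g) \<or> (\<exists>e v. splits g e v)"

lemma hty_conj_uminus: "is_conj X \<Longrightarrow> hty (- X) = hty X"
  by (simp add: ty_def hd_is_conj_uminus)

lemma lty_uminus: "g \<noteq> 0 \<Longrightarrow> lty (- g) = hty g"
  by (simp add: rd_uminus last_winv ty_def)

lemma hty_uminus: "g \<noteq> 0 \<Longrightarrow> hty (- g) = lty g"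
  by (simp add: rd_uminus hd_winv ty_def)

lemma list_all_gens: "list_all is_conj gens"
  by (simp add: gens_def list_all_iff)

lemma heq_gens_conj: "heq gens L \<Longrightarrow> list_all is_conj L"
  using heq_is_conj list_all_gens by blast

text \<open>The block \<open>P\<close> moves behind \<open>L\<close> by
  \<open>heq_block_right\<close>, which turns any interval of a tuple in the orbit into an initial
  segment.\<close>

lemma Simp_mid:
  assumes "heq gens (P @ L @ S)" "L \<noteq> []" shows "Simp (sum_list L)"
proof -
  have "heq ((P @ L) @ S) ((L @ map (\<lambda>y. - sum_list L + y + sum_list L) P) @ S)"
    by (rule heq_append1) (rule heq_block_right)
  with assms have "heq gens (L @ (map (\<lambda>y. - sum_list L + y + sum_list L) P @ S))"
    using heq_trans by fastforce
  then show ?thesis using assms(2) unfolding Simp_def by blast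
qed

lemma Simp_nonzero: "Simp g \<Longrightarrow> g \<noteq> 0"
  unfolding Simp_def using heq_gens_conj sum_list_conj_nonzero by (metis list_all_append)

text \<open>The source of all cuts except that of the full product: \<open>b\<close> is the
  difference of \<open>a\<close> and \<open>a + b\<close>, and by \<open>full_cancel\<close> nothing
  cancels in it when these begin in different factors.\<close>

lemma splitsI:
  assumes "a \<noteq> 0" "a + b \<noteq> 0" "hty a \<noteq> hty (a + b)"
    "Simp a \<or> Simp (- a)" "Simp (a + b) \<or> Simp (- (a + b))"
  shows "splits b (- a) (a + b)"
proof -
  have "rd b = rd (- a) @ rd (a + b)" by (rule full_cancel) (use assms in auto)
  then show ?thesis using assms unfolding splits_def
    by (auto simp: lty_uminus)
qed

lemma pure_add: "pure T a \<Longrightarrow> pure T b \<Longrightarrow> pure T (a + b)"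
  unfolding pure_def by (rule rd_add_decomp[of a b]) auto

lemma pure_uminus: "pure T (- a) = pure T a"
  by (auto simp: pure_def rd_uminus set_winv ty_def)

lemma pure_0 [simp]: "pure T 0"
  by (simp add: pure_def)

lemma pure_gx: "pure T (gx i) \<longleftrightarrow> (i < k) = T"
  by (simp add: pure_def ty_def)

lemma pure_sum_list: "list_all (pure T) L \<Longrightarrow> pure T (sum_list L)"
  by (induction L) (auto simp: pure_add)

lemma pure_heq:
  assumes "heq L L'" "list_all (pure T) L" shows "list_all (pure T) L'"
proof -
  have "list_all (pure T) (hz w L)" if "braid_word (length L) w" for w
    using that
  proof (induction w)
    case (Cons x w)
    obtain i b where x: "x = (i, b)" by fastforce
    obtain A a c B where AB: "hz w L = A @ a # c # B" "length A = i"
      by (rule list_split2[of i "hz w L"]) (use Cons.prems x in \<open>auto simp: braid_word_Cons\<close>)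
    have "pure T (a + c - a)" "pure T (- c + a + c)" if "pure T a" "pure T c"
      using that pure_add[of T "a + c" "- a"] by (auto simp: pure_add pure_uminus)
    then show ?case using Cons AB
      by (cases b) (auto simp: x hz_Cons hzl_True hzl_False braid_word_Cons simp del: hzl.simps)
  qed (simp add: assms)
  then show ?thesis using assms unfolding heq_def by blast
qed

text \<open>Under the hypothesis on first letters nothing cancels between the two products, so they
  are the two parts of the positive word x(1) ... x(n) cut somewhere. The letters next to the cut
  lie in different factors, which forces the cut to be at \<open>k\<close>. By
  \<open>Artin_reduction\<close> each block is then equivalent to generators of one factor.\<close>

lemma boundary:
  assumes "heq gens (P @ Q)" "P \<noteq> []" "Q \<noteq> []" "hty (- sum_list P) \<noteq> hty (sum_list Q)"
  shows "sum_list P = sum_list (map gx [0..<k])" "sum_list Q = sum_list (map gx [k..<n])"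
    "list_all (pure True) P" "list_all (pure False) Q"
proof -
  have cj: "list_all is_conj P" "list_all is_conj Q" using heq_gens_conj[OF assms(1)] by auto
  have c: "sum_list P + sum_list Q = sum_list gens"
    using heq_sum_list[OF assms(1)] by simp
  have neq: "hd (rd (- sum_list P)) \<noteq> hd (rd (sum_list Q))" using assms(4) by auto
  have "rd (sum_list P + sum_list Q) = rd (sum_list P) @ rd (sum_list Q)"
    using full_cancel[of "- sum_list P" "sum_list P + sum_list Q"] neq
      sum_list_conj_nonzero[OF cj(1) assms(2)] sum_list_conj_nonzero[OF cj(2) assms(3)] by simp
  then have "rd (sum_list P) @ rd (sum_list Q) = map (\<lambda>i. (i, True)) [0..<n]"
    using rd_sum_list_gx[of "[0..<n]"] by (simp add: c gens_def)
  then obtain us vs where uv: "[0..<n] = us @ vs" "rd (sum_list P) = map (\<lambda>i. (i, True)) us"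
    "rd (sum_list Q) = map (\<lambda>i. (i, True)) vs" by (metis map_eq_append_conv)
  have ne: "us \<noteq> []" "vs \<noteq> []" using uv sum_list_conj_nonzero cj assms by auto
  define j where "j = length us"
  have j: "0 < j" "j < n" using ne arg_cong[OF uv(1), of length] by (auto simp: j_def)
  have us: "us = [0..<j]" using arg_cong[OF uv(1), of "take j"] j by (simp add: j_def)
  have vs: "vs = [j..<n]" using arg_cong[OF uv(1), of "drop j"] j by (simp add: j_def)
  have "hty (- sum_list P) = (j - 1 < k)"
    using hty_uminus[OF sum_list_conj_nonzero[OF cj(1) assms(2)]] j uv(2) us
    by (simp add: ty_def last_map)
  moreover have "hty (sum_list Q) = (j < k)"
    using j uv(3) vs ne by (simp add: ty_def upt_conv_Cons)
  ultimately have "j = k" using assms(4) j by auto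
  have P: "sum_list P = sum_list (map gx [0..<k])"
    using uv(2) us \<open>j = k\<close> rd_sum_list_gx by (metis rd_inject)
  have Q: "sum_list Q = sum_list (map gx [k..<n])"
    using uv(3) vs \<open>j = k\<close> rd_sum_list_gx by (metis rd_inject)
  have lgx: "list_all is_conj (map gx xs)" for xs by (simp add: list_all_iff)
  have "length P = k" using expsum_sum_list[OF cj(1)] expsum_sum_list[OF lgx, of "[0..<k]"] P by simp
  then have "heq P (map gx [0..<k])" using cj P by (intro Artin_reduction) auto
  moreover have "list_all (pure True) (map gx [0..<k])" by (simp add: list_all_iff pure_gx)
  ultimately have 1: "list_all (pure True) P" using pure_heq heq_sym by blast
  have "length Q = n - k" using expsum_sum_list[OF cj(2)] expsum_sum_list[OF lgx, of "[k..<n]"] Q by simp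
  then have "heq Q (map gx [k..<n])" using cj Q by (intro Artin_reduction) auto
  moreover have "list_all (pure False) (map gx [k..<n])" by (auto simp: list_all_iff pure_gx)
  ultimately have 2: "list_all (pure False) Q" using pure_heq heq_sym by blast
  show "sum_list P = sum_list (map gx [0..<k])" "sum_list Q = sum_list (map gx [k..<n])"
    "list_all (pure True) P" "list_all (pure False) Q" by fact+
qed

text \<open>The tuple is cut into two minimal blocks.  Where the side of the first letter switches between
  neighbouring strands, the partial product cuts the block products; without any switch
  the full product c does.\<close>

lemma Good_blocks:
  assumes orb: "heq gens (L @ R)" and ne: "L \<noteq> []" "R \<noteq> []" and min: "minimal L" "minimal R"
  shows "(Good (sum_list L) \<and> Good (sum_list R)) \<or>
    (\<forall>X \<in> set (L @ R). hty X) \<and> Good (sum_list L) \<or>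
    (\<forall>X \<in> set (L @ R). \<not> hty X) \<and> Good (sum_list R)"
proof -
  have cj: "list_all is_conj L" "list_all is_conj R" using heq_gens_conj[OF orb] by auto
  have minL: "hd (rd (sum_list Q)) = hd (rd (hd Q))" "hd (rd (- sum_list Q)) = hd (rd (- last Q))"
    if "L = P @ Q @ S" "Q \<noteq> []" for P Q S
    using minimal_prefix[of P Q S] minimal_suffix[of P Q S] min(1) cj that by auto
  have minR: "hd (rd (sum_list Q)) = hd (rd (hd Q))" "hd (rd (- sum_list Q)) = hd (rd (- last Q))"
    if "R = P @ Q @ S" "Q \<noteq> []" for P Q S
    using minimal_prefix[of P Q S] minimal_suffix[of P Q S] min(2) cj that by auto
  have hlast: "hty (- last Q) = hty (last Q)" if "list_all is_conj Q" "Q \<noteq> []" for Q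
    using that by (intro hty_conj_uminus) (auto simp: list_all_iff)
  show ?thesis
  proof (rule switch_or_const[of L hty])
    fix P Q assume PQ: "L = P @ Q" "P \<noteq> []" "Q \<noteq> []" "hty (last P) \<noteq> hty (hd Q)"
    have cPQ: "list_all is_conj P" "list_all is_conj Q" "list_all is_conj (Q @ R)"
      using cj PQ by auto
    have orb': "heq gens ([] @ P @ (Q @ R))" "heq gens (P @ Q @ R)" "heq gens (P @ (Q @ R) @ [])"
      using orb PQ by auto
    have S: "Simp (sum_list P)" "Simp (sum_list Q)" "Simp (sum_list (Q @ R))"
      using Simp_mid[OF orb'(1)] Simp_mid[OF orb'(2)] Simp_mid[OF orb'(3)] PQ ne by auto
    have hP: "hty (- sum_list P) = hty (last P)"
      using minL(2)[of "[]" P Q] PQ cPQ hlast by simp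
    have hQ: "hty (sum_list Q) = hty (hd Q)" using minL(1)[of P Q "[]"] PQ by simp
    have "splits (sum_list L) (- (- sum_list P)) (- sum_list P + sum_list L)"
      by (rule splitsI) (use PQ S hP hQ S[THEN Simp_nonzero] in auto)
    then have "Good (sum_list L)" unfolding Good_def by blast
    moreover have "Good (sum_list R)"
    \<comment> \<open>If the sides agree, the products of \<open>Q\<close> and of
      \<open>Q @ R\<close> begin in different factors and cut the product of \<open>R\<close>. If
      not, \<open>P\<close> and \<open>Q @ R\<close> meet at the boundary of the factors.\<close>
    proof (cases "hty (- sum_list P) = hty (sum_list (Q @ R))")
      case True
      have "splits (sum_list R) (- sum_list Q) (sum_list Q + sum_list R)"
        by (rule splitsI) (use PQ S hP hQ True S[THEN Simp_nonzero] in auto)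
      then show ?thesis unfolding Good_def by blast
    next
      case False
      then have "list_all (pure False) (Q @ R)"
        using boundary(4)[of P "Q @ R"] orb' PQ by simp
      then have "pure False (sum_list R)" by (intro pure_sum_list) simp
      then show ?thesis unfolding Good_def by blast
    qed
    ultimately show ?thesis by blast
  next
    assume constL: "\<forall>X \<in> set L. hty X = hty (hd L)"
    show ?thesis
    proof (rule switch_or_const[of R hty])
      fix P Q assume PQ: "R = P @ Q" "P \<noteq> []" "Q \<noteq> []" "hty (last P) \<noteq> hty (hd Q)"
      have cPQ: "list_all is_conj P" "list_all is_conj Q" using cj PQ by auto
      have orb': "heq gens ([] @ (L @ P) @ Q)" "heq gens (L @ P @ Q)" "heq gens ((L @ P) @ Q @ [])"
        using orb PQ by auto
      have S: "Simp (sum_list (L @ P))" "Simp (sum_list P)" "Simp (sum_list Q)"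
        using Simp_mid[OF orb'(1)] Simp_mid[OF orb'(2)] Simp_mid[OF orb'(3)] PQ ne by auto
      have hP: "hty (- sum_list P) = hty (last P)"
        using minR(2)[of "[]" P Q] PQ cPQ hlast by simp
      have hQ: "hty (sum_list Q) = hty (hd Q)" using minR(1)[of P Q "[]"] PQ by simp
      have "splits (sum_list R) (- (- sum_list P)) (- sum_list P + sum_list R)"
        by (rule splitsI) (use PQ S hP hQ S[THEN Simp_nonzero] in auto)
      then have "Good (sum_list R)" unfolding Good_def by blast
      moreover have "Good (sum_list L)"
      proof (cases "hty (- sum_list (L @ P)) = hty (sum_list Q)")
        case True
        have eq: "- sum_list (L @ P) + sum_list L = - sum_list P"
          by (simp add: grp_simps del: add_uminus_conv_diff)
        have "splits (sum_list L) (- (- sum_list (L @ P))) (- sum_list P)"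
          by (rule splitsI[of "- sum_list (L @ P)" "sum_list L", unfolded eq])
            (use PQ S hP hQ True S[THEN Simp_nonzero] in auto)
        then show ?thesis unfolding Good_def by blast
      next
        case False
        then have "list_all (pure True) (L @ P)"
          using boundary(3)[of "L @ P" Q] orb' PQ by simp
        then have "pure True (sum_list L)" by (intro pure_sum_list) simp
        then show ?thesis unfolding Good_def by blast
      qed
      ultimately show ?thesis by blast
    next
      assume constR: "\<forall>X \<in> set R. hty X = hty (hd R)"
      have orb': "heq gens ([] @ L @ R)" "heq gens (L @ R @ [])" "heq gens ([] @ (L @ R) @ [])"
        using orb by auto
      have S: "Simp (sum_list L)" "Simp (sum_list R)" "Simp (sum_list (L @ R))"
        using Simp_mid[OF orb'(1)] Simp_mid[OF orb'(2)] Simp_mid[OF orb'(3)] ne by auto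
      have hL: "hty (sum_list L) = hty (hd L)" "hty (- sum_list L) = hty (last L)"
        using minL[of "[]" L "[]"] ne cj hlast by auto
      have hR: "hty (sum_list R) = hty (hd R)" "hty (- sum_list R) = hty (last R)"
        using minR[of "[]" R "[]"] ne cj hlast by auto
      have c: "sum_list (L @ R) = sum_list (map gx [0..<n])"
        using heq_sum_list[OF orb] by (simp add: gens_def)
      have c_nz: "sum_list (map gx [0..<n]) \<noteq> 0"
        using sum_list_conj_nonzero[OF list_all_gens] kn by (simp add: gens_def)
      have "0 < n" using kn by simp
      have hc: "hty (sum_list (L @ R))"
        unfolding c hd_last_rd_upt(1)[OF \<open>0 < n\<close>] using k0 by (simp add: ty_def)
      have hc': "\<not> hty (- sum_list (L @ R))"
        unfolding c hty_uminus[OF c_nz] hd_last_rd_upt(2)[OF \<open>0 < n\<close>] using kn by (auto simp: ty_def)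
      show ?thesis
      proof (cases "hty (last L) = hty (hd R)")
        case False
        then have "list_all (pure True) L" "list_all (pure False) R"
          using boundary(3,4)[OF orb ne] hL hR by auto
        then have "pure True (sum_list L)" "pure False (sum_list R)" by (intro pure_sum_list; simp)+
        then show ?thesis unfolding Good_def by blast
      next
        \<comment> \<open>All strands now begin on one side. The full product begins in the first
          factor and its inverse in the second; just one of the two is on the other side, and it
          cuts only one block. This is the origin of the asymmetric alternatives in the
          statement.\<close>
        case True
        have const: "hty X = hty (hd L)" if "X \<in> set (L @ R)" for X
        proof -
          have "hty (last L) = hty (hd L)" using bspec[OF constL last_in_set[OF ne(1)]] .
          then show ?thesis using True bspec[OF constL, of X] bspec[OF constR, of X] that
            by (metis Un_iff set_append)
        qed
        show ?thesis
        proof (cases "hty (hd L)")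
          case True
          have eq: "- sum_list (L @ R) + sum_list L = - sum_list R"
            by (simp add: grp_simps del: add_uminus_conv_diff)
          have "hty (- sum_list R)" using hR const[of "last R"] ne True by simp
          then have "splits (sum_list L) (- (- sum_list (L @ R))) (- sum_list R)"
            by (intro splitsI[of "- sum_list (L @ R)" "sum_list L", unfolded eq])
              (use S S[THEN Simp_nonzero] hc hc' in auto)
          then show ?thesis using const True unfolding Good_def by blast
        next
          case False
          have "splits (sum_list R) (- sum_list L) (sum_list L + sum_list R)"
            by (rule splitsI) (use S S[THEN Simp_nonzero] hc hL False in auto)
          then show ?thesis using const False unfolding Good_def by blast
        qed
      qed
    qed
  qed
qed

text \<open>Replacing either block by a minimal one changes neither its product nor the orbit, so
  \<open>Good_blocks\<close> applies. It misses the first block only when all strands begin in the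
  second factor.\<close>

lemma Simp_Good: "Simp g \<Longrightarrow> Good g"
proof -
  assume "Simp g"
  then obtain L R where LR: "heq gens (L @ R)" "L \<noteq> []" "g = sum_list L"
    unfolding Simp_def by blast
  show "Good g"
  proof (cases "R = []")
    case True
    have g: "g = sum_list (map gx [0..<n])" using heq_sum_list[OF LR(1)] LR(3) True by (simp add: gens_def)
    have n: "[0..<n] = [0..<k] @ [k..<n]" using kn upt_add_eq_append[of 0 k "n - k"] by simp
    let ?c1 = "sum_list (map gx [0..<k])" and ?c2 = "sum_list (map gx [k..<n])"
    have "Simp ?c1" "Simp ?c2"
      using Simp_mid[of "[]" "map gx [0..<k]" "map gx [k..<n]"]
        Simp_mid[of "map gx [0..<k]" "map gx [k..<n]" "[]"] k0 kn n
      by (simp_all add: gens_def)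
    moreover have "g = ?c1 + ?c2" using g n by simp
    moreover have "lty ?c1" "\<not> hty ?c2"
      using hd_last_rd_upt[of 0 k] hd_last_rd_upt[of k n] k0 kn by (simp_all only: ty_def) auto
    moreover have "rd g = rd ?c1 @ rd ?c2" unfolding g rd_sum_list_gx n by simp
    ultimately have "splits g ?c1 ?c2" unfolding splits_def using Simp_nonzero by blast
    then show ?thesis unfolding Good_def by blast
  next
    case False
    obtain L' where L': "heq L L'" "minimal L'" using minimal_exists by blast
    obtain R' where R': "heq R R'" "minimal R'" using minimal_exists by blast
    have g: "g = sum_list L'" using heq_sum_list[OF L'(1)] LR(3) by simp
    have ne: "L' \<noteq> []" "R' \<noteq> []"
      using heq_length[OF L'(1)] heq_length[OF R'(1)] LR(2) False by auto
    have "heq (L @ R) (L' @ R)" using L'(1) by (rule heq_append1)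
    also have "heq (L' @ R) (L' @ R')" using R'(1) by (rule heq_append2)
    finally have orb: "heq gens (L' @ R')" using LR(1) heq_trans by blast
    from Good_blocks[OF orb ne L'(2) R'(2)] show ?thesis
    proof (elim disjE conjE)
      \<comment> \<open>Interchange the blocks. The old first block becomes the second one, and its
        strands still begin in the second factor, which excludes the only alternative that would
        miss it.\<close>
      assume allF: "\<forall>X \<in> set (L' @ R'). \<not> hty X"
      let ?R = "map (\<lambda>y. sum_list L' + y - sum_list L') R'"
      obtain R'' where R'': "heq ?R R''" "minimal R''" using minimal_exists by blast
      have "heq (L' @ R') (?R @ L')" by (rule heq_block_left)
      also have "heq (?R @ L') (R'' @ L')" using R''(1) by (rule heq_append1)
      finally have "heq gens (R'' @ L')" using orb heq_trans by blast
      moreover have "R'' \<noteq> []" using heq_length[OF R''(1)] ne by auto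
      ultimately have "(Good (sum_list R'') \<and> Good (sum_list L')) \<or>
        (\<forall>X \<in> set (R'' @ L'). hty X) \<and> Good (sum_list R'') \<or>
        (\<forall>X \<in> set (R'' @ L'). \<not> hty X) \<and> Good (sum_list L')"
        using Good_blocks ne R'' L' by blast
      moreover have "\<exists>X \<in> set (R'' @ L'). \<not> hty X" using allF ne by (cases L') auto
      ultimately show ?thesis using g by auto
    qed (use g in auto)
  qed
qed

end

section \<open>The geometric representation\<close>

interpretation fv: vector_space "\<lambda>r (f :: nat \<Rightarrow> real) i. r * f i"
  by unfold_locales (auto simp: fun_eq_iff algebra_simps)

definition bas :: "nat \<Rightarrow> nat \<Rightarrow> real" where "bas i = (\<lambda>j. if j = i then 1 else 0)"

text \<open>Twice the Tits form on pairs of simple roots. Order one gives 2, and the value at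
  infinity is the limit of the finite ones.\<close>

definition cox_coeff :: "(nat \<Rightarrow> nat \<Rightarrow> enat) \<Rightarrow> nat \<Rightarrow> nat \<Rightarrow> real" where
  "cox_coeff M i j = (case M i j of enat m \<Rightarrow> - 2 * cos (pi / real m) | \<infinity> \<Rightarrow> - 2)"

locale coxeter =
  fixes n :: nat and M :: "nat \<Rightarrow> nat \<Rightarrow> enat"
  assumes M: "coxeter_matrix n M"
begin

abbreviation cc :: "nat \<Rightarrow> nat \<Rightarrow> real" where "cc \<equiv> cox_coeff M"

definition form :: "nat \<Rightarrow> (nat \<Rightarrow> real) \<Rightarrow> real" where
  "form i v = (\<Sum>j<n. cc i j * v j)"

text \<open>Indices outside the range act as the identity, so that \<open>refl_refl\<close> holds
  for every letter a derivation may insert.\<close>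

definition refl :: "nat \<Rightarrow> (nat \<Rightarrow> real) \<Rightarrow> nat \<Rightarrow> real" where
  "refl i v = (if i < n then v(i := v i - form i v) else v)"

text \<open>The sign of a letter is dropped because reflections are involutions.\<close>

definition rho :: "nat word \<Rightarrow> (nat \<Rightarrow> real) \<Rightarrow> nat \<Rightarrow> real" where
  "rho w = foldr (\<lambda>x. refl (fst x)) w"

lemma rho_Nil [simp]: "rho [] = id"
  and rho_Cons: "rho (x # w) = refl (fst x) \<circ> rho w"
  and rho_append: "rho (u @ v) = rho u \<circ> rho v"
  by (auto simp: rho_def fun_eq_iff)

lemma cc_diag: "i < n \<Longrightarrow> cc i i = 2"
  using M by (simp add: coxeter_matrix_def cox_coeff_def one_enat_def)

lemma form_upd: "i < n \<Longrightarrow> form l (v(i := x)) = form l v + cc l i * (x - v i)"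
  by (simp add: form_def sum.remove[of "{..<n}" i] algebra_simps)

lemma refl_refl [simp]: "refl i (refl i v) = v"
  by (auto simp: refl_def form_upd cc_diag)

text \<open>In the two coordinates moved by a pair of reflections, their product is a rotation by
  2 pi / m around the point (x0, y0).\<close>

lemma dihedral:
  assumes ij: "i < n" "j < n" "i \<noteq> j" "M i j = enat m"
  shows "((refl i \<circ> refl j) ^^ m) v = v"
proof -
  have m: "m \<ge> 2" and M': "M j i = enat m"
  proof -
    have "2 \<le> M i j" "M j i = M i j" using M ij(1-3) unfolding coxeter_matrix_def by auto
    then show "m \<ge> 2" "M j i = enat m" using ij(4) by (auto simp: numeral_eq_enat)
  qed
  define \<theta> where "\<theta> = pi / real m"
  have cij: "cc i j = - 2 * cos \<theta>" "cc j i = - 2 * cos \<theta>" "cc i i = 2" "cc j j = 2"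
    using ij M' cc_diag by (auto simp: cox_coeff_def \<theta>_def)
  have "0 < \<theta>" "\<theta> < pi" using m by (auto simp: \<theta>_def field_simps)
  then have s: "sin \<theta> > 0" by (rule sin_gt_zero)
  define v0 where "v0 = v(i := 0, j := 0)"
  define ri where "ri = form i v0"
  define rj where "rj = form j v0"
  \<comment> \<open>The centre of the rotation: \<open>form i\<close> and \<open>form j\<close>
    vanish where the two coordinates are \<open>x0\<close> and \<open>y0\<close>, which is the
    linear system solved below.\<close>
  define x0 where "x0 = - (ri + cos \<theta> * rj) / (2 * (sin \<theta>)\<^sup>2)"
  define y0 where "y0 = - (rj + cos \<theta> * ri) / (2 * (sin \<theta>)\<^sup>2)"
  have s2: "cos \<theta> * cos \<theta> = 1 - (sin \<theta>)\<^sup>2" using sin_cos_squared_add[of \<theta>] by (simp add: power2_eq_square)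
  have x0: "2 * x0 - 2 * cos \<theta> * y0 = - ri"
  proof -
    have "2 * x0 - 2 * cos \<theta> * y0 = - (ri * (1 - cos \<theta> * cos \<theta>)) / (sin \<theta>)\<^sup>2"
      unfolding x0_def y0_def using s by (simp add: field_simps)
    then show ?thesis using s by (simp add: s2)
  qed
  have y0: "2 * y0 - 2 * cos \<theta> * x0 = - rj"
  proof -
    have "2 * y0 - 2 * cos \<theta> * x0 = - (rj * (1 - cos \<theta> * cos \<theta>)) / (sin \<theta>)\<^sup>2"
      unfolding x0_def y0_def using s by (simp add: field_simps)
    then show ?thesis using s by (simp add: s2)
  qed
  \<comment> \<open>\<open>P\<close> and \<open>Q\<close> are fitted so that
    \<open>st \<theta> 0 = v\<close>. By the recursion \<open>hh\<close> each reflection advances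
    the phase of its own coordinate by twice \<open>\<theta>\<close>, so \<open>m\<close> rounds
    advance both by a full turn.\<close>
  define Q where "Q = v j - y0"
  define P where "P = (v i - x0 - Q * cos \<theta>) / sin \<theta>"
  define h where "h t = P * sin t + Q * cos t" for t
  define st where "st t u = v(i := x0 + h t, j := y0 + h u)" for t u
  have form: "form l (st t u) = form l v0 + cc l i * (x0 + h t) + cc l j * (y0 + h u)" for l t u
  proof -
    have "st t u = v0(i := x0 + h t, j := y0 + h u)" using ij by (auto simp: st_def v0_def)
    moreover have "v0 i = 0" "v0 j = 0" using ij by (auto simp: v0_def)
    ultimately show ?thesis using ij by (simp add: form_upd)
  qed
  have hh: "h (t + 2 * \<theta>) = 2 * cos \<theta> * h (t + \<theta>) - h t" for t
  proof -
    have "sin (t + 2 * \<theta>) = 2 * cos \<theta> * sin (t + \<theta>) - sin t"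
      using sin_add[of "t + \<theta>" \<theta>] sin_diff[of "t + \<theta>" \<theta>] by (simp add: algebra_simps)
    moreover have "cos (t + 2 * \<theta>) = 2 * cos \<theta> * cos (t + \<theta>) - cos t"
      using cos_add[of "t + \<theta>" \<theta>] cos_diff[of "t + \<theta>" \<theta>] by (simp add: algebra_simps)
    ultimately have "h (t + 2 * \<theta>) = P * (2 * cos \<theta> * sin (t + \<theta>) - sin t) +
        Q * (2 * cos \<theta> * cos (t + \<theta>) - cos t)" by (simp only: h_def)
    then show ?thesis by (simp add: h_def algebra_simps)
  qed
  have rj: "refl j (st (t + \<theta>) t) = st (t + \<theta>) (t + 2 * \<theta>)" for t
  proof -
    have "y0 + h t - form j (st (t + \<theta>) t) = y0 + h (t + 2 * \<theta>)"
      unfolding form hh cij rj_def[symmetric] using y0 by (simp add: algebra_simps)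
    moreover have "st (t + \<theta>) t j = y0 + h t" by (simp add: st_def)
    ultimately have "st (t + \<theta>) t j - form j (st (t + \<theta>) t) = y0 + h (t + 2 * \<theta>)" by (simp only:)
    then have "refl j (st (t + \<theta>) t) = (st (t + \<theta>) t)(j := y0 + h (t + 2 * \<theta>))"
      by (simp only: refl_def ij if_True)
    then show ?thesis by (simp add: st_def)
  qed
  have ri: "refl i (st (t + \<theta>) (t + 2 * \<theta>)) = st (t + 2 * \<theta> + \<theta>) (t + 2 * \<theta>)" for t
  proof -
    have "h (t + 2 * \<theta> + \<theta>) = 2 * cos \<theta> * h (t + 2 * \<theta>) - h (t + \<theta>)"
      using hh[of "t + \<theta>"] by (simp add: algebra_simps)
    then have "x0 + h (t + \<theta>) - form i (st (t + \<theta>) (t + 2 * \<theta>)) = x0 + h (t + 2 * \<theta> + \<theta>)"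
      unfolding form cij ri_def[symmetric] using x0 by (simp add: algebra_simps)
    moreover have "st (t + \<theta>) (t + 2 * \<theta>) i = x0 + h (t + \<theta>)" using ij by (simp add: st_def)
    ultimately have "st (t + \<theta>) (t + 2 * \<theta>) i - form i (st (t + \<theta>) (t + 2 * \<theta>)) =
        x0 + h (t + 2 * \<theta> + \<theta>)" by (simp only:)
    then have "refl i (st (t + \<theta>) (t + 2 * \<theta>)) =
        (st (t + \<theta>) (t + 2 * \<theta>))(i := x0 + h (t + 2 * \<theta> + \<theta>))"
      by (simp only: refl_def ij if_True)
    then show ?thesis using ij by (auto simp: st_def fun_upd_twist)
  qed
  have pow: "((refl i \<circ> refl j) ^^ p) (st \<theta> 0) = st (2 * real p * \<theta> + \<theta>) (2 * real p * \<theta>)" for p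
  proof (induction p)
    case (Suc p)
    have e: "2 * real p * \<theta> + 2 * \<theta> = 2 * real (Suc p) * \<theta>" by (simp add: algebra_simps)
    show ?case using Suc rj[of "2 * real p * \<theta>"] ri[of "2 * real p * \<theta>"] by (simp only: funpow.simps o_apply e)
  qed simp
  have "2 * real m * \<theta> = 2 * pi" using m by (simp add: \<theta>_def)
  moreover have "h (2 * pi + \<theta>) = h \<theta>" "h (2 * pi) = h 0" by (simp_all add: h_def sin_add cos_add)
  ultimately have "st (2 * real m * \<theta> + \<theta>) (2 * real m * \<theta>) = st \<theta> 0"
    by (simp only: st_def)
  moreover have "st \<theta> 0 = v" using s by (auto simp: st_def h_def Q_def P_def)
  ultimately show ?thesis using pow[of m] by simp
qed

lemma rho_replicate: "rho (concat (replicate m [(i, True), (j, True)])) = (refl i \<circ> refl j) ^^ m"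
  by (induction m) (auto simp: rho_Cons comp_assoc)

lemma rho_relator: "r \<in> coxeter_rels n M \<Longrightarrow> rho r = id"
proof -
  assume "r \<in> coxeter_rels n M"
  then obtain i j m where r: "r = concat (replicate m [(i, True), (j, True)])"
    "i < n" "j < n" "M i j = enat m" by (auto simp: coxeter_rels_def)
  show ?thesis
  proof (cases "i = j")
    case True
    have "(id ^^ m) = (id :: (nat \<Rightarrow> real) \<Rightarrow> _)" by (induction m) auto
    moreover have "refl j \<circ> refl j = id" by (auto simp: fun_eq_iff)
    ultimately show ?thesis unfolding r rho_replicate using True by simp
  next
    case False
    then show ?thesis unfolding r rho_replicate using dihedral r by (auto simp: fun_eq_iff)
  qed
qed

lemma rho_pres_eq:
  assumes "pres_eq R u v" "R \<subseteq> coxeter_rels n M" shows "rho u = rho v"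
  using assms(1)
proof (induction rule: pres_eq.induct)
  case (cancel u a b v)
  show ?case by (auto simp: rho_append rho_Cons fun_eq_iff)
next
  case (rel r u v)
  then show ?case using rho_relator assms(2) by (auto simp: rho_append)
qed auto

definition rhoF :: "fgrp \<Rightarrow> (nat \<Rightarrow> real) \<Rightarrow> nat \<Rightarrow> real" where "rhoF g = rho (rd g)"

lemma rhoF_fg: "rhoF (fg w) = rho w"
  unfolding rhoF_def using rho_pres_eq[OF pres_eq_red[of "{}" w]] by (simp add: rd_fg)

lemma rhoF_add: "rhoF (a + b) = rhoF a \<circ> rhoF b"
  by (metis fg_append fg_rd rhoF_fg rho_append)

lemma rhoF_0 [simp]: "rhoF 0 = id"
  by (simp add: rhoF_def)

lemma rhoF_inv: "rhoF a (rhoF (- a) v) = v" "rhoF (- a) (rhoF a v) = v"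
  using rhoF_add[of a "- a"] rhoF_add[of "- a" a] by (auto simp: fun_eq_iff)

lemma rhoF_gx: "rhoF (gx i) = refl i"
  by (simp add: rhoF_def rho_Cons)

lemma form_lin: "form i (\<lambda>l. f l - a * g l) = form i f - a * form i g"
  by (simp add: form_def sum_subtractf sum_distrib_left algebra_simps)

lemma refl_lin: "refl i (\<lambda>l. f l - a * g l) = (\<lambda>l. refl i f l - a * refl i g l)"
  by (auto simp: refl_def form_lin algebra_simps)

lemma rho_lin: "rho w (\<lambda>l. f l - a * g l) = (\<lambda>l. rho w f l - a * rho w g l)"
  by (induction w) (auto simp: rho_Cons refl_lin)

text \<open>States that \<open>g\<close> acts trivially modulo the span of \<open>D\<close>. For
  fixed \<open>D\<close> this is stable under products and inverses, hence under Hurwitz moves, and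
  a conjugate of a generator requires only one root in \<open>D\<close>.\<close>

definition moves :: "(nat \<Rightarrow> real) set \<Rightarrow> fgrp \<Rightarrow> bool" where
  "moves D g \<longleftrightarrow> (\<forall>v. rhoF g v - v \<in> fv.span D)"

lemma moves_add: "moves D a \<Longrightarrow> moves D b \<Longrightarrow> moves D (a + b)"
  unfolding moves_def rhoF_add
proof
  fix v assume "\<forall>v. rhoF a v - v \<in> fv.span D" "\<forall>v. rhoF b v - v \<in> fv.span D"
  then have "(rhoF a (rhoF b v) - rhoF b v) + (rhoF b v - v) \<in> fv.span D"
    by (intro fv.span_add) auto
  then show "(rhoF a \<circ> rhoF b) v - v \<in> fv.span D" by simp
qed

lemma moves_uminus: "moves D a \<Longrightarrow> moves D (- a)"
  unfolding moves_def
proof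
  fix v assume "\<forall>v. rhoF a v - v \<in> fv.span D"
  then have "rhoF a (rhoF (- a) v) - rhoF (- a) v \<in> fv.span D" by blast
  then have "- (v - rhoF (- a) v) \<in> fv.span D" unfolding rhoF_inv by (rule fv.span_neg)
  then show "rhoF (- a) v - v \<in> fv.span D" by simp
qed

lemma moves_diff: "moves D a \<Longrightarrow> moves D b \<Longrightarrow> moves D (a - b)"
  using moves_add[of D a "- b"] moves_uminus by simp

lemma moves_sum_list: "list_all (moves D) L \<Longrightarrow> moves D (sum_list L)"
  by (induction L) (auto simp: moves_add, simp add: moves_def fv.span_zero)

lemma moves_mono: "moves D a \<Longrightarrow> D \<subseteq> D' \<Longrightarrow> moves D' a"
  unfolding moves_def using fv.span_mono by blast

lemma moves_is_conj:
  assumes "is_conj X" obtains d where "moves {d} X"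
proof -
  obtain w i where X: "X = w + gx i - w" using assms by (auto simp: is_conj_def)
  have "rhoF X v - v \<in> fv.span {rhoF w (bas i)}" for v
  proof -
    define u where "u = rhoF (- w) v"
    define a where "a = (if i < n then form i u else 0)"
    have "refl i u = (\<lambda>l. u l - a * bas i l)"
      by (auto simp: refl_def bas_def a_def)
    moreover have "rhoF X v = rhoF w (refl i u)"
      using rhoF_add[of "w + gx i" "- w"] by (simp add: X rhoF_add rhoF_gx u_def)
    ultimately have "rhoF X v = (\<lambda>l. v l - a * rhoF w (bas i) l)"
      using rho_lin[of "rd w" u a "bas i"] rhoF_inv(1)[of w v] by (simp add: rhoF_def u_def)
    then have "rhoF X v - v = (\<lambda>l. (- a) * rhoF w (bas i) l)" by (auto simp: fun_eq_iff)
    then show ?thesis using fv.span_scale[OF fv.span_base, of "rhoF w (bas i)" "{rhoF w (bas i)}" "- a"] by simp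
  qed
  then show ?thesis using that unfolding moves_def by blast
qed

lemma moves_hz:
  assumes "list_all (moves D) L" "braid_word (length L) w" shows "list_all (moves D) (hz w L)"
  using assms(2)
proof (induction w)
  case (Cons x w)
  obtain i b where x: "x = (i, b)" by fastforce
  obtain A a c B where AB: "hz w L = A @ a # c # B" "length A = i"
    by (rule list_split2[of i "hz w L"]) (use Cons.prems x in \<open>auto simp: braid_word_Cons\<close>)
  show ?case using Cons AB
    by (cases b) (auto simp: x hz_Cons hzl_True hzl_False braid_word_Cons moves_add moves_diff moves_uminus
        simp del: hzl.simps)
qed (simp add: assms)

text \<open>A trivial prefix product would let fewer than n root directions span all n simple ones.\<close>

lemma prefix_nontrivial:
  assumes "heq (map gx [0..<n]) (L @ R)" "L \<noteq> []"
  shows "rhoF (sum_list L) \<noteq> id"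
proof
  assume triv: "rhoF (sum_list L) = id"
  obtain X L' where L: "L = X # L'" using assms(2) by (cases L) auto
  have cj: "list_all is_conj (L @ R)"
    using heq_is_conj[OF assms(1)] by (simp add: list_all_iff)
  have len: "length (L @ R) = n" using heq_length[OF assms(1)] by simp
  have "\<exists>d. moves {d} Y" if "Y \<in> set (L' @ R)" for Y
    using moves_is_conj[of Y] cj that L by (auto simp: list_all_iff)
  then obtain f where f: "\<And>Y. Y \<in> set (L' @ R) \<Longrightarrow> moves {f Y} Y" by metis
  define D where "D = f ` set (L' @ R)"
  have D: "finite D" "card D \<le> n - 1"
    using card_image_le[of "set (L' @ R)" f] card_length[of "L' @ R"] len L by (auto simp: D_def)
  have mD: "list_all (moves D) (L' @ R)"
    unfolding list_all_iff using f moves_mono by (fastforce simp: D_def)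
  \<comment> \<open>Since the product of \<open>L\<close> acts trivially, \<open>X\<close> acts as
    the inverse of the product of \<open>L'\<close>; the roots of the other n - 1 entries therefore
    suffice for \<open>X\<close> as well.\<close>
  have "rhoF X = rhoF (X + sum_list L' - sum_list L')" by (simp add: add_diff_cancel)
  also have "\<dots> = rhoF (X + sum_list L') \<circ> rhoF (- sum_list L')"
    using rhoF_add[of "X + sum_list L'" "- sum_list L'"] by simp
  also have "\<dots> = rhoF (- sum_list L')" using triv L by simp
  finally have "moves D X"
    using moves_uminus[OF moves_sum_list, of D L'] mD by (simp add: moves_def)
  then have "list_all (moves D) (L @ R)" using mD L by simp
  moreover obtain w where "braid_word (length (L @ R)) w" "hz w (L @ R) = map gx [0..<n]"
    using heq_sym[OF assms(1)] unfolding heq_def by blast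
  ultimately have "list_all (moves D) (map gx [0..<n])" using moves_hz by metis
  then have "moves D (gx i)" if "i < n" for i using that by (simp add: list_all_iff)
  then have 1: "refl i (bas i) - bas i \<in> fv.span D" if "i < n" for i
    using that unfolding moves_def rhoF_gx by blast
  have 2: "bas i \<in> fv.span D" if "i < n" for i
  proof -
    have "form i (bas i) = 2"
      using that cc_diag[OF that] by (simp add: form_def bas_def if_distrib[of "\<lambda>x. _ * x"] sum.delta cong: if_cong)
    then have "refl i (bas i) - bas i = (\<lambda>l. (- 2) * bas i l)"
      using that by (auto simp: refl_def bas_def fun_eq_iff)
    then show ?thesis using fv.span_scale[OF 1[OF that], of "- 1 / 2"] by simp
  qed
  have inj: "inj_on bas {..<n}" by (auto simp: inj_on_def bas_def fun_eq_iff)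
  have "fv.independent (bas ` {..<n})"
  proof (rule fv.independent_if_scalars_zero)
    fix g :: "(nat \<Rightarrow> real) \<Rightarrow> real" and x
    assume g: "(\<Sum>x\<in>bas ` {..<n}. (\<lambda>i. g x * x i)) = 0" and "x \<in> bas ` {..<n}"
    then obtain i where i: "x = bas i" "i < n" by auto
    have sum_app: "(\<Sum>x\<in>A. F x) j = (\<Sum>x\<in>A. F x j)" for A and F :: "nat \<Rightarrow> nat \<Rightarrow> real" and j
      by (induction A rule: infinite_finite_induct) auto
    have "0 = (\<Sum>l<n. (\<lambda>i. g (bas l) * bas l i)) i"
      using g by (simp add: sum.reindex[OF inj])
    also have "\<dots> = (\<Sum>l<n. g (bas l) * bas l i)" by (rule sum_app)
    also have "\<dots> = g (bas i)" using i
      by (simp add: bas_def if_distrib[of "\<lambda>x. _ * x"] sum.delta cong: if_cong)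
    finally show "g x = 0" using i by simp
  qed simp
  then have "card (bas ` {..<n}) \<le> card D"
    using fv.independent_span_bound[OF D(1)] 2 by blast
  then show False using D(2) card_image[OF inj] len L by simp
qed

end

section \<open>Normal forms in the free product\<close>

text \<open>A factor, \<open>True\<close> for the first, together with an image in the geometric
  representation, where \<open>prefix_nontrivial\<close> shows that simple elements survive.\<close>

type_synonym syllable = "bool \<times> ((nat \<Rightarrow> real) \<Rightarrow> nat \<Rightarrow> real)"

definition nfl :: "syllable list \<Rightarrow> bool" where
  "nfl l \<longleftrightarrow> (\<forall>x \<in> set l. snd x \<noteq> id) \<and> successively (\<lambda>x y. fst x \<noteq> fst y) l"

text \<open>Left multiplication of a normal form in a free product by one syllable. As with
  \<open>rcons\<close>, an action on normal forms stands in for the group.\<close>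

fun mulN :: "bool \<Rightarrow> ((nat \<Rightarrow> real) \<Rightarrow> nat \<Rightarrow> real) \<Rightarrow> syllable list \<Rightarrow> syllable list" where
  "mulN T f [] = (if f = id then [] else [(T, f)])"
| "mulN T f ((U, g) # l) =
     (if U = T then (if f \<circ> g = id then l else (T, f \<circ> g) # l)
      else if f = id then (U, g) # l else (T, f) # (U, g) # l)"

lemma nfl_Nil [simp]: "nfl []"
  by (simp add: nfl_def)

lemma nfl_Cons: "nfl (x # l) \<longleftrightarrow> snd x \<noteq> id \<and> nfl l \<and> (l \<noteq> [] \<longrightarrow> fst x \<noteq> fst (hd l))"
  by (cases l) (auto simp: nfl_def)

lemma nfl_mulN: "nfl l \<Longrightarrow> nfl (mulN T f l)"
  by (cases l rule: list.exhaust) (auto simp: nfl_Cons split: if_splits)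

lemma mulN_mulN: "nfl l \<Longrightarrow> mulN T f (mulN T g l) = mulN T (f \<circ> g) l"
proof (cases l)
  case (Cons x l')
  assume "nfl l"
  obtain U h where x: "x = (U, h)" by fastforce
  show ?thesis
  proof (cases "U = T \<and> g \<circ> h = id")
    case True
    then have "f \<circ> g \<circ> h = f" by (simp add: comp_assoc)
    then show ?thesis using True \<open>nfl l\<close> Cons x by (cases l') (auto simp: nfl_Cons)
  next
    case False
    show ?thesis
    proof (cases "U = T")
      case True
      then have "g \<circ> h \<noteq> id" using False by simp
      then show ?thesis using True Cons x by (simp add: comp_assoc)
    qed (simp add: Cons x)
  qed
qed simp

lemma mulN_id: "nfl l \<Longrightarrow> mulN T id l = l"
  by (cases l) (auto simp: nfl_Cons split: if_splits)

lemma mulN_other: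
  "f \<noteq> id \<Longrightarrow> l = [] \<or> fst (hd l) \<noteq> T \<Longrightarrow> mulN T f l = (T, f) # l"
  by (cases l) auto

locale free_coxeter = splitting n k + coxeter n M for n k M +
  assumes cross: "i < n \<Longrightarrow> j < n \<Longrightarrow> M i j = enat m \<Longrightarrow> (i < k) = (j < k)"
begin

definition actN :: "nat word \<Rightarrow> syllable list \<Rightarrow> syllable list" where
  "actN w = foldr (\<lambda>x. mulN (fst x < k) (refl (fst x))) w"

lemma actN_Nil [simp]: "actN [] l = l"
  and actN_Cons: "actN (x # w) l = mulN (fst x < k) (refl (fst x)) (actN w l)"
  and actN_append: "actN (u @ v) l = actN u (actN v l)"
  by (simp_all add: actN_def)

lemma nfl_actN: "nfl l \<Longrightarrow> nfl (actN w l)"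
  by (induction w) (auto simp: actN_Cons nfl_mulN)

lemma actN_pure:
  "nfl l \<Longrightarrow> \<forall>x \<in> set w. (fst x < k) = T \<Longrightarrow> actN w l = mulN T (rho w) l"
  by (induction w) (auto simp: actN_Cons mulN_id mulN_mulN rho_Cons)

text \<open>By \<open>cross\<close> a relator stays inside one factor, so it acts as a single
  syllable, and \<open>rho_relator\<close> makes this syllable trivial.\<close>

lemma actN_relator: "r \<in> coxeter_rels n M \<Longrightarrow> nfl l \<Longrightarrow> actN r l = l"
proof -
  assume r: "r \<in> coxeter_rels n M" and l: "nfl l"
  then obtain i j m where *: "r = concat (replicate m [(i, True), (j, True)])"
    "i < n" "j < n" "M i j = enat m" by (auto simp: coxeter_rels_def)
  then have "\<forall>x \<in> set r. (fst x < k) = (i < k)" using cross by auto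
  then show ?thesis using actN_pure[OF l, of r "i < k"] rho_relator[OF r] mulN_id[OF l] by simp
qed

lemma actN_pres_eq:
  assumes "pres_eq R u v" "R \<subseteq> coxeter_rels n M" "nfl l" shows "actN u l = actN v l"
  using assms(1,3)
proof (induction arbitrary: l rule: pres_eq.induct)
  case (cancel u a b v)
  have "refl a \<circ> refl a = id" by (auto simp: fun_eq_iff)
  then show ?case using nfl_actN[OF cancel, of v]
    by (simp add: actN_append actN_Cons mulN_mulN mulN_id)
next
  case (rel r u v)
  then show ?case using actN_relator assms(2) nfl_actN by (auto simp: actN_append)
qed auto

definition actF :: "fgrp \<Rightarrow> syllable list \<Rightarrow> syllable list" where "actF g = actN (rd g)"

lemma actF_fg: "nfl l \<Longrightarrow> actF (fg w) l = actN w l"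
  unfolding actF_def using actN_pres_eq[OF pres_eq_red[of "{}" w]] by (simp add: rd_fg)

lemma actF_add: "nfl l \<Longrightarrow> actF (a + b) l = actF a (actF b l)"
  by (metis actF_def actF_fg actN_append fg_append fg_rd)

lemma actF_pure: "nfl l \<Longrightarrow> pure T g \<Longrightarrow> actF g l = mulN T (rhoF g) l"
  unfolding actF_def rhoF_def by (rule actN_pure) (auto simp: pure_def ty_def)

text \<open>\<open>s\<close> counts syllables that survive in the representation, and the Booleans
  record the factors of the first and the last one, which decide whether two pieces may be
  joined.\<close>

inductive normal :: "nat \<Rightarrow> bool \<Rightarrow> fgrp \<Rightarrow> bool \<Rightarrow> bool" where
  single: "pure T g \<Longrightarrow> rhoF g \<noteq> id \<Longrightarrow> normal 1 T g T"
| join: "normal s T g U \<Longrightarrow> normal s' U' g' T' \<Longrightarrow> U \<noteq> U' \<Longrightarrow> normal (s + s') T (g + g') T'"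

lemma normal_pos: "normal s T g U \<Longrightarrow> s \<ge> 1"
  by (induction rule: normal.induct) auto

lemma normal_1: "normal s T g U \<Longrightarrow> s = 1 \<Longrightarrow> pure T g"
  by (cases rule: normal.cases) (auto dest!: normal_pos)

lemma rhoF_uminus_id: "rhoF (- g) = id \<longleftrightarrow> rhoF g = id"
proof -
  have "rhoF g = id" if "rhoF (- g) = id" for g
  proof
    fix v show "rhoF g v = id v" using rhoF_inv(1)[of g v] that by simp
  qed
  from this[of g] this[of "- g"] show ?thesis by auto
qed

lemma normal_uminus: "normal s T g U \<Longrightarrow> normal s U (- g) T"
proof (induction rule: normal.induct)
  case (single T g)
  then show ?case by (intro normal.single) (auto simp: pure_uminus rhoF_uminus_id)
next
  case (join s T g U s' U' g' T')
  have "normal (s' + s) T' (- g' + - g) T" by (rule normal.join) (use join in auto)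
  then show ?case by (simp add: minus_add add.commute del: add_uminus_conv_diff)
qed

text \<open>Each syllable is nontrivial and arrives in front of one from the other factor, so
  nothing merges and the syllable length of the image is that in the free group.\<close>

lemma normal_act:
  assumes "normal s T g U" "nfl l" "l = [] \<or> fst (hd l) \<noteq> U"
  shows "length (actF g l) = s + length l \<and> fst (hd (actF g l)) = T"
  using assms
proof (induction arbitrary: l rule: normal.induct)
  case (single T g)
  then show ?case by (simp add: actF_pure mulN_other)
next
  case (join s T g U s' U' g' T')
  have 1: "length (actF g' l) = s' + length l \<and> fst (hd (actF g' l)) = U'" using join by blast
  have 2: "nfl (actF g' l)" unfolding actF_def by (rule nfl_actN) fact
  have "length (actF g (actF g' l)) = s + length (actF g' l) \<and> fst (hd (actF g (actF g' l))) = T"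
    by (rule join.IH(1)[OF 2]) (use 1 join.hyps in auto)
  then show ?case using 1 join.prems by (simp add: actF_add)
qed

lemma Simp_nontrivial: "Simp g \<Longrightarrow> rhoF g \<noteq> id"
  unfolding Simp_def gens_def using prefix_nontrivial by blast

lemma pure_hty: "pure T g \<Longrightarrow> g \<noteq> 0 \<Longrightarrow> hty g = T \<and> lty g = T"
  by (simp add: pure_def)

text \<open>Recursion along the cuts of \<open>Simp_Good\<close> down to elements of one factor,
  which survive because they are simple. A piece may be simple only after inversion, hence
  \<open>normal_uminus\<close>.\<close>

lemma Simp_normal: "Simp g \<Longrightarrow> \<exists>s. normal s (hty g) g (lty g)"
proof (induction "len g" arbitrary: g rule: less_induct)
  case less
  have nz: "g \<noteq> 0" using less.prems Simp_nonzero by blast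
  have sub: "\<exists>s. normal s (hty e) e (lty e)" if se: "Simp e \<or> Simp (- e)" and le: "len e < len g" for e
    using se
  proof
    assume "Simp (- e)"
    then have "e \<noteq> 0" using Simp_nonzero[of "- e"] by auto
    obtain s where "normal s (hty (- e)) (- e) (lty (- e))"
      using less.hyps[of "- e"] \<open>Simp (- e)\<close> le by auto
    from normal_uminus[OF this] \<open>e \<noteq> 0\<close> show ?thesis by (auto simp: hty_uminus lty_uminus)
  qed (use less.hyps le in blast)
  from Simp_Good[OF less.prems] show ?case unfolding Good_def
  proof
    assume "\<exists>T. pure T g"
    then obtain T where T: "pure T g" by blast
    then have "normal 1 T g T" using Simp_nontrivial[OF less.prems] by (rule normal.single)
    moreover have "hty g = T" "lty g = T" using pure_hty[OF T nz] by simp_all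
    ultimately have "normal 1 (hty g) g (lty g)" by (simp only:)
    then show ?thesis by blast
  next
    assume "\<exists>e v. splits g e v"
    then obtain e v where ev: "splits g e v" by blast
    note d = ev[unfolded splits_def]
    have "len e < len g" "len v < len g" using d by auto
    then obtain s s' where "normal s (hty e) e (lty e)" "normal s' (hty v) v (lty v)"
      using sub d by blast
    then have "normal (s + s') (hty e) (e + v) (lty v)" using d by (intro normal.join) auto
    moreover have "hty g = hty e" "lty g = lty v" "g = e + v" using d by auto
    ultimately have "normal (s + s') (hty g) g (lty g)" by (simp only:)
    then show ?thesis by blast
  qed
qed

lemma pure_both: "pure True g \<Longrightarrow> pure False g \<Longrightarrow> g = 0"
  using rd_eq_Nil_iff[of g] by (cases "rd g") (auto simp: pure_def)

lemma upt_split: "[0..<n] = [0..<k] @ [k..<n]"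
  using kn upt_add_eq_append[of 0 k "n - k"] by simp

text \<open>The product of the first block is simple and acts on the empty normal form like c(1),
  which is one syllable of the first factor; so it is one syllable of that factor itself. The same
  holds for the second block and c(2).\<close>

lemma stabilizer_tuple:
  assumes w: "braid_word n w"
    and fixd: "hz w (map (\<lambda>i. pr R [(i, True)]) [0..<n]) = map (\<lambda>i. pr R [(i, True)]) [0..<n]"
    and R: "R \<subseteq> coxeter_rels n M"
  shows "heq (take k (hz w gens)) (map gx [0..<k]) \<and> heq (drop k (hz w gens)) (map gx [k..<n])"
proof -
  define t where "t = hurwitz w (map (\<lambda>i. [(i, True)]) [0..<n])"
  define L R' where "L = take k (hz w gens)" and "R' = drop k (hz w gens)"
  have X: "hz w gens = map fg t"
    unfolding t_def by (subst map_fg_hurwitz) (use w in \<open>simp_all add: gens_def gx_def[abs_def] comp_def\<close>)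
  have W: "map (pr R) t = map (\<lambda>i. pr R [(i, True)]) [0..<n]"
    unfolding t_def by (subst map_pr_hurwitz) (use w fixd in \<open>simp_all add: comp_def\<close>)
  have orb: "heq gens (L @ R')" using w unfolding heq_def L_def R'_def by (auto simp: gens_def)
  have len: "length L = k" "length R' = n - k" using kn by (simp_all add: L_def R'_def gens_def)
  then have ne: "L \<noteq> []" "R' \<noteq> []" using k0 kn by auto
  let ?c1 = "sum_list (map gx [0..<k])" and ?c2 = "sum_list (map gx [k..<n])"
  \<comment> \<open>Concatenating the words of a tuple lets \<open>actN_pres_eq\<close> carry
    equality modulo \<open>R\<close> over to the action on normal forms.\<close>
  have act: "actF (sum_list (map fg s)) [] = actF (sum_list (map gx is)) []"
    if "map (pr R) s = map (\<lambda>i. pr R [(i, True)]) is" for s "is"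
  proof -
    have prc: "pr R (concat s) = sum_list (map (pr R) s)" for s :: "nat word list"
      by (induction s) (auto simp: pr_append)
    have fgc: "fg (concat s) = sum_list (map fg s)" for s by (induction s) (auto simp: fg_append)
    have "pr R (concat s) = pr R (concat (map (\<lambda>i. [(i, True)]) is))"
      unfolding prc using that by (simp add: comp_def)
    then have "actN (concat s) [] = actN (concat (map (\<lambda>i. [(i, True)]) is)) []"
      unfolding pr_eq_iff by (rule actN_pres_eq[OF _ R]) simp
    then have "actF (fg (concat s)) [] = actF (fg (concat (map (\<lambda>i. [(i, True)]) is))) []"
      by (simp only: actF_fg[OF nfl_Nil])
    moreover have "map fg (map (\<lambda>i. [(i, True)]) is) = map gx is"
      by (simp add: gx_def[abs_def] comp_def)
    ultimately show ?thesis by (simp only: fgc)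
  qed
  have "take k (map (pr R) t) = take k (map (\<lambda>i. pr R [(i, True)]) [0..<n])"
    "drop k (map (pr R) t) = drop k (map (\<lambda>i. pr R [(i, True)]) [0..<n])"
    by (simp_all only: W)
  then have "map (pr R) (take k t) = map (\<lambda>i. pr R [(i, True)]) [0..<k]"
    "map (pr R) (drop k t) = map (\<lambda>i. pr R [(i, True)]) [k..<n]"
    unfolding upt_split by (simp_all add: take_map drop_map)
  then have a: "actF (sum_list L) [] = actF ?c1 []" "actF (sum_list R') [] = actF ?c2 []"
    using act unfolding L_def R'_def X by (simp_all add: take_map drop_map)
  have p: "pure True ?c1" "pure False ?c2"
    by (intro pure_sum_list, auto simp: list_all_iff pure_gx)+
  have g: "heq gens ([] @ map gx [0..<k] @ map gx [k..<n])" "heq gens (map gx [0..<k] @ map gx [k..<n] @ [])"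
    using upt_split by (simp_all add: gens_def)
  have c: "Simp ?c1" "Simp ?c2" using Simp_mid[OF g(1)] Simp_mid[OF g(2)] k0 kn by auto
  have S: "Simp (sum_list L)" "Simp (sum_list R')"
    using Simp_mid[of "[]" L R'] Simp_mid[of L R' "[]"] orb ne by auto
  have pure: "pure T g" if cc: "Simp g" "Simp c" "pure T c" "actF g [] = actF c []" for g c T
  proof -
    have "normal 1 T c T" using cc Simp_nontrivial[OF cc(2)] by (intro normal.single)
    moreover obtain s where s: "normal s (hty g) g (lty g)" using Simp_normal[OF cc(1)] by blast
    ultimately have "s = 1" "hty g = T"
      using normal_act[of 1 T c T "[]"] normal_act[OF s, of "[]"] cc(4) by auto
    then show ?thesis using normal_1[OF s] by simp
  qed
  have pg: "pure True (sum_list L)" "pure False (sum_list R')"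
    using pure[OF S(1) c(1) p(1) a(1)] pure[OF S(2) c(2) p(2) a(2)] .
  have "sum_list L + sum_list R' = ?c1 + ?c2"
    using heq_sum_list[OF orb] upt_split by (simp add: gens_def)
  \<comment> \<open>The left side lies in the first factor and the right side in the second, so both
    vanish.\<close>
  then have eq: "- ?c1 + sum_list L = ?c2 - sum_list R'" by (rule grp_swap)
  have "pure True (- ?c1 + sum_list L)" using pg p by (intro pure_add) (auto simp: pure_uminus)
  moreover have "pure False (?c2 - sum_list R')"
    using pure_add[of False ?c2 "- sum_list R'"] pg p by (auto simp: pure_uminus)
  ultimately have z: "- ?c1 + sum_list L = 0" "?c2 - sum_list R' = 0"
    using pure_both eq by metis+
  have "sum_list L = ?c1" using z(1) by (metis add.right_neutral add_minus_cancel)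
  moreover have "sum_list R' = ?c2" using z(2) by simp
  moreover have "list_all is_conj L" "list_all is_conj R'" using heq_gens_conj[OF orb] by auto
  ultimately show ?thesis using len
    unfolding L_def[symmetric] R'_def[symmetric] by (intro conjI Artin_reduction) auto
qed

lemma stabilizer_splits:
  assumes "braid_word n w"
    and "hz w (map (\<lambda>i. pr R [(i, True)]) [0..<n]) = map (\<lambda>i. pr R [(i, True)]) [0..<n]"
    and "R \<subseteq> coxeter_rels n M"
  shows "\<exists>u v. braid_word k u \<and> braid_word (n - k) v \<and> braid_eq n w (u @ shift_word k v)"
proof -
  define L R' where "L = take k (hz w gens)" and "R' = drop k (hz w gens)"
  have len: "length L = k" "length R' = n - k" using kn by (simp_all add: L_def R'_def gens_def)
  obtain u v where u: "braid_word k u" "hz u L = map gx [0..<k]"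
    and v: "braid_word (n - k) v" "hz v R' = map gx [k..<n]"
    using stabilizer_tuple[OF assms] len unfolding heq_def L_def[symmetric] R'_def[symmetric] by metis
  have LR: "hz w gens = L @ R'" by (simp add: L_def R'_def)
  have bw: "braid_word n (shift_word k v @ u)"
    using braid_word_shift[OF v(1), of k n] braid_word_mono[OF u(1), of n] kn by simp
  have "hz u (L @ R') = map gx [0..<k] @ R'" using hz_append1[of L u R'] u len by simp
  moreover have "hz (shift_word k v) (map gx [0..<k] @ R') = map gx [0..<k] @ hz v R'"
    using hz_append2[of R' v "map gx [0..<k]"] v len by simp
  ultimately have "hz ((shift_word k v @ u) @ w) gens = map gx [0..<k] @ map gx [k..<n]"
    using v by (simp add: hz_append LR)
  also have "\<dots> = gens" by (simp add: gens_def upt_split)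
  finally have "hz ((shift_word k v @ u) @ w) gens = gens" .
  then have "braid_eq n ((shift_word k v @ u) @ w) []"
    using Artin_faithful[of n "(shift_word k v @ u) @ w"] bw assms(1) by (simp add: gens_def)
  then have "pr (braid_rels n) (shift_word k v @ u) + pr (braid_rels n) w = 0"
    by (simp only: pr_eq_0_iff[symmetric] pr_append)
  then have "pr (braid_rels n) w = pr (braid_rels n) (winv (shift_word k v @ u))"
    unfolding pr_winv by (rule minus_unique[symmetric])
  then have "braid_eq n w (winv u @ shift_word k (winv v))" by (simp add: pr_eq_iff shift_word_winv)
  moreover have "braid_word k (winv u)" "braid_word (n - k) (winv v)" using u v by auto
  ultimately show ?thesis by blast
qed

end

section \<open>Stabilizers under homomorphisms and in free products of presentations\<close>

lemma wev_shift_word: "wev f (shift_word k w) = wev (\<lambda>i. f (i + k)) w"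
  by (induction w) (auto simp: shift_word_Cons wev_Cons)

lemma wev_zero: "wev (\<lambda>i. 0) w = 0"
  by (induction w) (auto simp: wev_Cons)

text \<open>The Hurwitz action commutes with homomorphisms, so the stabilizer of a tuple of
  generators also fixes the images of these generators.\<close>

lemma fixed_hom:
  assumes "braid_word (length is) w"
    and "hz w (map (\<lambda>i. pr R [(i, True)]) is) = map (\<lambda>i. pr R [(i, True)]) is"
    and "\<And>r. r \<in> R \<Longrightarrow> wev f r = 0"
  shows "hz w (map f is) = map f is"
proof -
  let ?g = "map (\<lambda>i. [(i, True)]) is"
  have "map (pr R) (hurwitz w ?g) = map (pr R) ?g"
    using map_pr_hurwitz[of ?g w R] assms by (simp add: comp_def)
  moreover have "wev f a = wev f b" if "pres_eq R a b" for a b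
    by (rule wev_pres_eq[OF that assms(3)])
  ultimately have "map (wev f) (hurwitz w ?g) = map (wev f) ?g"
    by (simp add: list_eq_iff_nth_eq pr_eq_iff)
  moreover have "map (wev f) (hurwitz w ?g) = hz w (map (wev f) ?g)"
    by (rule map_hurwitz) (use assms in auto)
  moreover have "map (wev f) ?g = map f is" by (simp add: wev_Cons)
  ultimately show ?thesis by metis
qed

lemma stab_iff:
  "w \<in> stab R m (gen_tuple m) \<longleftrightarrow> braid_word m w \<and>
     hz w (map (\<lambda>i. pr R [(i, True)]) [0..<m]) = map (\<lambda>i. pr R [(i, True)]) [0..<m]"
proof -
  let ?g = "gen_tuple m"
  have "list_all2 (pres_eq R) (hurwitz w ?g) ?g \<longleftrightarrow> map (pr R) (hurwitz w ?g) = map (pr R) ?g"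
    by (auto simp: list_all2_conv_all_nth list_eq_iff_nth_eq pr_eq_iff)
  moreover have "braid_word m w \<Longrightarrow> map (pr R) (hurwitz w ?g) = hz w (map (pr R) ?g)"
    by (rule map_pr_hurwitz) (simp add: gen_tuple_def)
  moreover have "map (pr R) ?g = map (\<lambda>i. pr R [(i, True)]) [0..<m]"
    by (simp add: gen_tuple_def comp_def)
  ultimately show ?thesis unfolding stab_def by auto
qed

lemma shift_gens: "map f [k..<n] = map (\<lambda>i. f (i + k)) [0..<n - k]" if "k \<le> n"
  using that by (intro nth_equalityI) (auto simp: add.commute)

text \<open>After splitting, the two blocks are acted on separately, and it remains to compare the
  stabilizer of one block in the free product with that in its factor. The map from the factor gives
  one direction; the retraction that kills the other generators, called \<open>f\<close>, gives the
  converse.\<close>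

lemma stab_free_product:
  assumes kn: "k \<le> n" and R: "R = R1 \<union> shift_word k ` R2"
    and R1: "\<And>r. r \<in> R1 \<Longrightarrow> fst ` set r \<subseteq> {..<k}"
    and split: "\<And>w. w \<in> stab R n (gen_tuple n) \<Longrightarrow>
      \<exists>u v. braid_word k u \<and> braid_word (n - k) v \<and> braid_eq n w (u @ shift_word k v)"
  shows "stab R n (gen_tuple n) =
    braid_prod n k (stab R1 k (gen_tuple k)) (stab R2 (n - k) (gen_tuple (n - k)))"
proof -
  let ?A = "map (\<lambda>i. pr R [(i, True)]) [0..<k]" and ?B = "map (\<lambda>i. pr R [(i, True)]) [k..<n]"
  have AB: "map (\<lambda>i. pr R [(i, True)]) [0..<n] = ?A @ ?B"
    using kn upt_add_eq_append[of 0 k "n - k"] by (simp flip: map_append)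
  have prod: "hz w (?A @ ?B) = hz u ?A @ hz v ?B"
    if "braid_word n w" "braid_word k u" "braid_word (n - k) v" "braid_eq n w (u @ shift_word k v)" for w u v
  proof -
    have "braid_word n (u @ shift_word k v)"
      using braid_word_shift[OF that(3), of k n] braid_word_mono[OF that(2), of n] kn by simp
    then have "hz w (?A @ ?B) = hz (u @ shift_word k v) (?A @ ?B)"
      by (intro hz_braid_eq[OF that(4)]) (use that kn in auto)
    also have "\<dots> = hz u (?A @ hz v ?B)" using hz_append2[of ?B v ?A] that by (simp add: hz_append)
    also have "\<dots> = hz u ?A @ hz v ?B" using hz_append1[of ?A u] that by simp
    finally show ?thesis .
  qed
  have A: "hz u ?A = ?A \<longleftrightarrow> u \<in> stab R1 k (gen_tuple k)" if u: "braid_word k u" for u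
  proof
    assume u1: "u \<in> stab R1 k (gen_tuple k)"
    show "hz u ?A = ?A"
    proof (rule fixed_hom[of _ _ R1])
      fix r assume "r \<in> R1"
      then show "wev (\<lambda>i. pr R [(i, True)]) r = 0"
        unfolding wev_pr pr_eq_0_iff using R by (intro pres_eq_relator) simp
    qed (use u u1[unfolded stab_iff] in simp_all)
  next
    define f where "f i = (if i < k then pr R1 [(i, True)] else 0)" for i
    assume fixd: "hz u ?A = ?A"
    have kill: "wev f r = 0" if rR: "r \<in> R" for r
    proof (cases "r \<in> R1")
      case True
      have "wev f r = wev (\<lambda>i. pr R1 [(i, True)]) r"
        by (rule wev_cong) (use R1[OF True] in \<open>auto simp: f_def\<close>)
      then show ?thesis using True by (simp add: wev_pr pr_eq_0_iff pres_eq_relator)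
    next
      case False
      then obtain r' where "r = shift_word k r'" using rR R by blast
      then show ?thesis by (simp add: wev_shift_word f_def wev_zero)
    qed
    have "hz u (map f [0..<k]) = map f [0..<k]"
      by (rule fixed_hom[OF _ fixd kill]) (use u in auto)
    moreover have "map f [0..<k] = map (\<lambda>i. pr R1 [(i, True)]) [0..<k]"
      by (rule map_cong) (auto simp: f_def)
    ultimately have "hz u (map (\<lambda>i. pr R1 [(i, True)]) [0..<k]) = map (\<lambda>i. pr R1 [(i, True)]) [0..<k]"
      by (simp only:)
    then show "u \<in> stab R1 k (gen_tuple k)" using u by (simp add: stab_iff)
  qed
  have B: "hz v ?B = ?B \<longleftrightarrow> v \<in> stab R2 (n - k) (gen_tuple (n - k))" if v: "braid_word (n - k) v" for v
  proof
    assume v2: "v \<in> stab R2 (n - k) (gen_tuple (n - k))"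
    show "hz v ?B = ?B" unfolding shift_gens[OF kn]
    proof (rule fixed_hom[of _ _ R2])
      fix r assume "r \<in> R2"
      then have "pr R (shift_word k r) = 0" using R by (simp add: pr_eq_0_iff pres_eq_relator)
      then show "wev (\<lambda>i. pr R [(i + k, True)]) r = 0"
        using wev_pr[of R "shift_word k r"] by (simp add: wev_shift_word)
    qed (use v v2[unfolded stab_iff] in simp_all)
  next
    define f where "f i = (if k \<le> i then pr R2 [(i - k, True)] else 0)" for i
    assume fixd: "hz v ?B = ?B"
    have kill: "wev f r = 0" if rR: "r \<in> R" for r
    proof (cases "r \<in> R1")
      case True
      have "wev f r = wev (\<lambda>i. 0 :: nat pgrp) r"
        by (rule wev_cong) (use R1[OF True] in \<open>auto simp: f_def\<close>)
      then show ?thesis by (simp add: wev_zero)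
    next
      case False
      then obtain r' where "r = shift_word k r'" "r' \<in> R2" using rR R by blast
      then show ?thesis by (simp add: wev_shift_word f_def wev_pr pr_eq_0_iff pres_eq_relator)
    qed
    have "hz v (map f [k..<n]) = map f [k..<n]"
      by (rule fixed_hom[OF _ fixd kill]) (use v in auto)
    then have "hz v (map (\<lambda>i. pr R2 [(i, True)]) [0..<n - k]) = map (\<lambda>i. pr R2 [(i, True)]) [0..<n - k]"
      unfolding shift_gens[OF kn] by (simp add: f_def)
    then show "v \<in> stab R2 (n - k) (gen_tuple (n - k))" using v by (simp add: stab_iff)
  qed
  show ?thesis
  proof (intro set_eqI iffI)
    fix w assume w: "w \<in> stab R n (gen_tuple n)"
    then obtain u v where uv: "braid_word k u" "braid_word (n - k) v" "braid_eq n w (u @ shift_word k v)"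
      using split by blast
    have bw: "braid_word n w" "hz w (?A @ ?B) = ?A @ ?B" using w unfolding stab_iff AB by auto
    then have "hz u ?A @ hz v ?B = ?A @ ?B" using prod uv by simp
    then have "hz u ?A = ?A" "hz v ?B = ?B" by (simp_all add: append_eq_append_conv)
    then show "w \<in> braid_prod n k (stab R1 k (gen_tuple k)) (stab R2 (n - k) (gen_tuple (n - k)))"
      unfolding braid_prod_def using A B uv bw by blast
  next
    fix w assume "w \<in> braid_prod n k (stab R1 k (gen_tuple k)) (stab R2 (n - k) (gen_tuple (n - k)))"
    then obtain u v where *: "braid_word n w" "u \<in> stab R1 k (gen_tuple k)"
      "v \<in> stab R2 (n - k) (gen_tuple (n - k))" "braid_eq n w (u @ shift_word k v)"
      unfolding braid_prod_def by blast
    then have uv: "braid_word k u" "braid_word (n - k) v" by (auto simp: stab_iff)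
    then have "hz w (?A @ ?B) = ?A @ ?B" using prod * A B by simp
    then show "w \<in> stab R n (gen_tuple n)" using * unfolding stab_iff AB by simp
  qed
qed

section \<open>Relators of the free product, and the theorem\<close>

lemma shift_alt_word: "shift_word k (alt_word i j m) = alt_word (i + k) (j + k) m"
  by (auto simp: alt_word_def shift_word_def)

lemma shift_concat_replicate:
  "shift_word k (concat (replicate m [(i, True), (j, True)])) = concat (replicate m [(i + k, True), (j + k, True)])"
  by (induction m) (auto simp: shift_word_Cons)

lemma free_prod_matrix_enat:
  "free_prod_matrix k M1 M2 i j = enat m \<longleftrightarrow>
     (i < k \<and> j < k \<and> M1 i j = enat m) \<or> (\<exists>i' j'. i = i' + k \<and> j = j' + k \<and> M2 i' j' = enat m)"
proof (cases "k \<le> i \<and> k \<le> j")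
  case True
  then obtain i' j' where "i = i' + k" "j = j' + k" by (metis add.commute le_Suc_ex)
  then show ?thesis by (simp add: free_prod_matrix_def)
qed (auto simp: free_prod_matrix_def)

text \<open>Infinite entries contribute no relators, so only those inside the two blocks remain. The
  parameter \<open>Q\<close> serves both presentations: it is \<open>i \<noteq> j\<close> for Artin
  relators and always true for Coxeter relators.\<close>

lemma relators_free_prod:
  assumes "k \<le> n" "\<And>i j m. shift_word k (rel i j m) = rel (i + k) (j + k) m"
    "\<And>i j. Q (i + k) (j + k) = Q i j"
  shows "{rel i j m | i j m. i < n \<and> j < n \<and> Q i j \<and> free_prod_matrix k M1 M2 i j = enat m} =
    {rel i j m | i j m. i < k \<and> j < k \<and> Q i j \<and> M1 i j = enat m} \<union>
    shift_word k ` {rel i j m | i j m. i < n - k \<and> j < n - k \<and> Q i j \<and> M2 i j = enat m}"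
    (is "?L = ?R1 \<union> shift_word k ` ?R2")
proof (intro set_eqI iffI)
  fix r assume "r \<in> ?L"
  then obtain i j m where r: "r = rel i j m" "i < n" "j < n" "Q i j"
    "free_prod_matrix k M1 M2 i j = enat m" by blast
  from r(5) show "r \<in> ?R1 \<union> shift_word k ` ?R2" unfolding free_prod_matrix_enat
  proof
    assume "\<exists>i' j'. i = i' + k \<and> j = j' + k \<and> M2 i' j' = enat m"
    then obtain i' j' where *: "i = i' + k" "j = j' + k" "M2 i' j' = enat m" by blast
    have "i' < n - k" "j' < n - k" "Q i' j'" using r * assms(3) by auto
    then have "rel i' j' m \<in> ?R2" using *(3) by blast
    moreover have "r = shift_word k (rel i' j' m)" using r * assms(2) by simp
    ultimately show ?thesis by blast
  qed (use r in blast)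
next
  fix r assume "r \<in> ?R1 \<union> shift_word k ` ?R2"
  then show "r \<in> ?L"
  proof
    assume "r \<in> ?R1"
    then obtain i j m where r: "r = rel i j m" "i < k" "j < k" "Q i j" "M1 i j = enat m" by blast
    then have "free_prod_matrix k M1 M2 i j = enat m" by (simp add: free_prod_matrix_enat)
    moreover have "i < n" "j < n" using r assms(1) by auto
    ultimately show ?thesis using r by blast
  next
    assume "r \<in> shift_word k ` ?R2"
    then obtain i j m where r: "r = shift_word k (rel i j m)" "i < n - k" "j < n - k" "Q i j"
      "M2 i j = enat m" by blast
    then have "free_prod_matrix k M1 M2 (i + k) (j + k) = enat m" by (auto simp: free_prod_matrix_enat)
    moreover have "i + k < n" "j + k < n" "Q (i + k) (j + k)" using r assms by auto
    ultimately show ?thesis using r assms(2) by blast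
  qed
qed

lemma coxeter_rels_free_prod:
  "k \<le> n \<Longrightarrow> coxeter_rels n (free_prod_matrix k M1 M2) =
    coxeter_rels k M1 \<union> shift_word k ` coxeter_rels (n - k) M2"
  using relators_free_prod[of k n "\<lambda>i j m. concat (replicate m [(i, True), (j, True)])" "\<lambda>_ _. True" M1 M2]
  by (simp add: coxeter_rels_def shift_concat_replicate)

lemma artin_rels_free_prod:
  "k \<le> n \<Longrightarrow> artin_rels n (free_prod_matrix k M1 M2) =
    artin_rels k M1 \<union> shift_word k ` artin_rels (n - k) M2"
  using relators_free_prod[of k n "\<lambda>i j m. alt_word i j m @ winv (alt_word j i m)" "\<lambda>i j. i \<noteq> j" M1 M2]
  by (simp add: artin_rels_def shift_alt_word shift_word_winv)

lemma coxeter_rels_letters: "r \<in> coxeter_rels k M \<Longrightarrow> fst ` set r \<subseteq> {..<k}"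
  by (auto simp: coxeter_rels_def split: if_splits)

lemma artin_rels_letters: "r \<in> artin_rels k M \<Longrightarrow> fst ` set r \<subseteq> {..<k}"
  by (auto simp: artin_rels_def alt_word_def set_winv split: if_splits)

lemma coxeter_matrix_free_prod:
  assumes "coxeter_matrix k M1" "coxeter_matrix (n - k) M2"
  shows "coxeter_matrix n (free_prod_matrix k M1 M2)"
  unfolding coxeter_matrix_def
proof (intro conjI allI impI)
  note d = assms[unfolded coxeter_matrix_def]
  fix i assume i: "i < n"
  show "free_prod_matrix k M1 M2 i i = 1" using i d by (auto simp: free_prod_matrix_def)
  fix j assume j: "j < n"
  show "free_prod_matrix k M1 M2 i j = free_prod_matrix k M1 M2 j i"
    using i j d by (auto simp: free_prod_matrix_def)
  assume ij: "i \<noteq> j"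
  have "i - k \<noteq> j - k" if "k \<le> i" "k \<le> j" using that ij by arith
  then show "free_prod_matrix k M1 M2 i j \<ge> 2"
    using i j ij d by (auto simp: free_prod_matrix_def)
qed

text \<open>Generators being involutions, the inverted half of an Artin relator continues the
  alternating word, so that the relator becomes a power of ij.\<close>

lemma artin_relator_coxeter:
  assumes M: "coxeter_matrix n M" and r: "r \<in> artin_rels n M"
  shows "wev (\<lambda>i. pr (coxeter_rels n M) [(i, True)]) r = 0"
proof -
  let ?R = "coxeter_rels n M"
  let ?p = "\<lambda>i. pr ?R [(i, True)]"
  obtain i j m where r: "r = alt_word i j m @ winv (alt_word j i m)"
    "i < n" "j < n" "M i j = enat m" using r by (auto simp: artin_rels_def)
  define f where "f a b t = (if even t then a else b)" for a b t :: nat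
  have alt: "alt_word a b m = map (\<lambda>x. (x, True)) (map (f a b) [0..<m])" for a b m
    by (simp add: alt_word_def f_def comp_def)
  define val where "val xs = sum_list (map ?p xs)" for xs
  have wval: "wev ?p (map (\<lambda>x. (x, True)) xs) = val xs" for xs
    by (simp add: wev_def val_def comp_def)
  have val_app: "val (xs @ ys) = val xs + val ys" for xs ys by (simp add: val_def)
  have inv: "- ?p a = ?p a" if "a < n" for a
  proof -
    have "M a a = enat 1" using M that by (simp add: coxeter_matrix_def one_enat_def)
    then have "concat (replicate 1 [(a, True), (a, True)]) \<in> ?R"
      using that unfolding coxeter_rels_def by blast
    then have "pr ?R [(a, True), (a, True)] = 0" by (simp add: pr_eq_0_iff pres_eq_relator)
    then have "?p a + ?p a = 0" using pr_append[of ?R "[(a, True)]" "[(a, True)]"] by simp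
    then show ?thesis by (rule minus_unique)
  qed
  have neg: "- val xs = val (rev xs)" if "set xs \<subseteq> {..<n}" for xs
    using that
  proof (induction xs)
    case (Cons a xs)
    have "- val (a # xs) = - val xs + - ?p a" by (simp only: val_def list.map sum_list.Cons minus_add)
    also have "\<dots> = val (rev xs) + ?p a" using Cons inv by simp
    finally show ?case by (simp add: val_def)
  qed (simp add: val_def)
  have "map (f i j) [0..<m] @ rev (map (f j i) [0..<m]) = map (f i j) [0..<2 * m]"
  proof (rule nth_equalityI)
    fix t assume "t < length (map (f i j) [0..<m] @ rev (map (f j i) [0..<m]))"
    then have t: "t < 2 * m" by simp
    show "(map (f i j) [0..<m] @ rev (map (f j i) [0..<m])) ! t = map (f i j) [0..<2 * m] ! t"
    proof (cases "t < m")
      case False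
      \<comment> \<open>Entry t of the whole is entry 2m - 1 - t of the second list before reversal.
        The parity is opposite, and so are the roles of \<open>i\<close> and
        \<open>j\<close>.\<close>
      then have "even (m - Suc (t - m)) \<longleftrightarrow> odd t" using t by presburger
      then show ?thesis using False t by (auto simp: nth_append rev_nth f_def)
    qed (use t in \<open>simp add: nth_append\<close>)
  qed simp
  moreover have "wev ?p r = val (map (f i j) [0..<m]) + val (rev (map (f j i) [0..<m]))"
  proof -
    have "set (map (f j i) [0..<m]) \<subseteq> {..<n}" using r by (auto simp: f_def)
    then show ?thesis by (simp only: r(1) alt wev_append wev_winv wval neg)
  qed
  ultimately have "wev ?p r = val (map (f i j) [0..<2 * m])"
    unfolding val_app[symmetric] by simp
  also have "map (f i j) [0..<2 * m] = concat (replicate m [i, j])" for m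
  proof (induction m)
    case (Suc m)
    have "map (f i j) [0..<2 * Suc m] = map (f i j) [0..<2 * m] @ [i, j]" by (simp add: f_def)
    also have "\<dots> = concat (replicate m [i, j] @ [[i, j]])" using Suc by simp
    also have "replicate m [i, j] @ [[i, j]] = replicate (Suc m) [i, j]"
      by (simp add: replicate_append_same)
    finally show ?case .
  qed simp
  also have "val (concat (replicate m [i, j])) = pr ?R (concat (replicate m [(i, True), (j, True)]))"
    unfolding wval[symmetric] wev_pr by (simp add: map_concat)
  also have "\<dots> = 0" unfolding pr_eq_0_iff
    by (rule pres_eq_relator) (use r in \<open>auto simp: coxeter_rels_def\<close>)
  finally show ?thesis .
qed

text \<open>The homomorphism from the Artin group to the Coxeter group takes one tuple of generators
  to the other.\<close>

lemma Hart_subset_Hcox: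
  assumes "coxeter_matrix n M" shows "Hart n M \<subseteq> Hcox n M"
proof
  fix w assume "w \<in> Hart n M"
  then have w: "braid_word n w" "hz w (map (\<lambda>i. pr (artin_rels n M) [(i, True)]) [0..<n]) =
      map (\<lambda>i. pr (artin_rels n M) [(i, True)]) [0..<n]"
    by (simp_all add: Hart_def stab_iff)
  have "hz w (map (\<lambda>i. pr (coxeter_rels n M) [(i, True)]) [0..<n]) =
      map (\<lambda>i. pr (coxeter_rels n M) [(i, True)]) [0..<n]"
    by (rule fixed_hom[OF _ w(2) artin_relator_coxeter[OF assms]]) (use w(1) in simp_all)
  then show "w \<in> Hcox n M" using w(1) by (simp add: Hcox_def stab_iff)
qed

lemma Hcox_splits:
  assumes "k \<le> n" "coxeter_matrix k M1" "coxeter_matrix (n - k) M2"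
    and w: "w \<in> Hcox n (free_prod_matrix k M1 M2)"
  shows "\<exists>u v. braid_word k u \<and> braid_word (n - k) v \<and> braid_eq n w (u @ shift_word k v)"
proof -
  have bw: "braid_word n w" using w by (simp add: Hcox_def stab_def)
  \<comment> \<open>The locale requires both blocks to be nonempty; in the extreme cases one block
    is empty and \<open>w\<close> itself is the other component.\<close>
  consider "k = 0" | "k = n" | "0 < k" "k < n" using assms(1) by linarith
  then show ?thesis
  proof cases
    case 1
    moreover have "shift_word 0 w = w" by (simp add: shift_word_def)
    ultimately show ?thesis using bw
      by (intro exI[of _ "[]"] exI[of _ w]) (simp add: pres_eq.refl)
  next
    case 2
    then show ?thesis using bw by (intro exI[of _ w] exI[of _ "[]"]) (simp add: pres_eq.refl)
  next
    case 3
    interpret free_coxeter n k "free_prod_matrix k M1 M2"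
      using 3 assms coxeter_matrix_free_prod
      by unfold_locales (auto simp: free_prod_matrix_enat)
    show ?thesis
      using w unfolding Hcox_def stab_iff by (intro stabilizer_splits) auto
  qed
qed

theorem theorem5p4:
  fixes n k :: nat and M1 M2 :: "nat \<Rightarrow> nat \<Rightarrow> enat"
  assumes "k \<le> n"
    and "coxeter_matrix k M1"
    and "coxeter_matrix (n - k) M2"
  shows "Hcox n (free_prod_matrix k M1 M2) =
           braid_prod n k (Hcox k M1) (Hcox (n - k) M2)
       \<and> Hart n (free_prod_matrix k M1 M2) =
           braid_prod n k (Hart k M1) (Hart (n - k) M2)
       \<and> (well_stabilized k M1 \<and> well_stabilized (n - k) M2
            \<longrightarrow> well_stabilized n (free_prod_matrix k M1 M2))"
proof -
  let ?M = "free_prod_matrix k M1 M2"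
  have split: "\<exists>u v. braid_word k u \<and> braid_word (n - k) v \<and> braid_eq n w (u @ shift_word k v)"
    if "w \<in> Hcox n ?M" for w
    by (rule Hcox_splits[OF assms that])
  have 1: "Hcox n ?M = braid_prod n k (Hcox k M1) (Hcox (n - k) M2)"
    unfolding Hcox_def
    by (rule stab_free_product[OF assms(1) coxeter_rels_free_prod[OF assms(1)] coxeter_rels_letters])
      (use split in \<open>auto simp: Hcox_def\<close>)
  have sub: "Hart n ?M \<subseteq> Hcox n ?M"
    by (rule Hart_subset_Hcox) (rule coxeter_matrix_free_prod[OF assms(2,3)])
  have 2: "Hart n ?M = braid_prod n k (Hart k M1) (Hart (n - k) M2)"
    unfolding Hart_def
    by (rule stab_free_product[OF assms(1) artin_rels_free_prod[OF assms(1)] artin_rels_letters])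
      (use split sub in \<open>auto simp: Hart_def\<close>)
  show ?thesis using 1 2 by (simp add: well_stabilized_def)
qed

end
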